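(* Let $\Gamma=(V,E,a,b,\gamma_0,\gamma_1)$ be a metric graph with $\inf_{e\in E}(b_e-a_e)>0$, and let $\hat H$ be the maximal first derivative operator in $\mathcal H_\Gamma=\bigoplus_{e\in E}L_2(a_e,b_e)$, i.e. $D(\hat H)=\bigoplus_{e\in E}W_2^1(a_e,b_e)$, $\hat Hf=(f_e')_{e\in E}$. Then an operator $H\subseteq\hat H$ is skew-self-adjoint if and only if there exists a unitary operator $L$ from $\ell_2(E_{\rm r})$ to $\ell_2(E_{\rm l})$ such that \[ D(H)=\{f\in D(\hat H) : L\operatorname{tr}_{\rm r} f=\operatorname{tr}_{\rm l} f\}. \]
   Context: All spaces are over $\mathbb K\in\{\mathbb R,\mathbb C\}$. Operators are linear; $H\subseteq\hat H$ means that $H$ is a restriction of $\hat H$ to a subspace $D(H)$ of $D(\hat H)$. $H$ is skew-self-adjoint if $H=-H^*$. Metric graph $\Gamma=(V,E,a,b,\gamma_0,\gamma_1)$: $V$ (vertices) and $E$ (edges) are sets, not assumed finite or countable; $a,b\colon E\to[-\infty,\infty]$ satisfy $a_e<b_e$, and edge $e$ corresponds to the interval $(a_e,b_e)\subseteq\mathbb R$. Put $E_{\rm l}=\{e\in E: a_e>-\infty\}$, $E_{\rm r}=\{e\in E: b_e<\infty\}$. The maps $\gamma_0\colon E_{\rm l}\to V$ and $\gamma_1\colon E_{\rm r}\to V$ assign starting and end vertices. Direct sums $\bigoplus_{e\in E}$ are Hilbert space direct sums (square-summable families of norms); $W_2^1(a_e,b_e)$ is the first order $L_2$-Sobolev space.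 The continuous linear maps $\operatorname{tr}_{\rm l}\colon\bigoplus_{e\in E}W_2^1(a_e,b_e)\to\ell_2(E_{\rm l})$ and $\operatorname{tr}_{\rm r}\colon\bigoplus_{e\in E}W_2^1(a_e,b_e)\to\ell_2(E_{\rm r})$ (well defined because the edge lengths have a positive lower bound) are given by $(\operatorname{tr}_{\rm l}f)(e)=f_e(a_e)$ for $e\in E_{\rm l}$ and $(\operatorname{tr}_{\rm r}f)(e)=f_e(b_e)$ for $e\in E_{\rm r}$, using continuous representatives extended to finite endpoints. *)

theory Defs
  imports "HOL-Analysis.Analysis"
begin

section \<open>Scalars\<close>

text \<open>
  The scalar field is \<open>\<real>\<close> or \<open>\<complex>\<close>. By the theorem of Frobenius these two types are, up to an
  isomorphism preserving the norm and the conjugation, the only instances of the following class.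
\<close>

class rc_scalar = real_normed_field + euclidean_space +
  fixes kconj :: "'a \<Rightarrow> 'a"
  assumes kconj_add: "kconj (x + y) = kconj x + kconj y"
    and kconj_mult: "kconj (x * y) = kconj x * kconj y"
    and kconj_kconj: "kconj (kconj x) = x"
    and kconj_scaleR: "kconj (r *\<^sub>R x) = r *\<^sub>R kconj x"
    and mult_kconj: "x * kconj x = ((norm x)\<^sup>2) *\<^sub>R 1"

instantiation real :: rc_scalar
begin
definition kconj_real :: "real \<Rightarrow> real" where "kconj_real x = x"
instance
  by standard (simp_all add: kconj_real_def power2_eq_square)
end

instantiation complex :: rc_scalar
begin
definition kconj_complex :: "complex \<Rightarrow> complex" where "kconj_complex z = cnj z"
instance
proof
  show "z * kconj z = ((norm z)\<^sup>2) *\<^sub>R 1" for z :: complex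
    by (simp add: kconj_complex_def complex_eq_iff cmod_power2 flip: power2_eq_square)
qed (simp_all add: kconj_complex_def)
end

section \<open>Function spaces on an interval\<close>

text \<open>
  Elements of \<open>L\<^sub>2\<close> are represented by square-integrable functions; equality in \<open>L\<^sub>2\<close> is equality
  almost everywhere. Nothing below depends on the choice of representatives, nor on the values of
  a function outside the interval.
\<close>

definition L2 :: "real set \<Rightarrow> (real \<Rightarrow> 'k::rc_scalar) set" where
  "L2 I = {f \<in> borel_measurable (lebesgue_on I). integrable (lebesgue_on I) (\<lambda>t. (norm (f t))\<^sup>2)}"

definition L2_inner :: "real set \<Rightarrow> (real \<Rightarrow> 'k::rc_scalar) \<Rightarrow> (real \<Rightarrow> 'k) \<Rightarrow> 'k" where
  "L2_inner I f g = (LINT t|lebesgue_on I. f t * kconj (g t))"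

definition L2_norm :: "real set \<Rightarrow> (real \<Rightarrow> 'k::rc_scalar) \<Rightarrow> real" where
  "L2_norm I f = sqrt (LINT t|lebesgue_on I. (norm (f t))\<^sup>2)"

text \<open>\<open>C\<^sub>c\<^sup>\<infinity>(I)\<close>; real-valued test functions suffice for both scalar fields.\<close>

definition test_functions :: "real set \<Rightarrow> (real \<Rightarrow> real) set" where
  "test_functions I = {\<phi>. (\<forall>n t. (deriv ^^ n) \<phi> field_differentiable at t) \<and>
     (\<exists>K. compact K \<and> K \<subseteq> I \<and> (\<forall>t. t \<notin> K \<longrightarrow> \<phi> t = 0))}"

definition has_weak_deriv :: "real set \<Rightarrow> (real \<Rightarrow> 'k::rc_scalar) \<Rightarrow> (real \<Rightarrow> 'k) \<Rightarrow> bool" where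
  "has_weak_deriv I f g \<longleftrightarrow> f \<in> L2 I \<and> g \<in> L2 I \<and>
     (\<forall>\<phi>\<in>test_functions I.
        (LINT t|lebesgue_on I. deriv \<phi> t *\<^sub>R f t) = - (LINT t|lebesgue_on I. \<phi> t *\<^sub>R g t))"

definition W12 :: "real set \<Rightarrow> (real \<Rightarrow> 'k::rc_scalar) set" where
  "W12 I = {f. \<exists>g. has_weak_deriv I f g}"

definition weak_deriv :: "real set \<Rightarrow> (real \<Rightarrow> 'k::rc_scalar) \<Rightarrow> (real \<Rightarrow> 'k)" where
  "weak_deriv I f = (SOME g. has_weak_deriv I f g)"

definition W12_norm :: "real set \<Rightarrow> (real \<Rightarrow> 'k::rc_scalar) \<Rightarrow> real" where
  "W12_norm I f = sqrt ((L2_norm I f)\<^sup>2 + (L2_norm I (weak_deriv I f))\<^sup>2)"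

text \<open>
  The continuous representative, extended to the finite endpoints of \<open>I\<close>: the closure is taken in
  \<open>\<real>\<close>, so it adds exactly these endpoints. Its values on \<open>closure I\<close> are uniquely determined.
\<close>

definition cont_rep :: "real set \<Rightarrow> (real \<Rightarrow> 'k::rc_scalar) \<Rightarrow> (real \<Rightarrow> 'k)" where
  "cont_rep I f = (SOME u. continuous_on (closure I) u \<and> (AE t in lebesgue_on I. u t = f t))"

section \<open>Metric graphs\<close>

definition E_l :: "'e set \<Rightarrow> ('e \<Rightarrow> ereal) \<Rightarrow> 'e set" where
  "E_l E a = {e \<in> E. a e > -\<infinity>}"

definition E_r :: "'e set \<Rightarrow> ('e \<Rightarrow> ereal) \<Rightarrow> 'e set" where
  "E_r E b = {e \<in> E. b e < \<infinity>}"

locale metric_graph =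
  fixes V :: "'v set" and E :: "'e set"
    and a b :: "'e \<Rightarrow> ereal"
    and \<gamma>0 \<gamma>1 :: "'e \<Rightarrow> 'v"
  assumes a_less_b: "e \<in> E \<Longrightarrow> a e < b e"
    and start_vertex: "\<gamma>0 ` E_l E a \<subseteq> V"
    and end_vertex: "\<gamma>1 ` E_r E b \<subseteq> V"

abbreviation edge :: "('e \<Rightarrow> ereal) \<Rightarrow> ('e \<Rightarrow> ereal) \<Rightarrow> 'e \<Rightarrow> real set" where
  "edge a b e \<equiv> einterval (a e) (b e)"

section \<open>Direct sums over the edges\<close>

definition hilbert_sum :: "'e set \<Rightarrow> ('e \<Rightarrow> 'x set) \<Rightarrow> ('e \<Rightarrow> 'x \<Rightarrow> real) \<Rightarrow> ('e \<Rightarrow> 'x) set" where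
  "hilbert_sum E X N = {f. (\<forall>e\<in>E. f e \<in> X e) \<and> (\<lambda>e. (N e (f e))\<^sup>2) summable_on E}"

definition graph_L2 ::
  "'e set \<Rightarrow> ('e \<Rightarrow> ereal) \<Rightarrow> ('e \<Rightarrow> ereal) \<Rightarrow> ('e \<Rightarrow> real \<Rightarrow> 'k::rc_scalar) set" where
  "graph_L2 E a b = hilbert_sum E (\<lambda>e. L2 (edge a b e)) (\<lambda>e. L2_norm (edge a b e))"

definition graph_W12 ::
  "'e set \<Rightarrow> ('e \<Rightarrow> ereal) \<Rightarrow> ('e \<Rightarrow> ereal) \<Rightarrow> ('e \<Rightarrow> real \<Rightarrow> 'k::rc_scalar) set" where
  "graph_W12 E a b = hilbert_sum E (\<lambda>e. W12 (edge a b e)) (\<lambda>e. W12_norm (edge a b e))"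

definition graph_inner ::
  "'e set \<Rightarrow> ('e \<Rightarrow> ereal) \<Rightarrow> ('e \<Rightarrow> ereal) \<Rightarrow>
   ('e \<Rightarrow> real \<Rightarrow> 'k::rc_scalar) \<Rightarrow> ('e \<Rightarrow> real \<Rightarrow> 'k) \<Rightarrow> 'k" where
  "graph_inner E a b f g = (\<Sum>\<^sub>\<infinity>e\<in>E. L2_inner (edge a b e) (f e) (g e))"

text \<open>Equality of the elements of \<open>\<Oplus>\<^sub>e L\<^sub>2(a\<^sub>e,b\<^sub>e)\<close> represented by \<open>f\<close> and \<open>g\<close>.\<close>

definition graph_eq ::
  "'e set \<Rightarrow> ('e \<Rightarrow> ereal) \<Rightarrow> ('e \<Rightarrow> ereal) \<Rightarrow>
   ('e \<Rightarrow> real \<Rightarrow> 'k::rc_scalar) \<Rightarrow> ('e \<Rightarrow> real \<Rightarrow> 'k) \<Rightarrow> bool" where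
  "graph_eq E a b f g \<longleftrightarrow> (\<forall>e\<in>E. AE t in lebesgue_on (edge a b e). f e t = g e t)"

definition ell2 :: "'e set \<Rightarrow> ('e \<Rightarrow> 'k::rc_scalar) set" where
  "ell2 J = {x. (\<forall>e. e \<notin> J \<longrightarrow> x e = 0) \<and> (\<lambda>e. (norm (x e))\<^sup>2) summable_on J}"

definition ell2_inner :: "'e set \<Rightarrow> ('e \<Rightarrow> 'k::rc_scalar) \<Rightarrow> ('e \<Rightarrow> 'k) \<Rightarrow> 'k" where
  "ell2_inner J x y = (\<Sum>\<^sub>\<infinity>e\<in>J. x e * kconj (y e))"

definition ell2_unitary ::
  "'e set \<Rightarrow> 'e set \<Rightarrow> (('e \<Rightarrow> 'k::rc_scalar) \<Rightarrow> ('e \<Rightarrow> 'k)) \<Rightarrow> bool" where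
  "ell2_unitary J J' L \<longleftrightarrow> bij_betw L (ell2 J) (ell2 J') \<and>
     (\<forall>x\<in>ell2 J. \<forall>y\<in>ell2 J. L (\<lambda>e. x e + y e) = (\<lambda>e. L x e + L y e)) \<and>
     (\<forall>c. \<forall>x\<in>ell2 J. L (\<lambda>e. c * x e) = (\<lambda>e. c * L x e)) \<and>
     (\<forall>x\<in>ell2 J. \<forall>y\<in>ell2 J. ell2_inner J' (L x) (L y) = ell2_inner J x y)"

section \<open>Traces\<close>

definition tr_l ::
  "'e set \<Rightarrow> ('e \<Rightarrow> ereal) \<Rightarrow> ('e \<Rightarrow> ereal) \<Rightarrow> ('e \<Rightarrow> real \<Rightarrow> 'k::rc_scalar) \<Rightarrow> ('e \<Rightarrow> 'k)" where
  "tr_l E a b f =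
     (\<lambda>e. if e \<in> E_l E a then cont_rep (edge a b e) (f e) (real_of_ereal (a e)) else 0)"

definition tr_r ::
  "'e set \<Rightarrow> ('e \<Rightarrow> ereal) \<Rightarrow> ('e \<Rightarrow> ereal) \<Rightarrow> ('e \<Rightarrow> real \<Rightarrow> 'k::rc_scalar) \<Rightarrow> ('e \<Rightarrow> 'k)" where
  "tr_r E a b f =
     (\<lambda>e. if e \<in> E_r E b then cont_rep (edge a b e) (f e) (real_of_ereal (b e)) else 0)"

section \<open>Operators\<close>

text \<open>
  An operator is identified with its graph, so that \<open>H \<subseteq> H'\<close> is literally restriction and
  \<open>D(H) = Domain H\<close>. As elements of the Hilbert space are given by representatives, a graph contains
  with a pair all its representatives, and single-valuedness is up to equality almost everywhere.
\<close>

definition graph_operator ::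
  "'e set \<Rightarrow> ('e \<Rightarrow> ereal) \<Rightarrow> ('e \<Rightarrow> ereal) \<Rightarrow>
   (('e \<Rightarrow> real \<Rightarrow> 'k::rc_scalar) \<times> ('e \<Rightarrow> real \<Rightarrow> 'k)) set \<Rightarrow> bool" where
  "graph_operator E a b H \<longleftrightarrow>
     H \<subseteq> graph_L2 E a b \<times> graph_L2 E a b \<and>
     (\<forall>f g f' g'. (f, g) \<in> H \<longrightarrow> f' \<in> graph_L2 E a b \<longrightarrow> g' \<in> graph_L2 E a b \<longrightarrow>
        graph_eq E a b f f' \<longrightarrow> graph_eq E a b g g' \<longrightarrow> (f', g') \<in> H) \<and>
     (\<forall>f g f' g'. (f, g) \<in> H \<longrightarrow> (f', g') \<in> H \<longrightarrow> graph_eq E a b f f' \<longrightarrow> graph_eq E a b g g') \<and>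
     ((\<lambda>e t. 0), (\<lambda>e t. 0)) \<in> H \<and>
     (\<forall>f g f' g'. (f, g) \<in> H \<longrightarrow> (f', g') \<in> H \<longrightarrow>
        ((\<lambda>e t. f e t + f' e t), (\<lambda>e t. g e t + g' e t)) \<in> H) \<and>
     (\<forall>c f g. (f, g) \<in> H \<longrightarrow> ((\<lambda>e t. c * f e t), (\<lambda>e t. c * g e t)) \<in> H)"

definition max_deriv ::
  "'e set \<Rightarrow> ('e \<Rightarrow> ereal) \<Rightarrow> ('e \<Rightarrow> ereal) \<Rightarrow>
   (('e \<Rightarrow> real \<Rightarrow> 'k::rc_scalar) \<times> ('e \<Rightarrow> real \<Rightarrow> 'k)) set" where
  "max_deriv E a b = {(f, g). f \<in> graph_W12 E a b \<and> g \<in> graph_L2 E a b \<and>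
     (\<forall>e\<in>E. has_weak_deriv (edge a b e) (f e) (g e))}"

text \<open>
  The adjoint as a linear relation; it is (the graph of) an operator iff \<open>H\<close> is densely defined.
  Thus an operator equal to the negative of its adjoint is automatically densely defined.
\<close>

definition graph_adjoint ::
  "'e set \<Rightarrow> ('e \<Rightarrow> ereal) \<Rightarrow> ('e \<Rightarrow> ereal) \<Rightarrow>
   (('e \<Rightarrow> real \<Rightarrow> 'k::rc_scalar) \<times> ('e \<Rightarrow> real \<Rightarrow> 'k)) set \<Rightarrow>
   (('e \<Rightarrow> real \<Rightarrow> 'k) \<times> ('e \<Rightarrow> real \<Rightarrow> 'k)) set" where
  "graph_adjoint E a b H = {(g, h). g \<in> graph_L2 E a b \<and> h \<in> graph_L2 E a b \<and>
     (\<forall>(u, v)\<in>H. graph_inner E a b v g = graph_inner E a b u h)}"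

definition rel_uminus ::
  "(('e \<Rightarrow> real \<Rightarrow> 'k::rc_scalar) \<times> ('e \<Rightarrow> real \<Rightarrow> 'k)) set \<Rightarrow>
   (('e \<Rightarrow> real \<Rightarrow> 'k) \<times> ('e \<Rightarrow> real \<Rightarrow> 'k)) set" where
  "rel_uminus H = {(f, \<lambda>e t. - g e t) | f g. (f, g) \<in> H}"

definition skew_self_adjoint ::
  "'e set \<Rightarrow> ('e \<Rightarrow> ereal) \<Rightarrow> ('e \<Rightarrow> ereal) \<Rightarrow>
   (('e \<Rightarrow> real \<Rightarrow> 'k::rc_scalar) \<times> ('e \<Rightarrow> real \<Rightarrow> 'k)) set \<Rightarrow> bool" where
  "skew_self_adjoint E a b H \<longleftrightarrow> H = rel_uminus (graph_adjoint E a b H)"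

end

theory Submission
  imports Defs
begin

text \<open>
  The theorem is a statement about boundary values only. On an edge, a function with a weak
  derivative is an indefinite integral of that derivative. It therefore has values at the finite
  endpoints, and it tends to zero at the infinite ones, so integration by parts on every edge and
  summation over the edges give Green's formula (\<open>Green_graph\<close>): for \<open>u\<close>, \<open>f\<close> in the domain of the
  maximal operator \<open>M\<close>,

  \<open>\<langle>M u, f\<rangle> + \<langle>u, M f\<rangle> = \<langle>tr\<^sub>r u, tr\<^sub>r f\<rangle> - \<langle>tr\<^sub>l u, tr\<^sub>l f\<rangle>\<close>.

  As the edge lengths have a positive lower bound, the pair of traces maps into
  \<open>\<ell>\<^sub>2(E\<^sub>r) \<times> \<ell>\<^sub>2(E\<^sub>l)\<close> (\<open>traces_ell2\<close>) and onto it (\<open>traces_surjective\<close>). By Green's formula, a pair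
  \<open>(f, M f)\<close> belongs to \<open>-H\<^sup>*\<close> iff the traces of \<open>f\<close> are orthogonal, for the indefinite form on the
  right-hand side, to the traces of all functions in \<open>D(H)\<close>
  (\<open>in_neg_adjoint_iff_traces\<close>).

  Let \<open>H = -H\<^sup>*\<close>. Then the set \<open>R\<close> of all pairs \<open>(tr\<^sub>r f, tr\<^sub>l f)\<close> with \<open>f \<in> D(H)\<close> is its own orthogonal
  complement for the indefinite form. Such a relation is isometric and closed, so its domain is a
  closed subspace of \<open>\<ell>\<^sub>2(E\<^sub>r)\<close>. If \<open>r\<close> is orthogonal to this domain, then \<open>(r, 0)\<close> is orthogonal to \<open>R\<close>
  and hence belongs to \<open>R\<close>, and isometry forces \<open>r = 0\<close>. So the domain is everything; by symmetry so is
  the range, and \<open>R\<close> is the graph of a unitary operator (\<open>self_orthogonal_unitary\<close>).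

  Conversely, let \<open>D(H)\<close> be given by a unitary \<open>L\<close>. Then \<open>D(H)\<close> contains the functions with vanishing
  traces, in particular the test functions on single edges, and pairing with those shows that
  \<open>-H\<^sup>*\<close> is a restriction of \<open>M\<close> (\<open>neg_adjoint_subset_max_deriv\<close>). Because \<open>L\<close> is isometric and onto,
  the trace condition that describes \<open>-H\<^sup>*\<close> inside \<open>M\<close> is again \<open>L tr\<^sub>r f = tr\<^sub>l f\<close>.

  The analysis below this argument is one-dimensional. A weak derivative is linked to an
  indefinite integral by the lemma of du Bois-Reymond (\<open>has_weak_deriv_primitive\<close>), which rests on
  smooth bump functions, and by integration by parts for absolutely continuous functions
  (\<open>primitive_on_prod\<close>).
\<close>

section \<open>Functions with a primitive, and integration by parts\<close>

text \<open>
  Absolute continuity with derivative \<open>g\<close>, asked for on compact subintervals only, so that \<open>J\<close> may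
  be unbounded. The Henstock-Kurzweil integral is used because it comes with the fundamental
  theorem of calculus and additivity on adjacent intervals.
\<close>

definition primitive_on :: "real set \<Rightarrow> (real \<Rightarrow> 'b::euclidean_space) \<Rightarrow> (real \<Rightarrow> 'b) \<Rightarrow> bool" where
  "primitive_on J u g \<longleftrightarrow> (\<forall>s\<in>J. \<forall>t\<in>J. s \<le> t \<longrightarrow>
     g absolutely_integrable_on {s..t} \<and> (g has_integral (u t - u s)) {s..t})"

lemma primitive_onD:
  assumes "primitive_on J u g" "s \<in> J" "t \<in> J" "s \<le> t"
  shows "g absolutely_integrable_on {s..t}" "(g has_integral (u t - u s)) {s..t}"
    "integral {s..t} g = u t - u s"
  using assms by (auto simp: primitive_on_def integral_unique)

lemma primitive_on_subset: "primitive_on J u g \<Longrightarrow> J' \<subseteq> J \<Longrightarrow> primitive_on J' u g"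
  by (auto simp: primitive_on_def)

lemma primitive_on_Icc_continuous:
  assumes "primitive_on {s..t} u g"
  shows "continuous_on {s..t} u"
proof (cases "s \<le> t")
  case True
  have "continuous_on {s..t} (\<lambda>x. u s + integral {s..x} g)"
    using primitive_onD[OF assms, of s t] True
    by (intro continuous_intros indefinite_integral_continuous_1) auto
  moreover have "u s + integral {s..x} g = u x" if "x \<in> {s..t}" for x
    using primitive_onD(3)[OF assms, of s x] that by auto
  ultimately show ?thesis by (rule continuous_on_eq)
qed auto

text \<open>
  Continuity is local, and within distance 1 of a point \<open>J\<close> looks like a compact interval.
\<close>

lemma primitive_on_continuous:
  assumes J: "is_interval J" "closed J" and u: "primitive_on J u g"
  shows "continuous_on J u"
  unfolding continuous_on_eq_continuous_within
proof
  fix x assume x: "x \<in> J"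
  have "compact (J \<inter> cball x 1)" "is_interval (J \<inter> cball x 1)"
    using J by (auto intro: closed_Int_compact is_interval_Int is_interval_cball_1)
  then obtain s t where st: "J \<inter> cball x 1 = {s..t}"
    using connected_compact_interval_1 is_interval_connected by blast
  have "continuous_on {s..t} u"
    by (rule primitive_on_Icc_continuous[OF primitive_on_subset[OF u]]) (use st in auto)
  moreover have "x \<in> {s..t}" using x st by auto
  ultimately have c: "continuous (at x within J \<inter> cball x 1) u"
    unfolding st by (simp add: continuous_on_eq_continuous_within)
  have "at x within J = at x within J \<inter> cball x 1"
    by (rule at_within_nhd[of _ "ball x 1"]) auto
  then show "continuous (at x within J) u"
    using c by (simp add: continuous_within)
qed

lemma absolutely_integrable_continuous_product:
  fixes g :: "real \<Rightarrow> 'b::euclidean_space" and w :: "real \<Rightarrow> 'a::euclidean_space"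
    and h :: "'a \<Rightarrow> 'b \<Rightarrow> 'c::euclidean_space"
  assumes "bounded_bilinear h" "continuous_on {s..t} w" "g absolutely_integrable_on {s..t}"
  shows "(\<lambda>x. h (w x) (g x)) absolutely_integrable_on {s..t}"
proof (rule absolutely_integrable_bounded_measurable_product[where h = h])
  show "bilinear h" using assms(1) by (simp add: bilinear_conv_bounded_bilinear)
  show "w \<in> borel_measurable (lebesgue_on {s..t})"
    by (intro continuous_imp_measurable_on_sets_lebesgue assms) auto
  show "bounded (w ` {s..t})"
    by (intro compact_imp_bounded compact_continuous_image assms) auto
qed (use assms in auto)

text \<open>
  Integration by parts without derivatives. Let \<open>W y z\<close> be the increment of \<open>h (u x) (v x)\<close> over
  \<open>[y, z]\<close> minus the integral of the claimed derivative. It equals the integral of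
  \<open>h (g \<tau>) (v z - v \<tau>) + h (u y - u \<tau>) (k \<tau>)\<close>, so by uniform continuity \<open>W y z\<close> is at most \<open>\<epsilon>\<close> times a
  multiple of \<open>\<integral> |g| + |k|\<close> on short intervals. Both sides of this bound are additive in the interval,
  hence it passes from short intervals to \<open>[s, t]\<close> by bisection, and \<open>\<epsilon>\<close> is arbitrary.
\<close>

lemma primitive_on_prod:
  fixes u g :: "real \<Rightarrow> 'a::euclidean_space" and v k :: "real \<Rightarrow> 'b::euclidean_space"
    and h :: "'a \<Rightarrow> 'b \<Rightarrow> 'c::euclidean_space"
  assumes h: "bounded_bilinear h" and J: "is_interval J"
    and u: "primitive_on J u g" and v: "primitive_on J v k"
  shows "primitive_on J (\<lambda>x. h (u x) (v x)) (\<lambda>x. h (g x) (v x) + h (u x) (k x))"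
  unfolding primitive_on_def
proof (intro ballI impI)
  fix s t assume st: "s \<in> J" "t \<in> J" "s \<le> t"
  interpret h: bounded_bilinear h by (rule h)
  let ?F = "\<lambda>x. h (g x) (v x) + h (u x) (k x)"
  have sub: "{s..t} \<subseteq> J"
    using mem_is_interval_1_I[OF J st(1,2)] by (simp add: subset_iff)
  note u' = primitive_on_subset[OF u sub] and v' = primitive_on_subset[OF v sub]
  note cu = primitive_on_Icc_continuous[OF u'] and cv = primitive_on_Icc_continuous[OF v']
  have ai1: "(\<lambda>x. h (g x) (w x)) absolutely_integrable_on {x..y}"
    and ai2: "(\<lambda>x. h (w' x) (k x)) absolutely_integrable_on {x..y}"
    if "{x..y} \<subseteq> {s..t}" "continuous_on {x..y} w" "continuous_on {x..y} w'" for x y w w'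
  proof -
    have "g absolutely_integrable_on {x..y}" "k absolutely_integrable_on {x..y}"
      using that(1) primitive_onD(1)[OF u', of x y] primitive_onD(1)[OF v', of x y]
      by (cases "x \<le> y"; auto)+
    then show "(\<lambda>x. h (g x) (w x)) absolutely_integrable_on {x..y}"
      "(\<lambda>x. h (w' x) (k x)) absolutely_integrable_on {x..y}"
      using absolutely_integrable_continuous_product[OF h.flip that(2)]
        absolutely_integrable_continuous_product[OF h that(3)] by blast+
  qed
  have aiF: "?F absolutely_integrable_on {x..y}" if "{x..y} \<subseteq> {s..t}" for x y
    using ai1 ai2 that continuous_on_subset[OF cu that] continuous_on_subset[OF cv that]
    by (intro set_integral_add(1)) blast+
  have N: "(\<lambda>x. norm (g x)) integrable_on {x..y}" "(\<lambda>x. norm (k x)) integrable_on {x..y}"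
    if "s \<le> x" "x \<le> y" "y \<le> t" for x y
    using primitive_onD(1)[OF u', of x y] primitive_onD(1)[OF v', of x y] that
    by (auto simp: absolutely_integrable_on_def)
  obtain K where K: "K > 0" "\<And>x y. norm (h x y) \<le> norm x * norm y * K"
    using h.pos_bounded by blast
  define M where "M x y = integral {x..y} (\<lambda>z. norm (g z)) + integral {x..y} (\<lambda>z. norm (k z))" for x y
  define W where "W x y = h (u y) (v y) - h (u x) (v x) - integral {x..y} ?F" for x y
  have Mst: "M s t \<ge> 0"
    unfolding M_def by (intro add_nonneg_nonneg integral_nonneg N) (use st in auto)
  have main: "norm (W s t) \<le> \<epsilon> * K * M s t" if e: "\<epsilon> > 0" for \<epsilon>
  proof -
    have "uniformly_continuous_on {s..t} u" "uniformly_continuous_on {s..t} v"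
      using cu cv by (auto intro: compact_uniformly_continuous)
    then obtain d1 d2 where d: "d1 > 0" "d2 > 0"
      "\<And>x y. x \<in> {s..t} \<Longrightarrow> y \<in> {s..t} \<Longrightarrow> dist y x < d1 \<Longrightarrow> dist (u y) (u x) < \<epsilon>"
      "\<And>x y. x \<in> {s..t} \<Longrightarrow> y \<in> {s..t} \<Longrightarrow> dist y x < d2 \<Longrightarrow> dist (v y) (v x) < \<epsilon>"
      using e unfolding uniformly_continuous_on_def by metis
    define P where "P x y \<longleftrightarrow> (s \<le> x \<and> x \<le> y \<and> y \<le> t \<longrightarrow> norm (W x y) \<le> \<epsilon> * K * M x y)" for x y
    have "P s t"
      using \<open>s \<le> t\<close>
    proof (induction rule: Bolzano)
      case (trans x y z)
      show ?case unfolding P_def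
      proof
        assume A: "s \<le> x \<and> x \<le> z \<and> z \<le> t"
        have "W x z = W x y + W y z"
          using aiF[of x z] A trans unfolding W_def
          by (subst Henstock_Kurzweil_Integration.integral_combine[of x y z ?F, symmetric])
             (auto simp: absolutely_integrable_on_def)
        then have "norm (W x z) \<le> norm (W x y) + norm (W y z)" by (simp add: norm_triangle_ineq)
        also have "\<dots> \<le> \<epsilon> * K * M x y + \<epsilon> * K * M y z"
          using trans A by (intro add_mono) (auto simp: P_def)
        also have "\<dots> = \<epsilon> * K * M x z"
          unfolding M_def using trans A N[of x z]
          by (auto simp: Henstock_Kurzweil_Integration.integral_combine[of x y z, symmetric] algebra_simps)
        finally show "norm (W x z) \<le> \<epsilon> * K * M x z" .
      qed
    next
      case (local x)
      show ?case
      proof (intro exI[of _ "min d1 d2"] conjI allI impI)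
        show "min d1 d2 > 0" using d by auto
      next
        fix y z assume yz: "y \<le> x \<and> x \<le> z \<and> z - y < min d1 d2"
        show "P y z" unfolding P_def
        proof
          assume A: "s \<le> y \<and> y \<le> z \<and> z \<le> t"
          let ?G = "\<lambda>\<tau>. h (g \<tau>) (v z - v \<tau>) + h (u y - u \<tau>) (k \<tau>)"
          have yzsub: "{y..z} \<subseteq> {s..t}" using A by auto
          have ci: "continuous_on {y..z} u" "continuous_on {y..z} v"
            using yzsub cu cv by (auto intro: continuous_on_subset)
          have ig: "(g has_integral (u z - u y)) {y..z}" "(k has_integral (v z - v y)) {y..z}"
            using primitive_onD(2)[OF u', of y z] primitive_onD(2)[OF v', of y z] A by auto
          have "((\<lambda>\<tau>. h (g \<tau>) (v z)) has_integral h (u z - u y) (v z)) {y..z}"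
            "((\<lambda>\<tau>. h (u y) (k \<tau>)) has_integral h (u y) (v z - v y)) {y..z}"
            using has_integral_linear[OF ig(1) h.bounded_linear_left[of "v z"]]
              has_integral_linear[OF ig(2) h.bounded_linear_right[of "u y"]]
            by (simp_all add: o_def)
          moreover have "(?F has_integral integral {y..z} ?F) {y..z}"
            using aiF[OF yzsub] by (auto simp: absolutely_integrable_on_def)
          ultimately have "((\<lambda>\<tau>. (h (g \<tau>) (v z) + h (u y) (k \<tau>)) - ?F \<tau>) has_integral
              (h (u z - u y) (v z) + h (u y) (v z - v y) - integral {y..z} ?F)) {y..z}"
            by (intro has_integral_diff has_integral_add)
          also have "(\<lambda>\<tau>. (h (g \<tau>) (v z) + h (u y) (k \<tau>)) - ?F \<tau>) = ?G"
            by (auto simp: h.diff_left h.diff_right)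
          also have "h (u z - u y) (v z) + h (u y) (v z - v y) - integral {y..z} ?F = W y z"
            by (simp add: W_def h.diff_left h.diff_right)
          finally have hW: "(?G has_integral W y z) {y..z}" .
          have "norm (integral {y..z} ?G) \<le> integral {y..z} (\<lambda>\<tau>. \<epsilon> * K * (norm (g \<tau>) + norm (k \<tau>)))"
          proof (rule integral_norm_bound_integral)
            show "?G integrable_on {y..z}" using hW by auto
            show "(\<lambda>\<tau>. \<epsilon> * K * (norm (g \<tau>) + norm (k \<tau>))) integrable_on {y..z}"
              using N[of y z] A by (intro integrable_on_mult_right integrable_add) auto
            fix \<tau> assume t: "\<tau> \<in> {y..z}"
            have 1: "norm (v z - v \<tau>) \<le> \<epsilon>" "norm (u y - u \<tau>) \<le> \<epsilon>"
              using d(3)[of \<tau> y] d(4)[of \<tau> z] t yz A by (auto simp: dist_norm dist_real_def)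
            have "norm (?G \<tau>) \<le> norm (h (g \<tau>) (v z - v \<tau>)) + norm (h (u y - u \<tau>) (k \<tau>))"
              by (rule norm_triangle_ineq)
            also have "\<dots> \<le> norm (g \<tau>) * norm (v z - v \<tau>) * K + norm (u y - u \<tau>) * norm (k \<tau>) * K"
              by (intro add_mono K)
            also have "\<dots> \<le> norm (g \<tau>) * \<epsilon> * K + \<epsilon> * norm (k \<tau>) * K"
              using 1 K by (intro add_mono mult_right_mono mult_left_mono) auto
            finally show "norm (?G \<tau>) \<le> \<epsilon> * K * (norm (g \<tau>) + norm (k \<tau>))"
              by (simp add: algebra_simps)
          qed
          also have "\<dots> = \<epsilon> * K * M y z"
            using N[of y z] A unfolding M_def
            by (simp add: Henstock_Kurzweil_Integration.integral_add)
          finally show "norm (W y z) \<le> \<epsilon> * K * M y z"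
            using hW by (simp add: integral_unique)
        qed
      qed
    qed
    then show ?thesis using st by (simp add: P_def)
  qed
  have "norm (W s t) \<le> 0"
  proof (rule field_le_epsilon)
    fix e :: real assume "e > 0"
    have "norm (W s t) \<le> (e / (K * (M s t + 1))) * K * M s t"
      using Mst K \<open>e > 0\<close> by (intro main) auto
    also have "\<dots> = e * (M s t / (M s t + 1))" using K by simp
    also have "\<dots> \<le> e * 1" using Mst \<open>e > 0\<close> by (intro mult_left_mono) auto
    finally show "norm (W s t) \<le> 0 + e" by simp
  qed
  then have "integral {s..t} ?F = h (u t) (v t) - h (u s) (v s)" by (simp add: W_def)
  with aiF[of s t] show "?F absolutely_integrable_on {s..t} \<and>
      (?F has_integral (h (u t) (v t) - h (u s) (v s))) {s..t}"
    by (auto simp: absolutely_integrable_on_def has_integral_iff)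
qed

section \<open>Bump functions and the fundamental lemma of the calculus of variations\<close>

lemma AE_lebesgue_on_iff_negligible:
  assumes "S \<in> sets lebesgue"
  shows "(AE x in lebesgue_on S. P x) \<longleftrightarrow> negligible {x \<in> S. \<not> P x}"
proof -
  have "(AE x in lebesgue_on S. P x) \<longleftrightarrow> (AE x in lebesgue. x \<in> S \<longrightarrow> P x)"
    using assms by (simp add: AE_restrict_space_iff)
  also have "\<dots> \<longleftrightarrow> negligible {x \<in> S. \<not> P x}"
  proof
    assume "AE x in lebesgue. x \<in> S \<longrightarrow> P x"
    then obtain N where "N \<in> null_sets lebesgue" "{x. \<not> (x \<in> S \<longrightarrow> P x)} \<subseteq> N"
      by (auto simp: eventually_ae_filter)
    then show "negligible {x \<in> S. \<not> P x}"
      by (auto simp: negligible_iff_null_sets[symmetric] intro: negligible_subset[of N])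
  next
    assume "negligible {x \<in> S. \<not> P x}"
    then show "AE x in lebesgue. x \<in> S \<longrightarrow> P x"
      by (intro AE_I'[of "{x \<in> S. \<not> P x}"]) (auto simp: negligible_iff_null_sets)
  qed
  finally show ?thesis .
qed

text \<open>
  For \<open>p = 1\<close> and \<open>k = 0\<close> this is the classical bump \<open>exp (- c / w)\<close> with \<open>w = (x - s) (t - x)\<close>. The
  polynomial and the power of \<open>w\<close> make the family closed under differentiation, so that smoothness
  follows from first derivatives.
\<close>

definition bump :: "real \<Rightarrow> real \<Rightarrow> real \<Rightarrow> real poly \<Rightarrow> nat \<Rightarrow> real \<Rightarrow> real" where
  "bump c s t p k x = (if s < x \<and> x < t
     then poly p x * exp (- c / ((x - s) * (t - x))) / ((x - s) * (t - x)) ^ k else 0)"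

lemma power_div_fact_le_exp:
  fixes z :: real assumes "z \<ge> 0"
  shows "z ^ n / fact n \<le> exp z"
proof -
  have "(\<Sum>i\<in>{n}. inverse (fact i) * z ^ i) \<le> (\<Sum>i. inverse (fact i) * z ^ i)"
    using assms by (intro sum_le_suminf summable_exp) auto
  then show ?thesis by (simp add: exp_def field_simps)
qed

lemma has_real_derivative_zero_if_quadratic:
  fixes f :: "real \<Rightarrow> real"
  assumes "\<And>y. \<bar>f y\<bar> \<le> K * (y - x)\<^sup>2"
  shows "(f has_real_derivative 0) (at x)"
proof -
  have fx: "f x = 0" using assms[of x] by simp
  have "((\<lambda>y. (f y - f x) / (y - x)) \<longlongrightarrow> 0) (at x)"
  proof (rule Lim_null_comparison)
    show "\<forall>\<^sub>F y in at x. norm ((f y - f x) / (y - x)) \<le> K * \<bar>y - x\<bar>"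
      unfolding eventually_at_filter
    proof (intro always_eventually allI impI)
      fix y assume "y \<noteq> x"
      moreover have "\<bar>f y\<bar> \<le> K * \<bar>y - x\<bar> * \<bar>y - x\<bar>"
        using assms[of y] by (simp add: power2_eq_square mult.assoc)
      ultimately show "norm ((f y - f x) / (y - x)) \<le> K * \<bar>y - x\<bar>"
        by (simp add: fx pos_divide_le_eq)
    qed
    show "((\<lambda>y. K * \<bar>y - x\<bar>) \<longlongrightarrow> 0) (at x)"
      by (rule tendsto_eq_intros | simp)+
  qed
  then show ?thesis by (simp add: has_field_derivative_iff)
qed

text \<open>
  The exponential beats every power of \<open>w\<close> as \<open>w\<close> tends to 0: one term of the exponential series
  gives \<open>exp (c / w) \<ge> (c / w) ^ (k + 2) / fact (k + 2)\<close>. A quadratic bound is what makes the derivative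
  at the points \<open>s\<close> and \<open>t\<close> zero.
\<close>

lemma bump_quadratic_bound:
  assumes c: "c > 0"
  obtains K where "\<And>y. \<bar>bump c s t p k y\<bar> \<le> K * ((y - s) * (t - y))\<^sup>2"
proof -
  have "bounded (poly p ` {s..t})"
    by (intro compact_imp_bounded compact_continuous_image continuous_intros) auto
  then obtain B where B: "\<And>x. x \<in> {s..t} \<Longrightarrow> \<bar>poly p x\<bar> \<le> B" "B \<ge> 0"
    unfolding bounded_iff by (metis abs_ge_zero imageI norm_ge_zero real_norm_def order_trans abs_ge_self bounded_iff max.cobounded1 max.coboundedI2 max.cobounded2)
  have "\<bar>bump c s t p k y\<bar> \<le> B * (fact (k + 2) / c ^ (k + 2)) * ((y - s) * (t - y))\<^sup>2" for y
  proof (cases "s < y \<and> y < t")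
    case True
    define w where "w = (y - s) * (t - y)"
    have w: "w > 0" using True by (simp add: w_def)
    have "(c / w) ^ (k + 2) / fact (k + 2) \<le> exp (c / w)"
      using c w by (intro power_div_fact_le_exp) auto
    then have "exp (- c / w) \<le> fact (k + 2) * w ^ (k + 2) / c ^ (k + 2)"
      using c w by (simp add: exp_minus field_simps del: fact_Suc power_Suc)
    then have "exp (- c / w) / w ^ k \<le> fact (k + 2) * w ^ (k + 2) / c ^ (k + 2) / w ^ k"
      using w by (intro divide_right_mono) auto
    also have "\<dots> = fact (k + 2) / c ^ (k + 2) * w\<^sup>2"
      using w by (simp add: power_add power2_eq_square del: fact_Suc)
    finally have "\<bar>poly p y\<bar> * (exp (- c / w) / w ^ k) \<le> B * (fact (k + 2) / c ^ (k + 2) * w\<^sup>2)"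
      using B True w by (intro mult_mono) auto
    moreover have "\<bar>bump c s t p k y\<bar> = \<bar>poly p y\<bar> * (exp (- c / w) / w ^ k)"
      using True w by (simp add: bump_def w_def[symmetric] abs_mult)
    ultimately show ?thesis by (simp add: w_def mult.assoc)
  next
    case False
    then show ?thesis using B c by (auto simp: bump_def intro!: mult_nonneg_nonneg)
  qed
  then show ?thesis by (rule that)
qed

text \<open>
  The numerator that the product and quotient rules produce over the common denominator
  \<open>w ^ (k + 2)\<close>.
\<close>

definition bump_deriv_poly :: "real \<Rightarrow> real \<Rightarrow> real \<Rightarrow> real poly \<Rightarrow> nat \<Rightarrow> real poly" where
  "bump_deriv_poly c s t p k = (let w = [:-s, 1:] * [:t, -1:] in
     pderiv p * w\<^sup>2 - smult (real k) (p * w * pderiv w) + smult c (p * pderiv w))"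

lemma bump_has_derivative:
  assumes c: "c > 0"
  shows "(bump c s t p k has_real_derivative bump c s t (bump_deriv_poly c s t p k) (k + 2) x) (at x)"
proof -
  consider (int) "s < x \<and> x < t" | (bd) "x = s \<or> x = t" | (ext) "x < s \<or> t < x" by linarith
  then show ?thesis
  proof cases
    case int
    define w where "w = [:-s, 1:] * [:t, -1:]"
    have pw: "poly w y = (y - s) * (t - y)" for y by (simp add: w_def algebra_simps)
    have wx: "poly w x > 0" using int by (simp add: pw)
    have "((\<lambda>y. poly p y * exp (- c / poly w y) / poly w y ^ k) has_real_derivative
        (poly (bump_deriv_poly c s t p k) x * exp (- c / poly w x) / poly w x ^ (k + 2))) (at x)"
    proof -
      define g where "g y = poly w y ^ k" for y
      have gx: "g x > 0" "poly w x ^ (k + 2) = g x * (poly w x)\<^sup>2"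
        using wx by (auto simp: g_def power_add power2_eq_square)
      have dg: "(g has_real_derivative real k * poly (pderiv w) x * g x / poly w x) (at x)"
      proof (cases k)
        case (Suc m)
        show ?thesis
          unfolding Suc g_def
          by (rule DERIV_cong[OF DERIV_power_Suc[OF poly_DERIV]]) (use wx in \<open>simp add: field_simps\<close>)
      qed (simp add: g_def[abs_def])
      show ?thesis
        using wx gx unfolding bump_deriv_poly_def Let_def w_def[symmetric] gx(2) g_def[symmetric]
        by (auto intro!: derivative_eq_intros dg simp: field_simps power2_eq_square)
    qed
    then have "((\<lambda>y. poly p y * exp (- c / poly w y) / poly w y ^ k) has_real_derivative
        bump c s t (bump_deriv_poly c s t p k) (k + 2) x) (at x)"
      using int by (simp add: bump_def pw)
    then show ?thesis
      by (rule has_field_derivative_transform_within_open[of _ _ _ "{s<..<t}"])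
        (use int in \<open>auto simp: bump_def pw\<close>)
  next
    case ext
    have "((\<lambda>_. 0) has_real_derivative 0) (at x)" by simp
    then have "(bump c s t p k has_real_derivative 0) (at x)"
      by (rule has_field_derivative_transform_within_open[of _ _ _ "- {s..t}"])
        (use ext in \<open>auto simp: bump_def\<close>)
    then show ?thesis using ext by (auto simp: bump_def)
  next
    case bd
    obtain K where K: "\<And>y. \<bar>bump c s t p k y\<bar> \<le> K * ((y - s) * (t - y))\<^sup>2"
      by (rule bump_quadratic_bound[OF c]) blast
    have "\<bar>bump c s t p k y\<bar> \<le> \<bar>K\<bar> * (t - s)\<^sup>2 * (y - x)\<^sup>2" for y
    proof (cases "s < y \<and> y < t")
      case True
      have "K * ((y - s) * (t - y))\<^sup>2 \<le> \<bar>K\<bar> * ((y - s) * (t - y))\<^sup>2"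
        by (intro mult_right_mono) auto
      also have "\<dots> \<le> \<bar>K\<bar> * ((t - s) * (y - x))\<^sup>2"
      proof (intro mult_left_mono)
        have "(y - s) * (t - y) \<le> (t - s) * \<bar>y - x\<bar>"
          using bd
        proof
          assume "x = s"
          then have "(y - s) * (t - y) \<le> \<bar>y - x\<bar> * (t - s)"
            using True by (intro mult_mono) auto
          then show ?thesis by (simp add: mult.commute)
        next
          assume "x = t"
          then show ?thesis using True by (intro mult_mono) auto
        qed
        then show "((y - s) * (t - y))\<^sup>2 \<le> ((t - s) * (y - x))\<^sup>2"
          using True by (subst abs_le_square_iff[symmetric]) (auto simp: abs_mult)
      qed auto
      finally show ?thesis using K[of y] by (simp add: power_mult_distrib mult.assoc)
    next
      case False
      then show ?thesis by (auto simp: bump_def)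
    qed
    then have "(bump c s t p k has_real_derivative 0) (at x)"
      by (rule has_real_derivative_zero_if_quadratic)
    then show ?thesis using bd by (auto simp: bump_def)
  qed
qed

lemma deriv_funpow_bump:
  assumes "c > 0"
  shows "\<exists>q l. (deriv ^^ n) (bump c s t p k) = bump c s t q l"
proof (induction n)
  case (Suc n)
  then obtain q l where "(deriv ^^ n) (bump c s t p k) = bump c s t q l" by blast
  moreover have "deriv (bump c s t q l) = bump c s t (bump_deriv_poly c s t q l) (l + 2)"
    using DERIV_imp_deriv[OF bump_has_derivative[OF assms]] by blast
  ultimately show ?case by auto
qed auto

lemma bump_test_function:
  assumes "c > 0" "{s..t} \<subseteq> I"
  shows "bump c s t p k \<in> test_functions I"
proof -
  have "(deriv ^^ n) (bump c s t p k) field_differentiable at x" for n x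
  proof -
    obtain q l where "(deriv ^^ n) (bump c s t p k) = bump c s t q l"
      using deriv_funpow_bump[OF assms(1)] by blast
    then show ?thesis
      using bump_has_derivative[OF assms(1), of s t q l x] by (auto simp: field_differentiable_def)
  qed
  moreover have "bump c s t p k x = 0" if "x \<notin> {s..t}" for x
    using that by (auto simp: bump_def)
  ultimately show ?thesis
    using assms(2) unfolding test_functions_def by (auto intro!: exI[of _ "{s..t}"])
qed

text \<open>
  Almost every value of an integrable function is the limit of its means over \<open>[x, x + h]\<close>.
\<close>

lemma negligible_if_all_integrals_zero:
  fixes k :: "real \<Rightarrow> 'b::euclidean_space"
  assumes "k absolutely_integrable_on {s..t}"
    and "\<And>x y. s < x \<Longrightarrow> x < y \<Longrightarrow> y < t \<Longrightarrow> integral {x..y} k = 0"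
  shows "negligible {x \<in> {s<..<t}. k x \<noteq> 0}"
proof -
  define f where "f x = (if x \<in> {s<..<t} then k x else 0)" for x
  have "k absolutely_integrable_on {s<..<t}"
    using assms(1) by (simp add: absolutely_integrable_on_Icc_iff_Ioo)
  then have "f absolutely_integrable_on UNIV"
    unfolding f_def by (simp only: absolutely_integrable_restrict_UNIV)
  then have "f absolutely_integrable_on cbox x y" for x y
    by (rule absolutely_integrable_on_subcbox) auto
  then have "f integrable_on cbox x y" for x y
    by (simp add: absolutely_integrable_on_def)
  then obtain N where N: "negligible N" and
    lim: "\<And>x e. \<lbrakk>x \<notin> N; 0 < e\<rbrakk> \<Longrightarrow> \<exists>d>0. \<forall>h. 0 < h \<and> h < d \<longrightarrow>
           norm (integral (cbox x (x + h *\<^sub>R One)) f /\<^sub>R h ^ DIM(real) - f x) < e"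
    by (rule integrable_ccontinuous_explicit) blast
  have "f x = 0" if x: "x \<notin> N" "s < x" "x < t" for x
  proof (rule ccontr)
    assume "f x \<noteq> 0"
    then obtain d where d: "d > 0"
      "\<And>h. 0 < h \<Longrightarrow> h < d \<Longrightarrow> norm (integral (cbox x (x + h *\<^sub>R One)) f /\<^sub>R h ^ DIM(real) - f x) < norm (f x)"
      using lim[OF x(1), of "norm (f x)"] by auto
    \<comment> \<open>so small that \<open>[x, x + h]\<close> stays inside \<open>(s, t)\<close>\<close>
    define h where "h = min d (t - x) / 2"
    have h: "0 < h" "h < d" "x + h < t" using x d by (auto simp: h_def min_def field_simps)
    have "integral {x..x+h} f = integral {x..x+h} k"
      by (intro integral_cong) (use x h in \<open>auto simp: f_def\<close>)
    also have "\<dots> = 0" using assms(2)[of x "x + h"] x h by auto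
    finally show False using d(2)[OF h(1,2)] by simp
  qed
  then have "{x \<in> {s<..<t}. k x \<noteq> 0} \<subseteq> N" by (auto simp: f_def)
  then show ?thesis using N negligible_subset by blast
qed

lemma einterval_Icc_subset:
  "s \<in> einterval a b \<Longrightarrow> t \<in> einterval a b \<Longrightarrow> {s..t} \<subseteq> einterval a b"
  by (auto simp: einterval_def intro: less_le_trans[of a "ereal s"] le_less_trans[of _ "ereal t"])

lemma sets_lebesgue_einterval [simp, measurable]: "einterval a b \<in> sets lebesgue"
  by (simp add: borel_open)

lemma integrable_lebesgue_on_iff:
  fixes f :: "real \<Rightarrow> 'b::euclidean_space"
  assumes "S \<in> sets lebesgue"
  shows "integrable (lebesgue_on S) f \<longleftrightarrow> f absolutely_integrable_on S"
  using assms by (simp add: integrable_restrict_space set_integrable_def)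

text \<open>
  Weak derivatives are stated with the Lebesgue integral over the whole interval; this turns them
  into Henstock-Kurzweil integrals over a compact interval.
\<close>

lemma compactly_supported_LINT:
  fixes F :: "real \<Rightarrow> 'b::euclidean_space"
  assumes S: "S \<in> sets lebesgue" and sub: "{s..t} \<subseteq> S"
    and F: "F absolutely_integrable_on {s..t}" and zero: "\<And>x. x \<notin> {s..t} \<Longrightarrow> F x = 0"
  shows "integrable (lebesgue_on S) F" "(LINT x|lebesgue_on S. F x) = integral {s..t} F"
proof -
  have e1: "{x \<in> S - {s..t}. F x \<noteq> 0} = {}" using zero by blast
  have e2: "{x \<in> {s..t} - S. F x \<noteq> 0} = {}" using sub by blast
  have "F absolutely_integrable_on S"
    using F absolutely_integrable_spike_set_eq[of S "{s..t}" F] unfolding e1 e2 by simp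
  then show int: "integrable (lebesgue_on S) F"
    using S by (simp add: integrable_lebesgue_on_iff)
  have "integral S F = integral {s..t} F"
    using F zero sub
    by (intro integral_unique has_integral_on_superset[OF integrable_integral])
       (auto simp: absolutely_integrable_on_def)
  then show "(LINT x|lebesgue_on S. F x) = integral {s..t} F"
    using lebesgue_integral_eq_integral[OF int S] by simp
qed

lemma absolutely_integrable_continuous_scaleR:
  fixes g :: "real \<Rightarrow> 'b::euclidean_space"
  assumes "g absolutely_integrable_on {s..t}" "continuous_on {s..t} \<phi>"
  shows "(\<lambda>x. \<phi> x *\<^sub>R g x) absolutely_integrable_on {s..t}"
  by (rule absolutely_integrable_continuous_product[OF bounded_bilinear_scaleR assms(2,1)])

text \<open>
  The bumps on \<open>(s, t)\<close> with \<open>c = 1 / (n + 1)\<close> converge to 1 there, so by dominated convergence the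
  integral of \<open>k\<close> over every compact subinterval vanishes.
\<close>

lemma fundamental_lemma_variations:
  fixes k :: "real \<Rightarrow> 'b::euclidean_space"
  assumes loc: "\<And>s t. s \<in> einterval a b \<Longrightarrow> t \<in> einterval a b \<Longrightarrow> k absolutely_integrable_on {s..t}"
    and test: "\<And>\<phi>. \<phi> \<in> test_functions (einterval a b) \<Longrightarrow>
       (LINT x|lebesgue_on (einterval a b). \<phi> x *\<^sub>R k x) = 0"
  shows "AE x in lebesgue_on (einterval a b). k x = 0"
proof (cases "a < b")
  case False
  then have "einterval a b = {}" by (auto simp: einterval_def dest: less_trans)
  then show ?thesis by (simp add: AE_lebesgue_on_iff_negligible)
next
  case True
  let ?I = "einterval a b"
  have zero: "integral {s..t} k = 0" if st: "s \<in> ?I" "t \<in> ?I" for s t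
  proof -
    define \<phi> where "\<phi> n = bump (1 / Suc n) s t 1 0" for n
    have sub: "{s..t} \<subseteq> ?I" using st by (rule einterval_Icc_subset)
    have \<phi>: "\<phi> n \<in> test_functions ?I" for n
      unfolding \<phi>_def by (intro bump_test_function sub) auto
    have b: "\<bar>\<phi> n x\<bar> \<le> 1" for n x by (auto simp: \<phi>_def bump_def)
    have cont: "continuous_on {s..t} (\<phi> n)" for n
      unfolding \<phi>_def
      by (intro DERIV_continuous_on[OF DERIV_subset[OF bump_has_derivative]]) auto
    have ai: "(\<lambda>x. \<phi> n x *\<^sub>R k x) absolutely_integrable_on {s..t}" for n
      by (rule absolutely_integrable_continuous_scaleR[OF loc[OF st] cont])
    have z: "integral {s<..<t} (\<lambda>x. \<phi> n x *\<^sub>R k x) = 0" for n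
    proof -
      have "\<phi> n x *\<^sub>R k x = 0" if "x \<notin> {s..t}" for x
        using that by (auto simp: \<phi>_def bump_def)
      from compactly_supported_LINT(2)[OF sets_lebesgue_einterval sub ai this] test[OF \<phi>, of n]
      show ?thesis by (simp add: integral_open_interval_real)
    qed
    have "(\<lambda>n. integral {s<..<t} (\<lambda>x. \<phi> n x *\<^sub>R k x)) \<longlonglongrightarrow> integral {s<..<t} k"
    proof (rule dominated_convergence(2))
      show "(\<lambda>x. \<phi> n x *\<^sub>R k x) integrable_on {s<..<t}" for n
        using ai[of n] by (simp add: integrable_on_Icc_iff_Ioo absolutely_integrable_on_def)
      show "(\<lambda>x. norm (k x)) integrable_on {s<..<t}"
        using loc[OF st] by (simp add: integrable_on_Icc_iff_Ioo absolutely_integrable_on_def)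
      show "norm (\<phi> n x *\<^sub>R k x) \<le> norm (k x)" for n x
        using b[of n x] by (simp add: mult_left_le_one_le)
      show "(\<lambda>n. \<phi> n x *\<^sub>R k x) \<longlonglongrightarrow> k x" if "x \<in> {s<..<t}" for x
      proof -
        have "(\<lambda>n. exp (- (1 / real (Suc n)) / ((x - s) * (t - x)))) \<longlonglongrightarrow> exp (- 0 / ((x - s) * (t - x)))"
          by (intro tendsto_intros LIMSEQ_Suc[OF lim_1_over_n]) (use that in auto)
        then have "(\<lambda>n. \<phi> n x) \<longlonglongrightarrow> 1" using that by (simp add: \<phi>_def bump_def)
        then have "(\<lambda>n. \<phi> n x *\<^sub>R k x) \<longlonglongrightarrow> 1 *\<^sub>R k x" by (intro tendsto_intros)
        then show ?thesis by simp
      qed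
    qed
    then have "integral {s<..<t} k = 0" using z by (simp add: LIMSEQ_const_iff)
    then show ?thesis by (simp add: integral_open_interval_real)
  qed
  obtain u l :: "nat \<Rightarrow> real" where ul: "?I = (\<Union>i. {l i .. u i})" "\<And>i. l i < u i"
    by (rule einterval_Icc_approximation[OF True]) blast
  have "negligible (\<Union>i. {x \<in> {l i<..<u i}. k x \<noteq> 0} \<union> {l i, u i})"
  proof (intro negligible_Union_nat negligible_Un)
    fix i
    have "l i \<in> {l i..u i}" "u i \<in> {l i..u i}" using ul(2)[of i] by auto
    then have lu: "l i \<in> ?I" "u i \<in> ?I" unfolding ul(1) by blast+
    show "negligible {x \<in> {l i<..<u i}. k x \<noteq> 0}"
    proof (rule negligible_if_all_integrals_zero)
      show "k absolutely_integrable_on {l i..u i}" by (intro loc lu)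
      fix x y assume "l i < x" "x < y" "y < u i"
      then have "x \<in> {l i..u i}" "y \<in> {l i..u i}" by auto
      then show "integral {x..y} k = 0" using einterval_Icc_subset[OF lu] by (intro zero) auto
    qed
  qed auto
  moreover have "{x \<in> ?I. k x \<noteq> 0} \<subseteq> (\<Union>i. {x \<in> {l i<..<u i}. k x \<noteq> 0} \<union> {l i, u i})"
  proof
    fix x assume "x \<in> {x \<in> ?I. k x \<noteq> 0}"
    then obtain i where "x \<in> {l i..u i}" "k x \<noteq> 0" unfolding ul(1) by blast
    then have "x \<in> {x \<in> {l i<..<u i}. k x \<noteq> 0} \<union> {l i, u i}" by auto
    then show "x \<in> (\<Union>i. {x \<in> {l i<..<u i}. k x \<noteq> 0} \<union> {l i, u i})" by blast
  qed
  ultimately have "negligible {x \<in> ?I. k x \<noteq> 0}" by (rule negligible_subset)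
  then show ?thesis by (simp add: AE_lebesgue_on_iff_negligible)
qed

section \<open>Weak derivatives on an interval\<close>

lemma closure_einterval:
  assumes "a < b"
  shows "closure (einterval a b) = {x. a \<le> ereal x \<and> ereal x \<le> b}"
  using assms by (cases a; cases b) (auto simp: closure_greaterThan closure_lessThan)

lemma is_interval_closure_einterval: "is_interval (closure (einterval a b))"
proof -
  have "is_interval (einterval a b)"
    unfolding is_interval_1 using einterval_Icc_subset by fastforce
  then show ?thesis by (simp add: is_interval_connected_1 connected_imp_connected_closure)
qed

lemma Ioo_subset_einterval:
  assumes "s \<in> closure (einterval a b)" "t \<in> closure (einterval a b)"
  shows "{s<..<t} \<subseteq> einterval a b"
proof (cases "a < b")
  case True
  show ?thesis
  proof
    fix x assume x: "x \<in> {s<..<t}"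
    have "a \<le> ereal s" "ereal t \<le> b" using assms closure_einterval[OF True] by auto
    moreover have "ereal s < ereal x" "ereal x < ereal t" using x by auto
    ultimately have "a < ereal x" "ereal x < b" by (meson le_less_trans less_le_trans)+
    then show "x \<in> einterval a b" by (simp add: einterval_def)
  qed
next
  case False
  then have "einterval a b = {}" by (auto simp: einterval_def dest: less_trans)
  then show ?thesis using assms by simp
qed

lemma primitive_on_exists:
  fixes g :: "real \<Rightarrow> 'b::euclidean_space"
  assumes "\<And>s t. s \<in> J \<Longrightarrow> t \<in> J \<Longrightarrow> g absolutely_integrable_on {s..t}"
  shows "\<exists>u. primitive_on J u g"
proof (cases "J = {}")
  case False
  then obtain c where c: "c \<in> J" by blast
  \<comment> \<open>the signed integral from \<open>c\<close> to \<open>x\<close>: one of the two intervals is empty or a point\<close>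
  define u where "u x = integral {c..x} g - integral {x..c} g" for x
  have int: "g integrable_on {s..t}" if "s \<in> J" "t \<in> J" for s t
    using assms[OF that] by (simp add: absolutely_integrable_on_def)
  have "u t - u s = integral {s..t} g" if st: "s \<in> J" "t \<in> J" "s \<le> t" for s t
  proof -
    consider "c \<le> s" | "s \<le> c" "c \<le> t" | "t \<le> c" by linarith
    then show ?thesis
    proof cases
      case 1
      then have "integral {c..s} g + integral {s..t} g = integral {c..t} g"
        using st c int by (intro Henstock_Kurzweil_Integration.integral_combine) auto
      moreover have "integral {s..c} g = 0" "integral {t..c} g = 0"
        using 1 st by (cases "s = c"; cases "t = c"; simp)+
      ultimately show ?thesis by (auto simp: u_def algebra_simps)
    next
      case 2
      then have "integral {s..c} g + integral {c..t} g = integral {s..t} g"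
        using st c int by (intro Henstock_Kurzweil_Integration.integral_combine) auto
      moreover have "integral {c..s} g = 0" "integral {t..c} g = 0"
        using 2 by (cases "s = c"; cases "t = c"; simp)+
      ultimately show ?thesis by (auto simp: u_def algebra_simps)
    next
      case 3
      then have "integral {s..t} g + integral {t..c} g = integral {s..c} g"
        using st c int by (intro Henstock_Kurzweil_Integration.integral_combine) auto
      moreover have "integral {c..s} g = 0" "integral {c..t} g = 0"
        using 3 st by (cases "s = c"; cases "t = c"; simp)+
      ultimately show ?thesis by (auto simp: u_def algebra_simps)
    qed
  qed
  then have "primitive_on J u g"
    using assms int by (auto simp: primitive_on_def has_integral_iff)
  then show ?thesis by blast
qed (auto simp: primitive_on_def)

lemma primitive_on_C1:
  fixes f :: "real \<Rightarrow> 'b::euclidean_space"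
  assumes "\<And>x. (f has_vector_derivative f' x) (at x)" "continuous_on UNIV f'"
  shows "primitive_on J f f'"
  unfolding primitive_on_def
proof (intro ballI impI conjI)
  fix s t :: real assume "s \<le> t"
  show "f' absolutely_integrable_on {s..t}"
    by (intro absolutely_integrable_continuous_real continuous_on_subset[OF assms(2)]) auto
  show "(f' has_integral f t - f s) {s..t}"
    using \<open>s \<le> t\<close> assms(1) by (intro fundamental_theorem_of_calculus) (auto intro: has_vector_derivative_at_within)
qed

lemma test_function_support:
  assumes "\<phi> \<in> test_functions (einterval a b)" "a < b"
  obtains s t where "s \<in> einterval a b" "t \<in> einterval a b" "s \<le> t" "\<forall>x. x \<notin> {s..t} \<longrightarrow> \<phi> x = 0"
proof -
  obtain K where K: "compact K" "K \<subseteq> einterval a b" "\<And>x. x \<notin> K \<Longrightarrow> \<phi> x = 0"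
    using assms(1) by (auto simp: test_functions_def)
  obtain c where c: "c \<in> einterval a b" using einterval_nonempty[OF assms(2)] by blast
  have K': "compact (insert c K)" "insert c K \<noteq> {}" "insert c K \<subseteq> einterval a b"
    using K c by auto
  obtain s where s: "s \<in> insert c K" "\<And>x. x \<in> insert c K \<Longrightarrow> s \<le> x"
    using compact_attains_inf[OF K'(1,2)] by blast
  obtain t where t: "t \<in> insert c K" "\<And>x. x \<in> insert c K \<Longrightarrow> x \<le> t"
    using compact_attains_sup[OF K'(1,2)] by blast
  show ?thesis
  proof (rule that[of s t])
    show "\<forall>x. x \<notin> {s..t} \<longrightarrow> \<phi> x = 0"
      using K(3) s t by auto
  qed (use s t K' in auto)
qed

lemma test_function_deriv:
  assumes "\<phi> \<in> test_functions I"
  shows "(\<phi> has_real_derivative deriv \<phi> x) (at x)" "continuous_on S \<phi>" "continuous_on S (deriv \<phi>)"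
proof -
  have d: "(deriv ^^ n) \<phi> field_differentiable at t" for n t
    using assms by (auto simp: test_functions_def)
  show "(\<phi> has_real_derivative deriv \<phi> x) (at x)"
    using d[of 0 x] by (simp add: field_differentiable_derivI)
  show "continuous_on S \<phi>"
    using d[of 0] by (intro continuous_at_imp_continuous_on ballI field_differentiable_imp_continuous_at) auto
  show "continuous_on S (deriv \<phi>)"
    using d[of 1] by (intro continuous_at_imp_continuous_on ballI field_differentiable_imp_continuous_at) auto
qed

lemma deriv_zero_off_support:
  fixes \<phi> :: "real \<Rightarrow> real"
  assumes "\<forall>x. x \<notin> {s..t} \<longrightarrow> \<phi> x = 0"
  shows "\<forall>x. x \<notin> {s..t} \<longrightarrow> deriv \<phi> x = 0"
proof (intro allI impI)
  fix x assume x: "x \<notin> {s..t}"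
  have "((\<lambda>_. 0) has_real_derivative 0) (at x)" by simp
  then have "(\<phi> has_real_derivative 0) (at x)"
    by (rule has_field_derivative_transform_within_open[of _ _ _ "- {s..t}"]) (use assms x in auto)
  then show "deriv \<phi> x = 0" by (rule DERIV_imp_deriv)
qed

text \<open>
  Stated for continuous \<open>\<phi>\<close>, so that it serves a test function and its derivative alike.
\<close>

lemma test_function_LINT:
  fixes g :: "real \<Rightarrow> 'b::euclidean_space"
  assumes "continuous_on UNIV \<phi>" "\<forall>x. x \<notin> {s..t} \<longrightarrow> \<phi> x = 0"
    and "s \<in> einterval a b" "t \<in> einterval a b" "g absolutely_integrable_on {s..t}"
  shows "integrable (lebesgue_on (einterval a b)) (\<lambda>x. \<phi> x *\<^sub>R g x)"
    "(LINT x|lebesgue_on (einterval a b). \<phi> x *\<^sub>R g x) = integral {s..t} (\<lambda>x. \<phi> x *\<^sub>R g x)"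
proof -
  have "(\<lambda>x. \<phi> x *\<^sub>R g x) absolutely_integrable_on {s..t}"
    using assms by (intro absolutely_integrable_continuous_scaleR) (auto intro: continuous_on_subset)
  moreover have "\<phi> x *\<^sub>R g x = 0" if "x \<notin> {s..t}" for x using assms(2) that by simp
  ultimately show "integrable (lebesgue_on (einterval a b)) (\<lambda>x. \<phi> x *\<^sub>R g x)"
    "(LINT x|lebesgue_on (einterval a b). \<phi> x *\<^sub>R g x) = integral {s..t} (\<lambda>x. \<phi> x *\<^sub>R g x)"
    using compactly_supported_LINT[OF sets_lebesgue_einterval einterval_Icc_subset[OF assms(3,4)]]
    by blast+
qed

text \<open>
  Integrate the derivative of \<open>\<phi> u\<close> over an interval that is strictly larger than the support of \<open>\<phi>\<close>,
  so that the boundary terms vanish.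
\<close>

lemma primitive_on_test_function:
  fixes u g :: "real \<Rightarrow> 'b::euclidean_space"
  assumes ab: "a < b" and u: "primitive_on (einterval a b) u g"
    and \<phi>: "\<phi> \<in> test_functions (einterval a b)"
  shows "integrable (lebesgue_on (einterval a b)) (\<lambda>x. deriv \<phi> x *\<^sub>R u x)"
    "integrable (lebesgue_on (einterval a b)) (\<lambda>x. \<phi> x *\<^sub>R g x)"
    "(LINT x|lebesgue_on (einterval a b). deriv \<phi> x *\<^sub>R u x) = - (LINT x|lebesgue_on (einterval a b). \<phi> x *\<^sub>R g x)"
proof -
  let ?I = "einterval a b"
  obtain s0 t0 where st0: "s0 \<in> ?I" "t0 \<in> ?I" "s0 \<le> t0" "\<forall>x. x \<notin> {s0..t0} \<longrightarrow> \<phi> x = 0"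
    using test_function_support[OF \<phi> ab] by blast
  obtain s where s: "s \<in> ?I" "s < s0"
  proof -
    obtain e where "e > 0" "cball s0 e \<subseteq> ?I"
      using open_contains_cball open_einterval st0(1) by blast
    then have "s0 - e \<in> ?I" by (auto simp: subset_iff dist_real_def)
    then show ?thesis using \<open>e > 0\<close> that[of "s0 - e"] by auto
  qed
  obtain t where t: "t \<in> ?I" "t > t0"
  proof -
    obtain e where "e > 0" "cball t0 e \<subseteq> ?I"
      using open_contains_cball open_einterval st0(2) by blast
    then have "t0 + e \<in> ?I" by (auto simp: subset_iff dist_real_def)
    then show ?thesis using \<open>e > 0\<close> that[of "t0 + e"] by auto
  qed
  have st: "s \<le> t" using s t st0 by linarith
  have ends: "\<phi> s = 0" "\<phi> t = 0" using s t st0(4) by auto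
  have supp: "\<forall>x. x \<notin> {s..t} \<longrightarrow> \<phi> x = 0" using st0(4) s t by auto
  note dsupp = deriv_zero_off_support[OF supp]
  have sub: "{s..t} \<subseteq> ?I" using einterval_Icc_subset[OF s(1) t(1)] .
  have ug: "primitive_on {s..t} u g" by (rule primitive_on_subset[OF u sub])
  have "primitive_on {s..t} \<phi> (deriv \<phi>)"
    using test_function_deriv[OF \<phi>]
    by (intro primitive_on_C1) (auto simp: has_real_derivative_iff_has_vector_derivative)
  from primitive_on_prod[OF bounded_bilinear_scaleR _ this ug]
  have "((\<lambda>x. deriv \<phi> x *\<^sub>R u x + \<phi> x *\<^sub>R g x) has_integral \<phi> t *\<^sub>R u t - \<phi> s *\<^sub>R u s) {s..t}"
    using st by (auto simp: primitive_on_def is_interval_cc)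
  then have sum0: "integral {s..t} (\<lambda>x. deriv \<phi> x *\<^sub>R u x + \<phi> x *\<^sub>R g x) = 0"
    using ends by (simp add: integral_unique)
  have g_int: "g absolutely_integrable_on {s..t}"
    using ug st by (auto simp: primitive_on_def)
  have u_int: "u absolutely_integrable_on {s..t}"
    using primitive_on_Icc_continuous[OF ug] by (rule absolutely_integrable_continuous_real)
  note 1 = test_function_LINT[OF test_function_deriv(3)[OF \<phi>] dsupp s(1) t(1) u_int]
  note 2 = test_function_LINT[OF test_function_deriv(2)[OF \<phi>] supp s(1) t(1) g_int]
  show "integrable (lebesgue_on ?I) (\<lambda>x. deriv \<phi> x *\<^sub>R u x)" using 1 by blast
  show "integrable (lebesgue_on ?I) (\<lambda>x. \<phi> x *\<^sub>R g x)" using 2 by blast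
  have "(\<lambda>x. deriv \<phi> x *\<^sub>R u x) integrable_on {s..t}" "(\<lambda>x. \<phi> x *\<^sub>R g x) integrable_on {s..t}"
    using absolutely_integrable_continuous_scaleR[OF u_int test_function_deriv(3)[OF \<phi>]]
      absolutely_integrable_continuous_scaleR[OF g_int test_function_deriv(2)[OF \<phi>]]
    by (simp_all add: absolutely_integrable_on_def)
  then have "integral {s..t} (\<lambda>x. deriv \<phi> x *\<^sub>R u x) = - integral {s..t} (\<lambda>x. \<phi> x *\<^sub>R g x)"
    using sum0 by (simp add: Henstock_Kurzweil_Integration.integral_add eq_neg_iff_add_eq_0)
  then show "(LINT x|lebesgue_on ?I. deriv \<phi> x *\<^sub>R u x) = - (LINT x|lebesgue_on ?I. \<phi> x *\<^sub>R g x)"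
    using 1 2 by simp
qed

lemma deriv_funpow_diff_scale:
  fixes f g :: "real \<Rightarrow> real"
  assumes "\<And>n t. (deriv ^^ n) f field_differentiable at t" "\<And>n t. (deriv ^^ n) g field_differentiable at t"
  shows "(deriv ^^ n) (\<lambda>x. f x - r * g x) = (\<lambda>x. (deriv ^^ n) f x - r * (deriv ^^ n) g x)"
proof (induction n)
  case (Suc n)
  have "deriv (\<lambda>x. (deriv ^^ n) f x - r * (deriv ^^ n) g x) x =
      deriv ((deriv ^^ n) f) x - r * deriv ((deriv ^^ n) g) x" for x
    by (rule DERIV_imp_deriv) (auto intro!: derivative_eq_intros field_differentiable_derivI assms)
  then show ?case using Suc by auto
qed auto

text \<open>
  The antiderivative that starts to the left of the support is constant to the right of it, and the
  constant is the integral of \<open>\<psi>\<close>.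
\<close>

lemma test_function_with_zero_integral_is_derivative:
  assumes \<psi>: "\<And>n x. (deriv ^^ n) \<psi> field_differentiable at x"
    and supp: "\<And>x. x \<notin> {s..t} \<Longrightarrow> \<psi> x = 0" and st: "{s..t} \<subseteq> I"
    and zero: "integral {s..t} \<psi> = 0"
  shows "\<exists>\<Phi>\<in>test_functions I. deriv \<Phi> = \<psi>"
proof -
  \<comment> \<open>starting one unit before the support makes the derivative at \<open>s\<close> two-sided\<close>
  define \<Phi> where "\<Phi> x = integral {s-1..x} \<psi>" for x
  have cont: "continuous_on A \<psi>" for A
    using \<psi>[of 0] by (intro continuous_at_imp_continuous_on ballI field_differentiable_imp_continuous_at) auto
  have int: "\<psi> integrable_on {x..y}" for x y
    by (rule integrable_continuous_real[OF cont])
  have left: "\<Phi> x = 0" if "x < s" for x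
    unfolding \<Phi>_def using that supp by (intro integral_unique has_integral_is_0) auto
  have right: "\<Phi> x = 0" if x: "t < x" for x
  proof -
    have "integral {s-1..x} \<psi> = integral {s..t} \<psi>"
      if "s \<le> t"
      by (intro integral_unique has_integral_on_superset[OF integrable_integral[OF int]] supp)
        (use x that in auto)
    moreover have "integral {s-1..x} \<psi> = 0" if "\<not> s \<le> t"
      by (intro integral_unique has_integral_is_0 supp) (use that in auto)
    ultimately show ?thesis using zero by (auto simp: \<Phi>_def)
  qed
  have d: "(\<Phi> has_real_derivative \<psi> x) (at x)" for x
  proof (cases "x < s")
    case True
    have "((\<lambda>_. 0) has_real_derivative 0) (at x)" by simp
    then have "(\<Phi> has_real_derivative 0) (at x)"
      by (rule has_field_derivative_transform_within_open[of _ _ _ "{..<s}"]) (use True left in auto)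
    then show ?thesis using supp[of x] True by simp
  next
    case False
    have "(\<Phi> has_real_derivative \<psi> x) (at x within {s-1..x+1})"
      unfolding \<Phi>_def using False by (intro integral_has_real_derivative cont) auto
    moreover have "at x within {s-1..x+1} = at x"
      using False by (intro at_within_interior) auto
    ultimately show ?thesis by simp
  qed
  then have deq: "deriv \<Phi> = \<psi>" by (auto intro: DERIV_imp_deriv)
  have "(deriv ^^ n) \<Phi> field_differentiable at x" for n x
  proof (cases n)
    case 0
    then show ?thesis using d[of x] by (auto simp: field_differentiable_def)
  next
    case (Suc m)
    then show ?thesis using \<psi>[of m x] deq by (simp add: funpow_Suc_right del: funpow.simps)
  qed
  moreover have "\<Phi> x = 0" if "x \<notin> {s..t}" for x
    using that left[of x] right[of x] by auto
  ultimately have "\<Phi> \<in> test_functions I"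
    using st by (auto simp: test_functions_def intro!: exI[of _ "{s..t}"])
  then show ?thesis using deq by blast
qed

text \<open>
  Fix a bump \<open>\<psi>\<close> with integral \<open>m \<noteq> 0\<close>. For a test function \<open>\<phi>\<close> with integral \<open>M\<close>, the function
  \<open>\<phi> - (M / m) \<psi>\<close> has integral zero and so is the derivative of a test function. The hypothesis then
  says that \<open>\<phi>\<close> cannot distinguish \<open>h\<close> from the constant \<open>c\<close> that is the \<open>\<psi>\<close>-weighted mean of \<open>h\<close>.
\<close>

lemma du_Bois_Reymond:
  fixes h :: "real \<Rightarrow> 'b::euclidean_space"
  assumes ab: "a < b"
    and loc: "\<And>s t. s \<in> einterval a b \<Longrightarrow> t \<in> einterval a b \<Longrightarrow> h absolutely_integrable_on {s..t}"
    and test: "\<And>\<phi>. \<phi> \<in> test_functions (einterval a b) \<Longrightarrow>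
       (LINT x|lebesgue_on (einterval a b). deriv \<phi> x *\<^sub>R h x) = 0"
  shows "\<exists>c. AE x in lebesgue_on (einterval a b). h x = c"
proof -
  let ?I = "einterval a b"
  obtain u l :: "nat \<Rightarrow> real" where ul: "?I = (\<Union>i. {l i .. u i})" "\<And>i. l i < u i"
    by (rule einterval_Icc_approximation[OF ab]) blast
  define s0 t0 where "s0 = l 0" and "t0 = u 0"
  have lt0: "s0 < t0" using ul(2) by (simp add: s0_def t0_def)
  then have "s0 \<in> {l 0..u 0}" "t0 \<in> {l 0..u 0}" by (auto simp: s0_def t0_def)
  then have st0: "s0 \<in> ?I" "t0 \<in> ?I" unfolding ul(1) by blast+
  define \<psi> where "\<psi> = bump 1 s0 t0 1 0"
  have \<psi>: "\<psi> \<in> test_functions ?I"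
    unfolding \<psi>_def by (intro bump_test_function einterval_Icc_subset st0) auto
  have \<psi>0: "\<forall>x. x \<notin> {s0..t0} \<longrightarrow> \<psi> x = 0" by (auto simp: \<psi>_def bump_def)
  define m where "m = integral {s0..t0} \<psi>"
  have "m \<noteq> 0"
  proof -
    have "\<psi> ((s0 + t0) / 2) \<noteq> 0" "(s0 + t0) / 2 \<in> {s0..t0}" using lt0 by (auto simp: \<psi>_def bump_def)
    moreover have "\<psi> x \<ge> 0" for x by (simp add: \<psi>_def bump_def)
    ultimately show ?thesis
      unfolding m_def using integral_eq_0_iff[OF test_function_deriv(2)[OF \<psi>] lt0] by blast
  qed
  define c where "c = (1 / m) *\<^sub>R (LINT x|lebesgue_on ?I. \<psi> x *\<^sub>R h x)"
  have "AE x in lebesgue_on ?I. h x - c = 0"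
  proof (rule fundamental_lemma_variations)
    show "(\<lambda>x. h x - c) absolutely_integrable_on {s..t}" if "s \<in> ?I" "t \<in> ?I" for s t
      using loc[OF that] by (intro set_integral_diff(1)) (auto intro: absolutely_integrable_continuous_real)
  next
    fix \<phi> assume \<phi>: "\<phi> \<in> test_functions ?I"
    obtain s t where st: "s \<in> ?I" "t \<in> ?I" "s \<le> t" "\<forall>x. x \<notin> {s..t} \<longrightarrow> \<phi> x = 0"
      using test_function_support[OF \<phi> ab] by blast
    define M where "M = integral {s..t} \<phi>"
    define s' t' where "s' = min s s0" and "t' = max t t0"
    have st': "s' \<in> ?I" "t' \<in> ?I" using st st0 by (auto simp: s'_def t'_def min_def max_def)
    let ?\<chi> = "\<lambda>x. \<phi> x - M / m * \<psi> x"
    have fd: "(deriv ^^ n) \<phi> field_differentiable at x" "(deriv ^^ n) \<psi> field_differentiable at x" for n x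
      using \<phi> \<psi> by (auto simp: test_functions_def)
    have int: "integral {s'..t'} \<phi> = M" "integral {s'..t'} \<psi> = m"
    proof -
      show "integral {s'..t'} \<phi> = M"
        unfolding M_def
        by (intro integral_unique has_integral_on_superset[OF integrable_integral] integrable_continuous_real
            test_function_deriv(2)[OF \<phi>]) (use st in \<open>auto simp: s'_def t'_def\<close>)
      show "integral {s'..t'} \<psi> = m"
        unfolding m_def
        by (intro integral_unique has_integral_on_superset[OF integrable_integral] integrable_continuous_real
            test_function_deriv(2)[OF \<psi>]) (use \<psi>0 in \<open>auto simp: s'_def t'_def\<close>)
    qed
    have "\<exists>\<Phi>\<in>test_functions ?I. deriv \<Phi> = ?\<chi>"
    proof (rule test_function_with_zero_integral_is_derivative)
      show "(deriv ^^ n) ?\<chi> field_differentiable at x" for n x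
        unfolding deriv_funpow_diff_scale[OF fd]
        by (intro field_differentiable_diff field_differentiable_mult fd) auto
      show "?\<chi> x = 0" if "x \<notin> {s'..t'}" for x
      proof -
        have "x \<notin> {s..t}" "x \<notin> {s0..t0}" using that by (auto simp: s'_def t'_def)
        then show ?thesis using st(4) \<psi>0 by simp
      qed
      show "{s'..t'} \<subseteq> ?I" by (rule einterval_Icc_subset[OF st'])
      have "integral {s'..t'} ?\<chi> = integral {s'..t'} \<phi> - integral {s'..t'} (\<lambda>x. M / m * \<psi> x)"
        by (intro Henstock_Kurzweil_Integration.integral_diff integrable_continuous_real
            continuous_intros test_function_deriv(2)[OF \<phi>] test_function_deriv(2)[OF \<psi>])
      also have "\<dots> = 0" using int \<open>m \<noteq> 0\<close> by simp
      finally show "integral {s'..t'} ?\<chi> = 0" .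
    qed
    then have z: "(LINT x|lebesgue_on ?I. ?\<chi> x *\<^sub>R h x) = 0" using test by metis
    note 1 = test_function_LINT[OF test_function_deriv(2)[OF \<phi>] st(4) st(1,2) loc[OF st(1,2)]]
    note 2 = test_function_LINT[OF test_function_deriv(2)[OF \<psi>] \<psi>0 st0 loc[OF st0]]
    have "(\<lambda>_. c) absolutely_integrable_on {s..t}" by (intro absolutely_integrable_continuous_real) auto
    note 3 = test_function_LINT[OF test_function_deriv(2)[OF \<phi>] st(4) st(1,2) this]
    have 4: "integrable (lebesgue_on ?I) (\<lambda>x. (M / m) *\<^sub>R (\<psi> x *\<^sub>R h x))"
      by (rule integrable_scaleR_right[OF 2(1)])
    have "0 = (LINT x|lebesgue_on ?I. \<phi> x *\<^sub>R h x - (M / m) *\<^sub>R (\<psi> x *\<^sub>R h x))"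
      using z by (simp add: scaleR_diff_left)
    also have "\<dots> = (LINT x|lebesgue_on ?I. \<phi> x *\<^sub>R h x) - (M / m) *\<^sub>R (LINT x|lebesgue_on ?I. \<psi> x *\<^sub>R h x)"
      by (subst Bochner_Integration.integral_diff[OF 1(1) 4]) (simp only: integral_scaleR_right)
    also have "\<dots> = (LINT x|lebesgue_on ?I. \<phi> x *\<^sub>R h x) - M *\<^sub>R c" by (simp add: c_def)
    also have "M *\<^sub>R c = integral {s..t} (\<lambda>x. \<phi> x *\<^sub>R c)"
      unfolding M_def
      by (intro integral_unique[symmetric] has_integral_scaleR_left integrable_integral
          integrable_continuous_real test_function_deriv(2)[OF \<phi>])
    also have "\<dots> = (LINT x|lebesgue_on ?I. \<phi> x *\<^sub>R c)" using 3 by simp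
    also have "(LINT x|lebesgue_on ?I. \<phi> x *\<^sub>R h x) - (LINT x|lebesgue_on ?I. \<phi> x *\<^sub>R c) =
       (LINT x|lebesgue_on ?I. \<phi> x *\<^sub>R (h x - c))"
      using 1 3 by (simp add: scaleR_diff_right)
    finally show "(LINT x|lebesgue_on ?I. \<phi> x *\<^sub>R (h x - c)) = 0" by simp
  qed
  then show ?thesis by auto
qed

lemma L2D:
  assumes "f \<in> L2 S"
  shows "f \<in> borel_measurable (lebesgue_on S)" "integrable (lebesgue_on S) (\<lambda>t. (norm (f t))\<^sup>2)"
  using assms by (auto simp: L2_def)

text \<open>
  On a bounded interval \<open>|f| \<le> 1 + |f|\<^sup>2\<close> is an integrable bound. That \<open>s\<close> and \<open>t\<close> may be endpoints of the
  interval is what later yields boundary values.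
\<close>

lemma L2_absolutely_integrable:
  fixes f :: "real \<Rightarrow> 'k::rc_scalar"
  assumes f: "f \<in> L2 (einterval a b)"
    and st: "s \<in> closure (einterval a b)" "t \<in> closure (einterval a b)"
  shows "f absolutely_integrable_on {s..t}"
proof -
  have sub: "{s<..<t} \<subseteq> einterval a b" by (rule Ioo_subset_einterval[OF st])
  have "(\<lambda>t. (norm (f t))\<^sup>2) absolutely_integrable_on einterval a b"
    using L2D(2)[OF f] by (simp add: integrable_lebesgue_on_iff)
  then have "(\<lambda>t. (norm (f t))\<^sup>2) absolutely_integrable_on {s<..<t}"
    by (rule set_integrable_subset) (use sub in auto)
  then have "(\<lambda>t. 1 + (norm (f t))\<^sup>2) integrable_on {s<..<t}"
    by (intro integrable_add) (auto simp: absolutely_integrable_on_def integrable_on_Icc_iff_Ioo[symmetric])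
  then have "f absolutely_integrable_on {s<..<t}"
  proof (rule measurable_bounded_by_integrable_imp_absolutely_integrable[rotated 2])
    show "f \<in> borel_measurable (lebesgue_on {s<..<t})"
      using L2D(1)[OF f] sub by (rule measurable_restrict_mono)
    show "norm (f x) \<le> 1 + (norm (f x))\<^sup>2" for x
      using zero_le_power2[of "norm (f x) - 1"] zero_le_power2[of "norm (f x)"]
      unfolding power2_diff power_one by linarith
  qed auto
  then show ?thesis by (simp add: absolutely_integrable_on_Icc_iff_Ioo)
qed

lemma power2_norm_add_le: "(norm (x + y))\<^sup>2 \<le> 2 * (norm x)\<^sup>2 + 2 * (norm (y::'b::real_normed_vector))\<^sup>2"
proof -
  have "(norm (x + y))\<^sup>2 \<le> (norm x + norm y)\<^sup>2" by (intro power_mono norm_triangle_ineq) auto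
  then show ?thesis
    using zero_le_power2[of "norm x - norm y"] unfolding power2_diff power2_sum by linarith
qed

lemma L2_add: 
  assumes f: "f \<in> L2 S" and g: "g \<in> L2 S"
  shows "(\<lambda>x. f x + g x) \<in> L2 S"
proof -
  have [measurable]: "f \<in> borel_measurable (lebesgue_on S)" "g \<in> borel_measurable (lebesgue_on S)"
    using L2D(1) f g by blast+
  have "integrable (lebesgue_on S) (\<lambda>t. 2 * (norm (f t))\<^sup>2 + 2 * (norm (g t))\<^sup>2)"
    using L2D(2)[OF f] L2D(2)[OF g] by simp
  then have "integrable (lebesgue_on S) (\<lambda>t. (norm (f t + g t))\<^sup>2)"
  proof (rule Bochner_Integration.integrable_bound)
    show "AE t in lebesgue_on S. norm ((norm (f t + g t))\<^sup>2) \<le> norm (2 * (norm (f t))\<^sup>2 + 2 * (norm (g t))\<^sup>2)"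
      by (intro always_eventually allI) (simp add: power2_norm_add_le)
  qed measurable
  then show ?thesis by (simp add: L2_def)
qed

lemma L2_mult:
  assumes f: "f \<in> L2 S"
  shows "(\<lambda>x. c * f x) \<in> L2 S"
  using L2D[OF f] by (auto simp: L2_def norm_mult power_mult_distrib)

lemma continuous_on_imp_measurable_einterval:
  fixes u :: "real \<Rightarrow> 'b::euclidean_space"
  assumes "continuous_on (closure (einterval a b)) u"
  shows "u \<in> borel_measurable (lebesgue_on (einterval a b))"
  by (intro continuous_imp_measurable_on_sets_lebesgue continuous_on_subset[OF assms] closure_subset) auto

lemma primitive_on_closure_continuous:
  "primitive_on (closure (einterval a b)) u g \<Longrightarrow> continuous_on (closure (einterval a b)) u"
  by (rule primitive_on_continuous[OF is_interval_closure_einterval closed_closure])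

text \<open>
  The difference of \<open>f\<close> and any primitive of \<open>g\<close> has weak derivative zero, hence is constant.
\<close>

lemma has_weak_deriv_primitive:
  fixes f g :: "real \<Rightarrow> 'k::rc_scalar"
  assumes ab: "a < b" and wd: "has_weak_deriv (einterval a b) f g"
  obtains u where "primitive_on (closure (einterval a b)) u g"
    "AE t in lebesgue_on (einterval a b). u t = f t"
proof -
  let ?I = "einterval a b"
  have f: "f \<in> L2 ?I" and g: "g \<in> L2 ?I" and
    wd': "\<And>\<phi>. \<phi> \<in> test_functions ?I \<Longrightarrow> (LINT t|lebesgue_on ?I. deriv \<phi> t *\<^sub>R f t) = - (LINT t|lebesgue_on ?I. \<phi> t *\<^sub>R g t)"
    using wd by (auto simp: has_weak_deriv_def)
  have cl: "x \<in> closure ?I" if "x \<in> ?I" for x using that closure_subset by blast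
  obtain u where u: "primitive_on (closure ?I) u g"
    using primitive_on_exists[OF L2_absolutely_integrable[OF g]] by blast
  have uI: "primitive_on ?I u g" by (rule primitive_on_subset[OF u closure_subset])
  have "\<exists>c. AE x in lebesgue_on ?I. f x - u x = c"
  proof (rule du_Bois_Reymond[OF ab])
    fix s t assume st: "s \<in> ?I" "t \<in> ?I"
    have "{s..t} \<subseteq> closure ?I" using einterval_Icc_subset[OF st] closure_subset by blast
    then show "(\<lambda>x. f x - u x) absolutely_integrable_on {s..t}"
      using st cl primitive_on_closure_continuous[OF u]
      by (intro set_integral_diff(1) L2_absolutely_integrable[OF f] absolutely_integrable_continuous_real)
         (auto intro: continuous_on_subset)
  next
    fix \<phi> assume \<phi>: "\<phi> \<in> test_functions ?I"
    obtain s t where st: "s \<in> ?I" "t \<in> ?I" "s \<le> t" "\<forall>x. x \<notin> {s..t} \<longrightarrow> \<phi> x = 0"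
      using test_function_support[OF \<phi> ab] by blast
    note d0 = deriv_zero_off_support[OF st(4)]
    note 1 = test_function_LINT[OF test_function_deriv(3)[OF \<phi>] d0 st(1,2)
        L2_absolutely_integrable[OF f cl[OF st(1)] cl[OF st(2)]]]
    note 2 = primitive_on_test_function[OF ab uI \<phi>]
    show "(LINT x|lebesgue_on ?I. deriv \<phi> x *\<^sub>R (f x - u x)) = 0"
      using 1 2 wd'[OF \<phi>] by (simp add: scaleR_diff_right)
  qed
  then obtain c where "AE x in lebesgue_on ?I. f x - u x = c" by blast
  then have "AE x in lebesgue_on ?I. u x + c = f x" by (rule eventually_mono) (auto simp: algebra_simps)
  moreover have "primitive_on (closure ?I) (\<lambda>x. u x + c) g" using u by (simp add: primitive_on_def)
  ultimately show ?thesis using that by blast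
qed

lemma has_weak_derivI:
  fixes f g :: "real \<Rightarrow> 'k::rc_scalar"
  assumes ab: "a < b" and f: "f \<in> L2 (einterval a b)" and g: "g \<in> L2 (einterval a b)"
    and u: "primitive_on (closure (einterval a b)) u g"
    and ae: "AE t in lebesgue_on (einterval a b). u t = f t"
  shows "has_weak_deriv (einterval a b) f g"
  unfolding has_weak_deriv_def
proof (intro conjI f g ballI)
  let ?I = "einterval a b"
  fix \<phi> assume \<phi>: "\<phi> \<in> test_functions ?I"
  have "deriv \<phi> \<in> borel_measurable (lebesgue_on ?I)"
    by (intro continuous_imp_measurable_on_sets_lebesgue test_function_deriv(3)[OF \<phi>]) auto
  then have "(LINT t|lebesgue_on ?I. deriv \<phi> t *\<^sub>R f t) = (LINT t|lebesgue_on ?I. deriv \<phi> t *\<^sub>R u t)"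
    using L2D[OF f] continuous_on_imp_measurable_einterval[OF primitive_on_closure_continuous[OF u]] ae
    by (intro integral_cong_AE) auto
  also have "\<dots> = - (LINT t|lebesgue_on ?I. \<phi> t *\<^sub>R g t)"
    by (rule primitive_on_test_function(3)[OF ab primitive_on_subset[OF u closure_subset] \<phi>])
  finally show "(LINT t|lebesgue_on ?I. deriv \<phi> t *\<^sub>R f t) = - (LINT t|lebesgue_on ?I. \<phi> t *\<^sub>R g t)" .
qed

lemma has_weak_deriv_unique:
  fixes f g :: "real \<Rightarrow> 'k::rc_scalar"
  assumes ab: "a < b" and g: "has_weak_deriv (einterval a b) f g" and g': "has_weak_deriv (einterval a b) f g'"
  shows "AE t in lebesgue_on (einterval a b). g t = g' t"
proof -
  let ?I = "einterval a b"
  have cl: "x \<in> closure ?I" if "x \<in> ?I" for x using that closure_subset by blast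
  have L: "g \<in> L2 ?I" "g' \<in> L2 ?I" using g g' by (auto simp: has_weak_deriv_def)
  have "AE t in lebesgue_on ?I. g t - g' t = 0"
  proof (rule fundamental_lemma_variations)
    show "(\<lambda>x. g x - g' x) absolutely_integrable_on {s..t}" if "s \<in> ?I" "t \<in> ?I" for s t
      using L that cl by (intro set_integral_diff(1) L2_absolutely_integrable) auto
  next
    fix \<phi> assume \<phi>: "\<phi> \<in> test_functions ?I"
    obtain s t where st: "s \<in> ?I" "t \<in> ?I" "s \<le> t" "\<forall>x. x \<notin> {s..t} \<longrightarrow> \<phi> x = 0"
      using test_function_support[OF \<phi> ab] by blast
    have 1: "integrable (lebesgue_on ?I) (\<lambda>x. \<phi> x *\<^sub>R k x)" if "k \<in> L2 ?I" for k :: "real \<Rightarrow> 'k"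
      by (rule test_function_LINT(1)[OF test_function_deriv(2)[OF \<phi>] st(4) st(1,2)
        L2_absolutely_integrable[OF that cl[OF st(1)] cl[OF st(2)]]])
    have "(LINT t|lebesgue_on ?I. \<phi> t *\<^sub>R g t) = (LINT t|lebesgue_on ?I. \<phi> t *\<^sub>R g' t)"
      using g g' \<phi> by (auto simp: has_weak_deriv_def)
    then show "(LINT t|lebesgue_on ?I. \<phi> t *\<^sub>R (g t - g' t)) = 0"
      using 1[OF L(1)] 1[OF L(2)] by (simp add: scaleR_diff_right)
  qed
  then show ?thesis by simp
qed

text \<open>
  The points of the interval at which two continuous functions differ form an open set, and
  a nonempty open set is not negligible.
\<close>

lemma continuous_AE_eq_imp_eq:
  fixes u v :: "real \<Rightarrow> 'b::euclidean_space"
  assumes u: "continuous_on (closure (einterval a b)) u" and v: "continuous_on (closure (einterval a b)) v"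
    and ae: "AE t in lebesgue_on (einterval a b). u t = v t" and x: "x \<in> closure (einterval a b)"
  shows "u x = v x"
proof -
  let ?I = "einterval a b"
  let ?C = "closure ?I \<inter> (\<lambda>x. u x - v x) -` {0}"
  have cc: "closed ?C"
    by (intro continuous_closed_preimage continuous_on_diff u v) auto
  have "?I \<subseteq> ?C"
  proof
    fix y assume y: "y \<in> ?I"
    show "y \<in> ?C"
    proof (rule ccontr)
      assume "y \<notin> ?C"
      then have "y \<in> ?I - ?C" using y by blast
      moreover have "open (?I - ?C)" using cc by (intro open_Diff) auto
      moreover have "negligible (?I - ?C)"
      proof (rule negligible_subset)
        show "negligible {x \<in> ?I. \<not> u x = v x}" using ae by (simp add: AE_lebesgue_on_iff_negligible)
        show "?I - ?C \<subseteq> {x \<in> ?I. \<not> u x = v x}" using closure_subset[of ?I] by auto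
      qed
      ultimately show False using open_not_negligible by blast
    qed
  qed
  then have "closure ?I \<subseteq> ?C" using cc by (rule closure_minimal)
  then have "x \<in> ?C" using x by blast
  then show ?thesis by simp
qed

text \<open>
  Replaces the choice in \<open>cont_rep\<close> by any primitive at hand: continuous representatives agree on the
  closure.
\<close>

lemma cont_rep_eq:
  fixes f g :: "real \<Rightarrow> 'k::rc_scalar"
  assumes u: "primitive_on (closure (einterval a b)) u g" "AE t in lebesgue_on (einterval a b). u t = f t"
    and x: "x \<in> closure (einterval a b)"
  shows "cont_rep (einterval a b) f x = u x"
proof -
  define v where "v = cont_rep (einterval a b) f"
  have u': "continuous_on (closure (einterval a b)) u" by (rule primitive_on_closure_continuous[OF u(1)])
  have "continuous_on (closure (einterval a b)) v \<and> (AE t in lebesgue_on (einterval a b). v t = f t)"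
    unfolding v_def cont_rep_def
    by (rule someI[of "\<lambda>v. continuous_on (closure (einterval a b)) v \<and> (AE t in lebesgue_on (einterval a b). v t = f t)",
        OF conjI[OF u' u(2)]])
  then have v: "continuous_on (closure (einterval a b)) v" "AE t in lebesgue_on (einterval a b). v t = f t"
    by blast+
  have "AE t in lebesgue_on (einterval a b). v t = u t"
    using v(2) u(2) by eventually_elim simp
  then have "v x = u x" by (rule continuous_AE_eq_imp_eq[OF v(1) u' _ x])
  then show ?thesis by (simp add: v_def)
qed

section \<open>Green's formula and the trace bound on one edge\<close>

lemma kconj_0 [simp]: "kconj (0::'k::rc_scalar) = 0"
  using kconj_scaleR[of 0 "0::'k"] by simp

lemma norm_kconj [simp]: "norm (kconj (x::'k::rc_scalar)) = norm x"
proof (cases "x = 0")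
  case False
  have "norm (x * kconj x) = (norm x)\<^sup>2" by (simp add: mult_kconj)
  then show ?thesis using False by (simp add: norm_mult power2_eq_square)
qed simp

lemma bounded_linear_kconj: "bounded_linear (kconj :: 'k::rc_scalar \<Rightarrow> 'k)"
  by (rule bounded_linear_intro[where K = 1]) (auto simp: kconj_add kconj_scaleR)

lemma kconj_minus: "kconj (- x) = - kconj (x::'k::rc_scalar)"
  using kconj_scaleR[of "-1" x] by simp

lemma bounded_bilinear_mult_kconj: "bounded_bilinear (\<lambda>x y. x * kconj (y::'k::rc_scalar))"
  using bounded_bilinear.comp[OF bounded_bilinear_mult bounded_linear_ident bounded_linear_kconj]
  by simp

lemma measurable_kconj [measurable]:
  "f \<in> borel_measurable M \<Longrightarrow> (\<lambda>x. kconj (f x :: 'k::rc_scalar)) \<in> borel_measurable M"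
  by (rule borel_measurable_continuous_on[OF linear_continuous_on[OF bounded_linear_kconj, of UNIV]])

lemma norm_mult_le_squares: "norm (x * y) \<le> (norm (x::'k::real_normed_field))\<^sup>2 + (norm y)\<^sup>2"
proof -
  have "2 * (norm x * norm y) \<le> (norm x)\<^sup>2 + (norm y)\<^sup>2"
    using zero_le_power2[of "norm x - norm y"] unfolding power2_diff by linarith
  moreover have "0 \<le> norm x * norm y" by simp
  ultimately show ?thesis by (simp only: norm_mult) 
qed

lemma L2_mult_kconj_integrable:
  fixes f g :: "real \<Rightarrow> 'k::rc_scalar"
  assumes f: "f \<in> L2 S" and g: "g \<in> L2 S"
  shows "integrable (lebesgue_on S) (\<lambda>t. f t * kconj (g t))"
    "norm (L2_inner S f g) \<le> (L2_norm S f)\<^sup>2 + (L2_norm S g)\<^sup>2"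
proof -
  have [measurable]: "f \<in> borel_measurable (lebesgue_on S)" "g \<in> borel_measurable (lebesgue_on S)"
    using L2D(1) f g by blast+
  have i: "integrable (lebesgue_on S) (\<lambda>t. (norm (f t))\<^sup>2 + (norm (g t))\<^sup>2)"
    using L2D(2)[OF f] L2D(2)[OF g] by simp
  have b: "norm (f t * kconj (g t)) \<le> (norm (f t))\<^sup>2 + (norm (g t))\<^sup>2" for t
    using norm_mult_le_squares[of "f t" "kconj (g t)"] by simp
  show int: "integrable (lebesgue_on S) (\<lambda>t. f t * kconj (g t))"
    using i
  proof (rule Bochner_Integration.integrable_bound)
    show "AE t in lebesgue_on S. norm (f t * kconj (g t)) \<le> norm ((norm (f t))\<^sup>2 + (norm (g t))\<^sup>2)"
      using b by (intro always_eventually allI) simp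
  qed measurable
  have "norm (L2_inner S f g) \<le> (LINT t|lebesgue_on S. norm (f t * kconj (g t)))"
    unfolding L2_inner_def by (rule integral_norm_bound)
  also have "\<dots> \<le> (LINT t|lebesgue_on S. (norm (f t))\<^sup>2 + (norm (g t))\<^sup>2)"
    using b i int by (intro integral_mono integrable_norm)
  also have "\<dots> = (L2_norm S f)\<^sup>2 + (L2_norm S g)\<^sup>2"
    using L2D(2)[OF f] L2D(2)[OF g] by (simp add: L2_norm_def)
  finally show "norm (L2_inner S f g) \<le> (L2_norm S f)\<^sup>2 + (L2_norm S g)\<^sup>2" .
qed

lemma L2_norm_power2: "(L2_norm S f)\<^sup>2 = (LINT t|lebesgue_on S. (norm (f t))\<^sup>2)"
  by (simp add: L2_norm_def)

text \<open>
  Average \<open>|P c| \<le> |P x| + \<integral> |F|\<close> over \<open>x\<close>. This one estimate gives both the decay at infinite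
  endpoints and the trace bound at finite ones.
\<close>

lemma primitive_on_norm_le:
  assumes P: "primitive_on {s..t} P F" and st: "s \<le> t" and c: "c \<in> {s..t}"
  shows "(t - s) * norm (P c) \<le> integral {s..t} (\<lambda>x. norm (P x)) + (t - s) * integral {s..t} (\<lambda>x. norm (F x))"
proof -
  define N where "N = integral {s..t} (\<lambda>x. norm (F x))"
  have Fi: "F absolutely_integrable_on {s..t}" using P st by (auto simp: primitive_on_def)
  have step: "norm (P y - P x) \<le> N" if "x \<in> {s..t}" "y \<in> {s..t}" "x \<le> y" for x y
  proof -
    have F': "F absolutely_integrable_on {x..y}" "integral {x..y} F = P y - P x"
      using primitive_onD[OF P that] by auto
    then have "norm (P y - P x) \<le> integral {x..y} (\<lambda>x. norm (F x))"
      by (metis absolutely_integrable_on_def integral_norm_bound_integral order_refl)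
    also have "\<dots> \<le> N"
      unfolding N_def using F' Fi that
      by (intro integral_subset_le) (auto simp: absolutely_integrable_on_def)
    finally show ?thesis .
  qed
  have "norm (P c) \<le> norm (P x) + N" if "x \<in> {s..t}" for x
  proof -
    have "norm (P c - P x) \<le> N"
      using step[of x c] step[of c x] that c by (cases "x \<le> c") (auto simp: norm_minus_commute)
    then show ?thesis by (metis add.commute add_le_cancel_left norm_triangle_sub order_trans)
  qed
  moreover have cn: "(\<lambda>x. norm (P x)) integrable_on {s..t}"
    by (intro integrable_continuous_real continuous_intros primitive_on_Icc_continuous[OF P])
  ultimately have "integral {s..t} (\<lambda>x. norm (P c)) \<le> integral {s..t} (\<lambda>x. norm (P x) + N)"
    by (intro integral_le integrable_add) auto
  also have "\<dots> = integral {s..t} (\<lambda>x. norm (P x)) + integral {s..t} (\<lambda>x. N)"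
    by (rule Henstock_Kurzweil_Integration.integral_add[OF cn]) auto
  finally show ?thesis using st by (simp add: N_def)
qed

lemma indicator_Icc_integral:
  fixes F :: "real \<Rightarrow> 'b::euclidean_space"
  assumes F: "F absolutely_integrable_on S" and st: "{s<..<t} \<subseteq> S"
  shows "(\<lambda>x. indicator {s..t} x *\<^sub>R F x) absolutely_integrable_on S"
    "integral S (\<lambda>x. indicator {s..t} x *\<^sub>R F x) = integral {s..t} F"
proof -
  have eq: "(\<lambda>x. indicator {s..t} x *\<^sub>R F x) = (\<lambda>x. if x \<in> {s..t} then F x else 0)"
    by (auto simp: indicator_def)
  have "F absolutely_integrable_on {s<..<t}"
    by (rule set_integrable_subset[OF F _ st]) auto
  then have "F absolutely_integrable_on {s..t}" by (simp only: absolutely_integrable_on_Icc_iff_Ioo)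
  then have "(\<lambda>x. if x \<in> {s..t} then F x else 0) absolutely_integrable_on UNIV"
    by (simp only: absolutely_integrable_restrict_UNIV)
  moreover have "negligible {x \<in> UNIV - S. (if x \<in> {s..t} then F x else 0) \<noteq> 0}"
  proof (rule negligible_subset[of "{s, t}"])
    show "{x \<in> UNIV - S. (if x \<in> {s..t} then F x else 0) \<noteq> 0} \<subseteq> {s, t}"
    proof
      fix x assume "x \<in> {x \<in> UNIV - S. (if x \<in> {s..t} then F x else 0) \<noteq> 0}"
      then have "x \<in> {s..t}" "x \<notin> S" by (auto split: if_splits)
      then have "x \<in> {s..t}" "x \<notin> {s<..<t}" using st by blast+
      then show "x \<in> {s, t}" by auto
    qed
  qed auto
  ultimately show "(\<lambda>x. indicator {s..t} x *\<^sub>R F x) absolutely_integrable_on S"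
    unfolding eq by (subst absolutely_integrable_spike_set_eq[where T = UNIV]) auto
  have "integral S (\<lambda>x. if x \<in> {s..t} then F x else 0) = integral ({s..t} \<inter> S) F"
    by (simp only: integral_restrict_Int)
  also have "\<dots> = integral {s..t} F"
    by (intro integral_spike_set; rule negligible_subset[of "{s, t}"])
       (use st in force)+
  finally show "integral S (\<lambda>x. indicator {s..t} x *\<^sub>R F x) = integral {s..t} F"
    unfolding eq .
qed

text \<open>
  The limit of \<open>P\<close> at the endpoint \<open>c\<close>; an integrable function with integrable derivative tends to
  zero at an infinite endpoint.
\<close>

definition boundary_value :: "(real \<Rightarrow> 'b::zero) \<Rightarrow> ereal \<Rightarrow> 'b" where
  "boundary_value P c = (if \<bar>c\<bar> = \<infinity> then 0 else P (real_of_ereal c))"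

text \<open>
  Finite endpoints lie in the closure, where \<open>P\<close> is continuous. Near an infinite endpoint
  \<open>P (x n)\<close> is bounded by the integral of \<open>|P| + |F|\<close> over a unit interval containing \<open>x n\<close>; these unit
  intervals leave every bounded set, so by dominated convergence the integrals tend to zero.
\<close>

lemma primitive_tendsto_boundary_value:
  fixes P F :: "real \<Rightarrow> 'b::euclidean_space"
  assumes ab: "a < b" and P: "primitive_on (closure (einterval a b)) P F"
    and PI: "integrable (lebesgue_on (einterval a b)) P" and FI: "integrable (lebesgue_on (einterval a b)) F"
    and x: "\<And>n. x n \<in> einterval a b" and lim: "(\<lambda>n. ereal (x n)) \<longlonglongrightarrow> c" and c: "c = a \<or> c = b"
  shows "(\<lambda>n. P (x n)) \<longlonglongrightarrow> boundary_value P c"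
proof (cases "\<bar>c\<bar> = \<infinity>")
  case False
  then obtain r where r: "c = ereal r" by (cases c) auto
  have "r \<in> closure (einterval a b)" using c ab r by (auto simp: closure_einterval)
  moreover have "x \<longlonglongrightarrow> r" using lim r by simp
  moreover have "x n \<in> closure (einterval a b)" for n using x[of n] closure_subset by blast
  ultimately have "(\<lambda>n. P (x n)) \<longlonglongrightarrow> P r"
    using primitive_on_closure_continuous[OF P] by (auto simp: continuous_on_sequentially o_def)
  then show ?thesis using r by (simp add: boundary_value_def)
next
  case True
  let ?I = "einterval a b"
  \<comment> \<open>a unit interval inside the closed edge that contains \<open>x n\<close>: to the right of \<open>x n\<close> if \<open>b = \<infinity>\<close>, to its left if \<open>a = -\<infinity>\<close>\<close>
  obtain s where s: "\<And>n. s n \<in> closure ?I" "\<And>n. s n + 1 \<in> closure ?I" "\<And>n. x n \<in> {s n..s n + 1}"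
  proof (cases "c = \<infinity>")
    case True
    then have "b = \<infinity>" using c ab by auto
    have "x n \<in> closure ?I" "x n + 1 \<in> closure ?I" for n
    proof -
      have "a \<le> ereal (x n)" using x[of n] by (simp add: einterval_def less_imp_le)
      moreover have "ereal (x n) \<le> ereal (x n + 1)" by simp
      ultimately have "a \<le> ereal (x n + 1)" by (rule order_trans)
      then show "x n \<in> closure ?I" "x n + 1 \<in> closure ?I"
        using \<open>a \<le> ereal (x n)\<close> \<open>b = \<infinity>\<close> unfolding closure_einterval[OF ab] by auto
    qed
    then show ?thesis using that[of x] by auto
  next
    case False
    then have "c = -\<infinity>" using True by auto
    then have "a = -\<infinity>" using c ab by auto
    have "x n \<in> closure ?I" "x n - 1 \<in> closure ?I" for n
    proof -
      have "ereal (x n) \<le> b" using x[of n] by (simp add: einterval_def less_imp_le)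
      moreover have "ereal (x n - 1) \<le> ereal (x n)" by simp
      ultimately have "ereal (x n - 1) \<le> b" by (rule order_trans[rotated])
      then show "x n \<in> closure ?I" "x n - 1 \<in> closure ?I"
        using \<open>ereal (x n) \<le> b\<close> \<open>a = -\<infinity>\<close> unfolding closure_einterval[OF ab] by auto
    qed
    then show ?thesis using that[of "\<lambda>n. x n - 1"] by auto
  qed
  have xinf: "\<forall>\<^sub>F n in sequentially. y \<notin> {s n..s n + 1}" for y
  proof (cases "c = \<infinity>")
    case True
    then have "\<forall>\<^sub>F n in sequentially. ereal (y + 1) < ereal (x n)"
      using lim by (intro order_tendstoD) auto
    then show ?thesis
    proof eventually_elim
      case (elim n)
      then show ?case using s(3)[of n] by auto
    qed
  next
    case False
    then have "c = -\<infinity>" using True by auto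
    then have "\<forall>\<^sub>F n in sequentially. ereal (x n) < ereal (y - 1)"
      using lim by (intro order_tendstoD) auto
    then show ?thesis
    proof eventually_elim
      case (elim n)
      then show ?case using s(3)[of n] by auto
    qed
  qed
  have vanish: "(\<lambda>n. integral {s n..s n + 1} (\<lambda>y. norm (Q y))) \<longlonglongrightarrow> 0"
    if "integrable (lebesgue_on ?I) Q" for Q :: "real \<Rightarrow> 'b"
  proof -
    have ai: "(\<lambda>y. norm (Q y)) absolutely_integrable_on ?I"
      using integrable_norm[OF that] by (simp add: integrable_lebesgue_on_iff)
    have sub: "{s n<..<s n + 1} \<subseteq> ?I" for n by (rule Ioo_subset_einterval[OF s(1,2)])
    note ind = indicator_Icc_integral[OF ai sub]
    have "(\<lambda>n. integral ?I (\<lambda>y. indicator {s n..s n + 1} y *\<^sub>R norm (Q y))) \<longlonglongrightarrow> integral ?I (\<lambda>y. 0)"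
    proof (rule dominated_convergence(2))
      show "(\<lambda>y. indicator {s n..s n + 1} y *\<^sub>R norm (Q y)) integrable_on ?I" for n
        using ind by (simp add: absolutely_integrable_on_def)
      show "(\<lambda>y. norm (Q y)) integrable_on ?I" using ai by (simp add: absolutely_integrable_on_def)
      show "norm (indicator {s n..s n + 1} y *\<^sub>R norm (Q y)) \<le> norm (Q y)" for n y
        by (auto simp: indicator_def)
      show "(\<lambda>n. indicator {s n..s n + 1} y *\<^sub>R norm (Q y)) \<longlonglongrightarrow> 0" for y
        by (rule tendsto_eventually) (use xinf[of y] in eventually_elim, simp)
    qed
    then show ?thesis unfolding ind by simp
  qed
  have bound: "norm (P (x n)) \<le> integral {s n..s n + 1} (\<lambda>y. norm (P y)) + integral {s n..s n + 1} (\<lambda>y. norm (F y))" for n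
  proof -
    have sub: "{s n..s n + 1} \<subseteq> closure ?I"
      using mem_is_interval_1_I[OF is_interval_closure_einterval s(1)[of n] s(2)[of n]] by (simp add: subset_iff)
    show ?thesis
      using primitive_on_norm_le[OF primitive_on_subset[OF P sub] _ s(3)] by simp
  qed
  have "(\<lambda>n. P (x n)) \<longlonglongrightarrow> 0"
    using tendsto_add[OF vanish[OF PI] vanish[OF FI]]
    by (intro Lim_null_comparison[OF always_eventually[OF allI[OF bound]]]) simp
  then show ?thesis using True by (simp add: boundary_value_def)
qed

lemma fundamental_theorem_einterval:
  fixes P F :: "real \<Rightarrow> 'b::euclidean_space"
  assumes ab: "a < b" and P: "primitive_on (closure (einterval a b)) P F"
    and PI: "integrable (lebesgue_on (einterval a b)) P" and FI: "integrable (lebesgue_on (einterval a b)) F"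
  shows "(LINT x|lebesgue_on (einterval a b). F x) = boundary_value P b - boundary_value P a"
proof -
  let ?I = "einterval a b"
  obtain u l :: "nat \<Rightarrow> real" where ul: "?I = (\<Union>i. {l i .. u i})" "incseq u" "decseq l" "\<And>i. l i < u i"
    "\<And>i. a < l i" "\<And>i. u i < b" "l \<longlonglongrightarrow> a" "u \<longlonglongrightarrow> b"
    by (rule einterval_Icc_approximation[OF ab]) blast
  have mem: "l i \<in> ?I" "u i \<in> ?I" for i
  proof -
    have "l i \<in> {l i..u i}" "u i \<in> {l i..u i}" using ul(4)[of i] by auto
    then show "l i \<in> ?I" "u i \<in> ?I" unfolding ul(1) by blast+
  qed
  have sub: "{l i..u i} \<subseteq> ?I" for i unfolding ul(1) by blast
  have int: "integral {l i..u i} F = P (u i) - P (l i)" for i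
    using primitive_onD(3)[OF P, of "l i" "u i"] mem[of i] closure_subset[of ?I] ul(4)[of i] by auto
  have ai: "F absolutely_integrable_on ?I" using FI by (simp add: integrable_lebesgue_on_iff)
  have "{l i<..<u i} \<subseteq> ?I" for i using sub[of i] greaterThanLessThan_subseteq_atLeastAtMost_iff by blast
  note ind = indicator_Icc_integral[OF ai this]
  have "(\<lambda>i. integral ?I (\<lambda>x. indicator {l i..u i} x *\<^sub>R F x)) \<longlonglongrightarrow> integral ?I F"
  proof (rule dominated_convergence(2))
    show "(\<lambda>x. indicator {l i..u i} x *\<^sub>R F x) integrable_on ?I" for i
      using ind by (simp add: absolutely_integrable_on_def)
    show "(\<lambda>x. norm (F x)) integrable_on ?I" using ai by (simp add: absolutely_integrable_on_def)
    show "norm (indicator {l i..u i} x *\<^sub>R F x) \<le> norm (F x)" for i x by (auto simp: indicator_def)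
    fix x assume "x \<in> ?I"
    then obtain i where i: "x \<in> {l i..u i}" unfolding ul(1) by blast
    have "\<forall>\<^sub>F j in sequentially. indicator {l j..u j} x *\<^sub>R F x = F x"
      using eventually_ge_at_top[of i]
    proof eventually_elim
      case (elim j)
      then have "l j \<le> l i" "u i \<le> u j" using ul(2,3) by (auto simp: incseq_def decseq_def)
      then show ?case using i by (auto simp: indicator_def)
    qed
    then show "(\<lambda>i. indicator {l i..u i} x *\<^sub>R F x) \<longlonglongrightarrow> F x" by (rule tendsto_eventually)
  qed
  then have "(\<lambda>i. P (u i) - P (l i)) \<longlonglongrightarrow> (LINT x|lebesgue_on ?I. F x)"
    unfolding ind int using lebesgue_integral_eq_integral[OF FI] by simp
  moreover have "(\<lambda>i. P (u i) - P (l i)) \<longlonglongrightarrow> boundary_value P b - boundary_value P a"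
    using primitive_tendsto_boundary_value[OF ab P PI FI mem(2) ul(8)]
      primitive_tendsto_boundary_value[OF ab P PI FI mem(1) ul(7)]
    by (intro tendsto_diff) auto
  ultimately show ?thesis by (rule LIMSEQ_unique)
qed

lemma has_weak_deriv_L2:
  assumes "has_weak_deriv I f g" shows "f \<in> L2 I" "g \<in> L2 I"
  using assms by (auto simp: has_weak_deriv_def)

lemma finite_end_in_closure:
  assumes "a < b" "c = a \<or> c = b" "\<bar>c\<bar> \<noteq> \<infinity>"
  shows "real_of_ereal c \<in> closure (einterval a b)"
proof -
  obtain r where r: "c = ereal r" using assms(3) by (cases c) auto
  show ?thesis using assms(1,2) r by (auto simp: closure_einterval)
qed

lemma L2_norm_cong:
  fixes f g :: "real \<Rightarrow> 'k::rc_scalar"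
  assumes "f \<in> borel_measurable (lebesgue_on S)" "g \<in> borel_measurable (lebesgue_on S)"
    "AE t in lebesgue_on S. f t = g t"
  shows "L2_norm S f = L2_norm S g"
proof -
  have "(LINT t|lebesgue_on S. (norm (f t))\<^sup>2) = (LINT t|lebesgue_on S. (norm (g t))\<^sup>2)"
  proof (rule integral_cong_AE)
    show "(\<lambda>t. (norm (f t))\<^sup>2) \<in> borel_measurable (lebesgue_on S)" "(\<lambda>t. (norm (g t))\<^sup>2) \<in> borel_measurable (lebesgue_on S)"
      using assms(1,2) by measurable
    show "AE t in lebesgue_on S. (norm (f t))\<^sup>2 = (norm (g t))\<^sup>2" using assms(3) by eventually_elim simp
  qed
  then show ?thesis by (simp add: L2_norm_def)
qed

lemma L2_inner_cong:
  fixes f g :: "real \<Rightarrow> 'k::rc_scalar"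
  assumes "f \<in> borel_measurable (lebesgue_on S)" "f' \<in> borel_measurable (lebesgue_on S)"
    "g \<in> borel_measurable (lebesgue_on S)" "g' \<in> borel_measurable (lebesgue_on S)"
    "AE t in lebesgue_on S. f t = f' t" "AE t in lebesgue_on S. g t = g' t"
  shows "L2_inner S f g = L2_inner S f' g'"
  unfolding L2_inner_def
proof (rule integral_cong_AE)
  show "(\<lambda>t. f t * kconj (g t)) \<in> borel_measurable (lebesgue_on S)"
    "(\<lambda>t. f' t * kconj (g' t)) \<in> borel_measurable (lebesgue_on S)"
    using assms(1-4) by measurable
  show "AE t in lebesgue_on S. f t * kconj (g t) = f' t * kconj (g' t)"
    using assms(5,6) by eventually_elim simp
qed

lemma L2_cong_AE:
  fixes f u :: "real \<Rightarrow> 'k::rc_scalar"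
  assumes f: "f \<in> L2 S" and u: "u \<in> borel_measurable (lebesgue_on S)" and ae: "AE t in lebesgue_on S. u t = f t"
  shows "u \<in> L2 S"
proof -
  note [measurable] = u L2D(1)[OF f]
  have "integrable (lebesgue_on S) (\<lambda>t. (norm (u t))\<^sup>2)"
  proof (rule integrable_cong_AE_imp[OF L2D(2)[OF f]])
    show "AE t in lebesgue_on S. (norm (f t))\<^sup>2 = (norm (u t))\<^sup>2" using ae by eventually_elim simp
  qed measurable
  then show ?thesis using u by (simp add: L2_def)
qed

text \<open>
  The fundamental theorem of calculus on the whole edge, for the product of one continuous
  representative with the conjugate of the other.
\<close>

lemma Green_edge:
  fixes f g f' g' :: "real \<Rightarrow> 'k::rc_scalar"
  assumes ab: "a < b" and fg: "has_weak_deriv (einterval a b) f g" and fg': "has_weak_deriv (einterval a b) f' g'"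
  defines "P \<equiv> \<lambda>x. cont_rep (einterval a b) f x * kconj (cont_rep (einterval a b) f' x)"
  shows "L2_inner (einterval a b) g f' + L2_inner (einterval a b) f g' = boundary_value P b - boundary_value P a"
proof -
  let ?I = "einterval a b"
  obtain u where u: "primitive_on (closure ?I) u g" "AE t in lebesgue_on ?I. u t = f t"
    using has_weak_deriv_primitive[OF ab fg] by blast
  obtain v where v: "primitive_on (closure ?I) v g'" "AE t in lebesgue_on ?I. v t = f' t"
    using has_weak_deriv_primitive[OF ab fg'] by blast
  note L = has_weak_deriv_L2[OF fg] has_weak_deriv_L2[OF fg']
  have um: "u \<in> borel_measurable (lebesgue_on ?I)" "v \<in> borel_measurable (lebesgue_on ?I)"
    using u(1) v(1) by (auto intro: continuous_on_imp_measurable_einterval primitive_on_closure_continuous)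
  have uL: "u \<in> L2 ?I" by (rule L2_cong_AE[OF L(1) um(1) u(2)])
  have vL: "v \<in> L2 ?I" by (rule L2_cong_AE[OF L(3) um(2) v(2)])
  have "primitive_on (closure ?I) (\<lambda>x. u x * kconj (v x)) (\<lambda>x. g x * kconj (v x) + u x * kconj (g' x))"
    by (rule primitive_on_prod[OF bounded_bilinear_mult_kconj is_interval_closure_einterval u(1) v(1)])
  from fundamental_theorem_einterval[OF ab this]
  have "(LINT x|lebesgue_on ?I. g x * kconj (v x) + u x * kconj (g' x)) =
     boundary_value (\<lambda>x. u x * kconj (v x)) b - boundary_value (\<lambda>x. u x * kconj (v x)) a"
    using L2_mult_kconj_integrable(1)[OF uL vL] L2_mult_kconj_integrable(1)[OF L(2) vL]
      L2_mult_kconj_integrable(1)[OF uL L(4)] by simp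
  moreover have "(LINT x|lebesgue_on ?I. g x * kconj (v x) + u x * kconj (g' x)) = L2_inner ?I g v + L2_inner ?I u g'"
    unfolding L2_inner_def
    by (rule Bochner_Integration.integral_add) (intro L2_mult_kconj_integrable(1) L uL vL)+
  moreover have "L2_inner ?I g v = L2_inner ?I g f'" "L2_inner ?I u g' = L2_inner ?I f g'"
    using L2D(1)[OF L(1)] L2D(1)[OF L(2)] L2D(1)[OF L(3)] L2D(1)[OF L(4)] um u(2) v(2)
    by (auto intro!: L2_inner_cong)
  moreover have "boundary_value (\<lambda>x. u x * kconj (v x)) c = boundary_value P c" if "c = a \<or> c = b" for c
    using finite_end_in_closure[OF ab that] cont_rep_eq[OF u] cont_rep_eq[OF v]
    by (auto simp: boundary_value_def P_def)
  ultimately show ?thesis by simp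
qed

text \<open>
  The averaging estimate for \<open>|u|\<^sup>2\<close>, whose derivative is \<open>2 (u \<bullet> g)\<close>, on an interval of length \<open>l\<close>
  that has the endpoint in question at one of its ends. The constant depends on \<open>l\<close> only, which makes
  the traces square-summable over all edges.
\<close>

lemma trace_bound_edge:
  fixes f g :: "real \<Rightarrow> 'k::rc_scalar"
  assumes ab: "a < b" and fg: "has_weak_deriv (einterval a b) f g" and l: "l > 0" "ereal l \<le> b - a"
    and c: "c = a \<or> c = b" "\<bar>c\<bar> \<noteq> \<infinity>"
  shows "(norm (cont_rep (einterval a b) f (real_of_ereal c)))\<^sup>2
    \<le> (1 / l + 1) * ((L2_norm (einterval a b) f)\<^sup>2 + (L2_norm (einterval a b) g)\<^sup>2)"
proof -
  let ?I = "einterval a b"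
  obtain u where u: "primitive_on (closure ?I) u g" "AE t in lebesgue_on ?I. u t = f t"
    using has_weak_deriv_primitive[OF ab fg] by blast
  note L = has_weak_deriv_L2[OF fg]
  have um: "u \<in> borel_measurable (lebesgue_on ?I)"
    using u(1) by (auto intro: continuous_on_imp_measurable_einterval primitive_on_closure_continuous)
  have uL: "u \<in> L2 ?I" by (rule L2_cong_AE[OF L(1) um u(2)])
  obtain r where r: "c = ereal r" using c by (cases c) auto
  have rc: "r \<in> closure ?I" using finite_end_in_closure[OF ab c] r by simp
  \<comment> \<open>an interval of length \<open>l\<close> in the closed edge with \<open>r\<close> at one of its ends\<close>
  obtain s t where st: "s \<in> closure ?I" "t \<in> closure ?I" "t = s + l" "r \<in> {s..t}"
  proof (cases "c = a")
    case True
    then have "r + l \<in> closure ?I"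
      using l ab r unfolding closure_einterval[OF ab] by (cases b) auto
    then show ?thesis using that[of r "r + l"] rc l by auto
  next
    case False
    then have "c = b" using c by simp
    then have "r - l \<in> closure ?I"
      using l ab r unfolding closure_einterval[OF ab] by (cases a) auto
    then show ?thesis using that[of "r - l" r] rc l by auto
  qed
  have sub: "{s..t} \<subseteq> closure ?I"
    using mem_is_interval_1_I[OF is_interval_closure_einterval st(1,2)] by (simp add: subset_iff)
  have P: "primitive_on {s..t} (\<lambda>x. u x \<bullet> u x) (\<lambda>x. g x \<bullet> u x + u x \<bullet> g x)"
    by (rule primitive_on_subset[OF primitive_on_prod[OF bounded_bilinear_inner is_interval_closure_einterval u(1) u(1)] sub])
  have le: "integral {s..t} (\<lambda>x. (norm (k x))\<^sup>2) \<le> (L2_norm ?I k)\<^sup>2" and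
    int: "(\<lambda>x. (norm (k x))\<^sup>2) integrable_on {s..t}" if "k \<in> L2 ?I" for k :: "real \<Rightarrow> 'k"
  proof -
    have ai: "(\<lambda>x. (norm (k x))\<^sup>2) absolutely_integrable_on ?I"
      using L2D(2)[OF that] by (simp add: integrable_lebesgue_on_iff)
    have "(\<lambda>x. (norm (k x))\<^sup>2) absolutely_integrable_on {s<..<t}"
      by (rule set_integrable_subset[OF ai _ Ioo_subset_einterval[OF st(1,2)]]) auto
    then have i: "(\<lambda>x. (norm (k x))\<^sup>2) integrable_on {s<..<t}" by (simp add: absolutely_integrable_on_def)
    then show "(\<lambda>x. (norm (k x))\<^sup>2) integrable_on {s..t}" by (simp add: integrable_on_Icc_iff_Ioo)
    have "integral {s..t} (\<lambda>x. (norm (k x))\<^sup>2) = integral {s<..<t} (\<lambda>x. (norm (k x))\<^sup>2)"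
      by (simp add: integral_open_interval_real)
    also have "\<dots> \<le> integral ?I (\<lambda>x. (norm (k x))\<^sup>2)"
      using i ai by (intro integral_subset_le Ioo_subset_einterval[OF st(1,2)]) (auto simp: absolutely_integrable_on_def)
    also have "\<dots> = (L2_norm ?I k)\<^sup>2"
      unfolding L2_norm_power2 using lebesgue_integral_eq_integral[OF L2D(2)[OF that]] by simp
    finally show "integral {s..t} (\<lambda>x. (norm (k x))\<^sup>2) \<le> (L2_norm ?I k)\<^sup>2" .
  qed
  have un: "L2_norm ?I u = L2_norm ?I f" by (rule L2_norm_cong[OF um L2D(1)[OF L(1)] u(2)])
  have "l * norm (u r \<bullet> u r) \<le> integral {s..t} (\<lambda>x. norm (u x \<bullet> u x)) + l * integral {s..t} (\<lambda>x. norm (g x \<bullet> u x + u x \<bullet> g x))"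
    using primitive_on_norm_le[OF P _ st(4)] st(3) l by simp
  also have "integral {s..t} (\<lambda>x. norm (u x \<bullet> u x)) = integral {s..t} (\<lambda>x. (norm (u x))\<^sup>2)"
    by (simp add: power2_norm_eq_inner)
  also have "integral {s..t} (\<lambda>x. norm (g x \<bullet> u x + u x \<bullet> g x)) \<le> integral {s..t} (\<lambda>x. (norm (u x))\<^sup>2 + (norm (g x))\<^sup>2)"
  proof (rule integral_le)
    show "(\<lambda>x. norm (g x \<bullet> u x + u x \<bullet> g x)) integrable_on {s..t}"
      using primitive_onD(1)[OF P, of s t] st(3) l by (auto simp: absolutely_integrable_on_def)
    show "(\<lambda>x. (norm (u x))\<^sup>2 + (norm (g x))\<^sup>2) integrable_on {s..t}"
      by (intro integrable_add int uL L)
    fix x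
    have "\<bar>g x \<bullet> u x\<bar> \<le> norm (g x) * norm (u x)" by (rule Cauchy_Schwarz_ineq2)
    moreover have "2 * norm (g x) * norm (u x) \<le> (norm (u x))\<^sup>2 + (norm (g x))\<^sup>2"
      using zero_le_power2[of "norm (g x) - norm (u x)"] unfolding power2_diff by linarith
    ultimately show "norm (g x \<bullet> u x + u x \<bullet> g x) \<le> (norm (u x))\<^sup>2 + (norm (g x))\<^sup>2"
      by (simp add: inner_commute)
  qed
  also have "\<dots> = integral {s..t} (\<lambda>x. (norm (u x))\<^sup>2) + integral {s..t} (\<lambda>x. (norm (g x))\<^sup>2)"
    by (intro Henstock_Kurzweil_Integration.integral_add int uL L)
  finally have "l * (norm (u r))\<^sup>2 \<le> (L2_norm ?I f)\<^sup>2 + l * ((L2_norm ?I f)\<^sup>2 + (L2_norm ?I g)\<^sup>2)"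
    using le[OF uL] le[OF L(2)] l unfolding un
    by (smt (verit, ccfv_SIG) mult_left_mono power2_norm_eq_inner real_norm_def zero_le_power2)
  also have "\<dots> \<le> l * ((1 / l + 1) * ((L2_norm ?I f)\<^sup>2 + (L2_norm ?I g)\<^sup>2))"
    using l by (simp add: field_simps)
  finally have "(norm (u r))\<^sup>2 \<le> (1 / l + 1) * ((L2_norm ?I f)\<^sup>2 + (L2_norm ?I g)\<^sup>2)"
    using l by (simp only: mult_le_cancel_left_pos)
  then show ?thesis using cont_rep_eq[OF u rc] r by simp
qed

section \<open>Functions with prescribed boundary values\<close>

text \<open>
  The bound is asked for on the edge only, since a tent function centred at an endpoint also lives
  outside the edge.
\<close>

lemma L2_if_bounded_on_Icc:
  fixes f :: "real \<Rightarrow> 'k::rc_scalar"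
  assumes f: "f \<in> borel_measurable borel" and l: "l > 0"
    and le: "\<forall>t\<in>einterval a b. norm (f t) \<le> B * indicator {s..s + l} t"
  shows "f \<in> L2 (einterval a b)" "(L2_norm (einterval a b) f)\<^sup>2 \<le> B\<^sup>2 * l"
proof -
  let ?I = "einterval a b"
  define w :: "real \<Rightarrow> real" where "w t = B\<^sup>2 * indicator {s..s + l} t" for t
  have fm: "f \<in> borel_measurable (lebesgue_on ?I)"
    by (intro measurable_restrict_space1 measurable_completion) (use f in simp)
  have w0: "w t \<ge> 0" for t by (simp add: w_def)
  have "((\<lambda>x. if x \<in> {s..s + l} then B\<^sup>2 else 0) has_integral (B\<^sup>2 * l)) UNIV"
    using l has_integral_const_real[of "B\<^sup>2" s "s + l"] by (subst has_integral_restrict_UNIV) (simp add: mult.commute)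
  moreover have "(\<lambda>x. if x \<in> {s..s + l} then B\<^sup>2 else 0) = w" by (auto simp: w_def indicator_def)
  ultimately have wU: "(w has_integral (B\<^sup>2 * l)) UNIV" by simp
  then have "w absolutely_integrable_on UNIV"
    using w0 by (intro nonnegative_absolutely_integrable_1) auto
  then have wI: "w absolutely_integrable_on ?I" by (rule set_integrable_subset) auto
  then have wint: "integrable (lebesgue_on ?I) w" by (simp add: integrable_lebesgue_on_iff)
  have fle: "(norm (f t))\<^sup>2 \<le> w t" if "t \<in> ?I" for t
    using power_mono[OF bspec[OF le that] norm_ge_zero, of 2] by (auto simp: w_def indicator_def)
  have "integrable (lebesgue_on ?I) (\<lambda>t. (norm (f t))\<^sup>2)"
  proof (rule Bochner_Integration.integrable_bound[OF wint])
    show "(\<lambda>t. (norm (f t))\<^sup>2) \<in> borel_measurable (lebesgue_on ?I)" using fm by measurable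
    show "AE t in lebesgue_on ?I. norm ((norm (f t))\<^sup>2) \<le> norm (w t)"
      by (rule AE_I2) (use fle w0 in auto)
  qed
  then show fL: "f \<in> L2 ?I" using fm by (simp add: L2_def)
  have "(L2_norm ?I f)\<^sup>2 \<le> (LINT t|lebesgue_on ?I. w t)"
    unfolding L2_norm_power2 by (rule integral_mono[OF L2D(2)[OF fL] wint]) (use fle in simp)
  also have "\<dots> = integral ?I w" by (rule lebesgue_integral_eq_integral[OF wint]) simp
  also have "\<dots> \<le> integral UNIV w"
    using wI wU w0 by (intro integral_subset_le) (auto simp: absolutely_integrable_on_def)
  also have "\<dots> = B\<^sup>2 * l" using wU by (rule integral_unique)
  finally show "(L2_norm ?I f)\<^sup>2 \<le> B\<^sup>2 * l" .
qed

lemma L2_norm_add_le: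
  fixes f g :: "real \<Rightarrow> 'k::rc_scalar"
  assumes f: "f \<in> L2 S" and g: "g \<in> L2 S"
  shows "(L2_norm S (\<lambda>t. f t + g t))\<^sup>2 \<le> 2 * (L2_norm S f)\<^sup>2 + 2 * (L2_norm S g)\<^sup>2"
proof -
  have "(LINT t|lebesgue_on S. (norm (f t + g t))\<^sup>2) \<le> (LINT t|lebesgue_on S. 2 * (norm (f t))\<^sup>2 + 2 * (norm (g t))\<^sup>2)"
    using L2D(2)[OF L2_add[OF f g]] L2D(2)[OF f] L2D(2)[OF g]
    by (intro integral_mono power2_norm_add_le) auto
  also have "\<dots> = 2 * (LINT t|lebesgue_on S. (norm (f t))\<^sup>2) + 2 * (LINT t|lebesgue_on S. (norm (g t))\<^sup>2)"
    using L2D(2)[OF f] L2D(2)[OF g] by simp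
  finally show ?thesis by (simp add: L2_norm_power2)
qed

lemma has_weak_derivI_self:
  fixes u g :: "real \<Rightarrow> 'k::rc_scalar"
  assumes ab: "a < b" and u: "u \<in> L2 (einterval a b)" and g: "g \<in> L2 (einterval a b)"
    and p: "primitive_on (closure (einterval a b)) u g"
  shows "has_weak_deriv (einterval a b) u g"
    "x \<in> closure (einterval a b) \<Longrightarrow> cont_rep (einterval a b) u x = u x"
  using has_weak_derivI[OF ab u g p] cont_rep_eq[OF p] by auto

definition hat :: "real \<Rightarrow> real \<Rightarrow> real \<Rightarrow> real" where
  "hat c l t = max 0 (1 - \<bar>t - c\<bar> / l)"

definition hat_deriv :: "real \<Rightarrow> real \<Rightarrow> real \<Rightarrow> real" where
  "hat_deriv c l t = (if \<bar>t - c\<bar> < l then (if t < c then 1 / l else - 1 / l) else 0)"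

lemma primitive_on_hat:
  assumes l: "l > 0"
  shows "primitive_on J (hat c l) (hat_deriv c l)"
  unfolding primitive_on_def
proof (intro ballI impI conjI)
  fix s t :: real assume st: "s \<le> t"
  have der: "(hat c l has_vector_derivative hat_deriv c l x) (at x)" if x: "x \<notin> {c - l, c, c + l}" for x
  proof -
    consider "x < c - l" | "c - l < x" "x < c" | "c < x" "x < c + l" | "c + l < x" using x by fastforce
    then have "(hat c l has_real_derivative hat_deriv c l x) (at x)"
    proof cases
      case 1
      have "((\<lambda>_. 0) has_real_derivative 0) (at x)" by simp
      then have "(hat c l has_real_derivative 0) (at x)"
        by (rule has_field_derivative_transform_within_open[of _ _ _ "{..<c - l}"])
           (use 1 l in \<open>auto simp: hat_def max_def field_simps\<close>)
      then show ?thesis using 1 l by (simp add: hat_deriv_def)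
    next
      case 2
      have "((\<lambda>t. 1 - (c - t) / l) has_real_derivative 1 / l) (at x)"
        using l by (auto intro!: derivative_eq_intros simp: field_simps)
      then have "(hat c l has_real_derivative 1 / l) (at x)"
        by (rule has_field_derivative_transform_within_open[of _ _ _ "{c - l<..<c}"])
           (use 2 l in \<open>auto simp: hat_def max_def field_simps\<close>)
      then show ?thesis using 2 l by (simp add: hat_deriv_def)
    next
      case 3
      have "((\<lambda>t. 1 - (t - c) / l) has_real_derivative - 1 / l) (at x)"
        using l by (auto intro!: derivative_eq_intros simp: field_simps)
      then have "(hat c l has_real_derivative - 1 / l) (at x)"
        by (rule has_field_derivative_transform_within_open[of _ _ _ "{c<..<c + l}"])
           (use 3 l in \<open>auto simp: hat_def max_def field_simps\<close>)
      then show ?thesis using 3 l by (simp add: hat_deriv_def)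
    next
      case 4
      have "((\<lambda>_. 0) has_real_derivative 0) (at x)" by simp
      then have "(hat c l has_real_derivative 0) (at x)"
        by (rule has_field_derivative_transform_within_open[of _ _ _ "{c + l<..}"])
           (use 4 l in \<open>auto simp: hat_def max_def field_simps\<close>)
      then show ?thesis using 4 l by (simp add: hat_deriv_def)
    qed
    then show ?thesis by (simp add: has_real_derivative_iff_has_vector_derivative)
  qed
  show hi: "(hat_deriv c l has_integral hat c l t - hat c l s) {s..t}"
  proof (rule fundamental_theorem_of_calculus_interior_strong[of "{c - l, c, c + l}"])
    show "continuous_on {s..t} (hat c l)"
      unfolding hat_def[abs_def] using l by (intro continuous_intros) auto
  qed (use st der in auto)
  show "hat_deriv c l absolutely_integrable_on {s..t}"
  proof (rule measurable_bounded_by_integrable_imp_absolutely_integrable)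
    show "hat_deriv c l \<in> borel_measurable (lebesgue_on {s..t})"
      using hi by (intro integrable_imp_measurable) auto
    show "(\<lambda>_. 1 / l) integrable_on {s..t}" by (rule integrable_const_ivl)
    show "norm (hat_deriv c l x) \<le> 1 / l" for x using l by (simp add: hat_deriv_def)
  qed auto
qed

lemma hat_borel: "hat c l \<in> borel_measurable borel" "hat_deriv c l \<in> borel_measurable borel"
  unfolding hat_def[abs_def] hat_deriv_def[abs_def] by measurable

lemma primitive_on_scaleR_left:
  fixes v :: "'b::euclidean_space"
  assumes "primitive_on J p g"
  shows "primitive_on J (\<lambda>t. p t *\<^sub>R v) (\<lambda>t. g t *\<^sub>R v)"
  unfolding primitive_on_def
proof (intro ballI impI conjI)
  fix s t assume st: "s \<in> J" "t \<in> J" "s \<le> t"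
  note D = primitive_onD[OF assms st]
  show "(\<lambda>t. g t *\<^sub>R v) absolutely_integrable_on {s..t}"
    using absolutely_integrable_linear[OF D(1) bounded_linear_scaleR_left[of v]] by (simp add: o_def)
  show "((\<lambda>t. g t *\<^sub>R v) has_integral p t *\<^sub>R v - p s *\<^sub>R v) {s..t}"
    using has_integral_scaleR_left[OF D(2), of v] by (simp add: scaleR_diff_left)
qed

lemma primitive_on_add:
  assumes "primitive_on J p g" "primitive_on J q h"
  shows "primitive_on J (\<lambda>t. p t + q t) (\<lambda>t. g t + h t)"
  unfolding primitive_on_def
proof (intro ballI impI conjI)
  fix s t assume st: "s \<in> J" "t \<in> J" "s \<le> t"
  show "(\<lambda>t. g t + h t) absolutely_integrable_on {s..t}"
    by (intro set_integral_add primitive_onD(1)[OF assms(1) st] primitive_onD(1)[OF assms(2) st])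
  show "((\<lambda>t. g t + h t) has_integral p t + q t - (p s + q s)) {s..t}"
    using has_integral_add[OF primitive_onD(2)[OF assms(1) st] primitive_onD(2)[OF assms(2) st]]
    by (simp add: algebra_simps)
qed

text \<open>
  Put a tent of height \<open>x\<close> at the left endpoint and one of height \<open>y\<close> at the right endpoint. Both have
  half-width \<open>l\<close>, so each vanishes at the other endpoint. At an infinite endpoint the height is zero,
  and it is harmless that \<open>real_of_ereal\<close> places the tent at the point 0. The bounds do not depend on
  the edge, so the extensions on all edges form an element of the direct sum.
\<close>

lemma edge_extension:
  fixes x y :: "'k::rc_scalar"
  assumes ab: "a < b" and l: "l > 0" "ereal l \<le> b - a"
    and x: "a = -\<infinity> \<Longrightarrow> x = 0" and y: "b = \<infinity> \<Longrightarrow> y = 0"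
  shows "\<exists>f g. has_weak_deriv (einterval a b) f g \<and>
     (a \<noteq> -\<infinity> \<longrightarrow> cont_rep (einterval a b) f (real_of_ereal a) = x) \<and>
     (b \<noteq> \<infinity> \<longrightarrow> cont_rep (einterval a b) f (real_of_ereal b) = y) \<and>
     (L2_norm (einterval a b) f)\<^sup>2 \<le> 2 * l * ((norm x)\<^sup>2 + (norm y)\<^sup>2) \<and>
     (L2_norm (einterval a b) g)\<^sup>2 \<le> 2 / l * ((norm x)\<^sup>2 + (norm y)\<^sup>2)"
proof -
  let ?I = "einterval a b"
  define \<alpha> \<beta> where "\<alpha> = real_of_ereal a" and "\<beta> = real_of_ereal b"
  have al: "a = ereal \<alpha>" if "x \<noteq> 0" using that x ab unfolding \<alpha>_def by (cases a) auto
  have be: "b = ereal \<beta>" if "y \<noteq> 0" using that y ab unfolding \<beta>_def by (cases b) auto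
  define f1 g1 f2 g2 where fg: "f1 t = hat \<alpha> l t *\<^sub>R x" "g1 t = hat_deriv \<alpha> l t *\<^sub>R x"
    "f2 t = hat \<beta> l t *\<^sub>R y" "g2 t = hat_deriv \<beta> l t *\<^sub>R y" for t
  note [measurable] = hat_borel
  have m: "f1 \<in> borel_measurable borel" "g1 \<in> borel_measurable borel" "f2 \<in> borel_measurable borel" "g2 \<in> borel_measurable borel"
    unfolding fg[abs_def] by measurable
  have b1: "norm (f1 t) \<le> norm x * indicator {\<alpha>..\<alpha> + l} t" "norm (g1 t) \<le> (norm x / l) * indicator {\<alpha>..\<alpha> + l} t"
    if t: "t \<in> ?I" for t
  proof -
    have "x = 0 \<or> t \<in> {\<alpha>..\<alpha> + l} \<or> t > \<alpha> + l" using al t by (force simp: einterval_def)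
    then show "norm (f1 t) \<le> norm x * indicator {\<alpha>..\<alpha> + l} t" "norm (g1 t) \<le> (norm x / l) * indicator {\<alpha>..\<alpha> + l} t"
      using l unfolding fg
      by (auto simp: hat_def hat_deriv_def max_def abs_mult intro!: mult_right_le_one_le mult_left_le_one_le)
  qed
  have b2: "norm (f2 t) \<le> norm y * indicator {\<beta> - l..\<beta> - l + l} t" "norm (g2 t) \<le> (norm y / l) * indicator {\<beta> - l..\<beta> - l + l} t"
    if t: "t \<in> ?I" for t
  proof -
    have "y = 0 \<or> t \<in> {\<beta> - l..\<beta> - l + l} \<or> t < \<beta> - l" using be t by (force simp: einterval_def)
    then show "norm (f2 t) \<le> norm y * indicator {\<beta> - l..\<beta> - l + l} t" "norm (g2 t) \<le> (norm y / l) * indicator {\<beta> - l..\<beta> - l + l} t"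
      using l unfolding fg
      by (auto simp: hat_def hat_deriv_def max_def abs_mult intro!: mult_right_le_one_le mult_left_le_one_le)
  qed
  have B: "\<forall>t\<in>?I. norm (f1 t) \<le> norm x * indicator {\<alpha>..\<alpha> + l} t"
    "\<forall>t\<in>?I. norm (g1 t) \<le> (norm x / l) * indicator {\<alpha>..\<alpha> + l} t"
    "\<forall>t\<in>?I. norm (f2 t) \<le> norm y * indicator {\<beta> - l..\<beta> - l + l} t"
    "\<forall>t\<in>?I. norm (g2 t) \<le> (norm y / l) * indicator {\<beta> - l..\<beta> - l + l} t"
    using b1 b2 by blast+
  note L = L2_if_bounded_on_Icc[OF m(1) l(1) B(1)] L2_if_bounded_on_Icc[OF m(2) l(1) B(2)]
    L2_if_bounded_on_Icc[OF m(3) l(1) B(3)] L2_if_bounded_on_Icc[OF m(4) l(1) B(4)]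
  let ?f = "\<lambda>t. f1 t + f2 t" and ?g = "\<lambda>t. g1 t + g2 t"
  have prim: "primitive_on (closure ?I) ?f ?g"
    unfolding fg by (intro primitive_on_add primitive_on_scaleR_left primitive_on_hat l)
  have fL: "?f \<in> L2 ?I" and gL: "?g \<in> L2 ?I" using L by (auto intro: L2_add)
  note wd = has_weak_derivI_self[OF ab fL gL prim]
  have h1: "hat c l c = 1" for c using l by (simp add: hat_def)
  have far: "hat \<alpha> l \<beta> = 0" "hat \<beta> l \<alpha> = 0" if "a \<noteq> -\<infinity>" "b \<noteq> \<infinity>"
  proof -
    have "a = ereal \<alpha>" "b = ereal \<beta>" using that ab unfolding \<alpha>_def \<beta>_def by (cases a; cases b; simp)+
    then have "l \<le> \<beta> - \<alpha>" using l(2) by simp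
    then have "1 \<le> \<bar>\<beta> - \<alpha>\<bar> / l" "1 \<le> \<bar>\<alpha> - \<beta>\<bar> / l" using l(1) by simp_all
    then show "hat \<alpha> l \<beta> = 0" "hat \<beta> l \<alpha> = 0" by (simp_all add: hat_def)
  qed
  have "cont_rep ?I ?f (real_of_ereal a) = x" if "a \<noteq> -\<infinity>"
  proof -
    have "\<bar>a\<bar> \<noteq> \<infinity>" using that ab by auto
    then have "cont_rep ?I ?f \<alpha> = ?f \<alpha>"
      unfolding \<alpha>_def by (intro wd(2) finite_end_in_closure ab) auto
    also have "\<dots> = x" using far(2)[OF that] y h1 by (cases "b = \<infinity>") (auto simp: fg)
    finally show ?thesis by (simp add: \<alpha>_def)
  qed
  moreover have "cont_rep ?I ?f (real_of_ereal b) = y" if "b \<noteq> \<infinity>"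
  proof -
    have "\<bar>b\<bar> \<noteq> \<infinity>" using that ab by auto
    then have "cont_rep ?I ?f \<beta> = ?f \<beta>"
      unfolding \<beta>_def by (intro wd(2) finite_end_in_closure ab) auto
    also have "\<dots> = y" using far(1)[OF _ that] x h1 by (cases "a = -\<infinity>") (auto simp: fg)
    finally show ?thesis by (simp add: \<beta>_def)
  qed
  moreover have "(L2_norm ?I ?f)\<^sup>2 \<le> 2 * l * ((norm x)\<^sup>2 + (norm y)\<^sup>2)"
    using L2_norm_add_le[OF L(1,5)] L(2,6) by (simp add: algebra_simps)
  moreover have "(L2_norm ?I ?g)\<^sup>2 \<le> 2 / l * ((norm x)\<^sup>2 + (norm y)\<^sup>2)"
  proof -
    have e: "(norm v / l)\<^sup>2 * l = (norm v)\<^sup>2 / l" for v :: 'k using l(1) by (simp add: power2_eq_square)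
    show ?thesis using L2_norm_add_le[OF L(3,7)] L(4,8) unfolding e by (simp add: add_divide_distrib distrib_left)
  qed
  ultimately show ?thesis using wd(1) by blast
qed

section \<open>Square-summable families\<close>

text \<open>
  Polarisation of \<open>x * kconj x = |x|\<^sup>2\<close>: the inner product of the underlying real vector space is the
  real part of \<open>x * kconj y\<close>.
\<close>

lemma mult_kconj_polar: "x * kconj y + y * kconj x = (2 * (x \<bullet> y)) *\<^sub>R (1::'k::rc_scalar)"
proof -
  have "(x + y) * kconj (x + y) = ((norm (x + y))\<^sup>2) *\<^sub>R 1" by (rule mult_kconj)
  then have "x * kconj x + y * kconj y + (x * kconj y + y * kconj x) = ((norm (x + y))\<^sup>2) *\<^sub>R 1"
    by (simp add: kconj_add algebra_simps)
  then show ?thesis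
    by (simp add: mult_kconj power2_norm_eq_inner inner_add_left inner_add_right inner_commute algebra_simps)
qed

text \<open>
  Recovers the scalar-valued product from the real one: if the left-hand side vanishes for all
  \<open>\<alpha>\<close>, then so does \<open>x * kconj z\<close>.
\<close>

lemma inner_mult_right_kconj: "x \<bullet> (\<alpha> * z) = (x * kconj z) \<bullet> (\<alpha>::'k::rc_scalar)"
proof -
  have "(2 * (x \<bullet> (\<alpha> * z))) *\<^sub>R (1::'k) = x * kconj (\<alpha> * z) + \<alpha> * z * kconj x"
    by (rule mult_kconj_polar[symmetric])
  also have "\<dots> = (x * kconj z) * kconj \<alpha> + \<alpha> * kconj (x * kconj z)"
    by (simp add: kconj_mult kconj_kconj algebra_simps)
  also have "\<dots> = (2 * ((x * kconj z) \<bullet> \<alpha>)) *\<^sub>R 1" by (rule mult_kconj_polar)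
  finally show ?thesis by simp
qed

definition ell2_normsq :: "'e set \<Rightarrow> ('e \<Rightarrow> 'k::rc_scalar) \<Rightarrow> real" where
  "ell2_normsq J x = (\<Sum>\<^sub>\<infinity>e\<in>J. (norm (x e))\<^sup>2)"

text \<open>
  The real part of \<open>ell2_inner\<close>, the term that appears when a squared norm is expanded.
\<close>

definition ell2_re_inner :: "'e set \<Rightarrow> ('e \<Rightarrow> 'k::rc_scalar) \<Rightarrow> ('e \<Rightarrow> 'k) \<Rightarrow> real" where
  "ell2_re_inner J x y = (\<Sum>\<^sub>\<infinity>e\<in>J. x e \<bullet> y e)"

lemma summable_on_norm_bound:
  fixes f :: "'e \<Rightarrow> 'b::banach"
  assumes g: "g summable_on A" and le: "\<And>x. x \<in> A \<Longrightarrow> norm (f x) \<le> g x"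
  shows "f summable_on A" "(\<lambda>x. norm (f x)) summable_on A"
proof -
  show "(\<lambda>x. norm (f x)) summable_on A"
    by (rule summable_on_comparison_test[OF g]) (use le in auto)
  then show "f summable_on A" by (rule abs_summable_summable)
qed

lemma norm_has_sum_le:
  fixes f :: "'e \<Rightarrow> 'b::banach"
  assumes f: "(f has_sum a) A" and g: "(g has_sum s) A" and le: "\<And>x. x \<in> A \<Longrightarrow> norm (f x) \<le> g x"
  shows "norm a \<le> s"
proof -
  have "(\<lambda>x. norm (f x)) summable_on A"
    using summable_on_norm_bound(2)[OF has_sum_imp_summable[OF g] le] .
  then have n: "((\<lambda>x. norm (f x)) has_sum (\<Sum>\<^sub>\<infinity>x\<in>A. norm (f x))) A" by simp
  have "norm a \<le> (\<Sum>\<^sub>\<infinity>x\<in>A. norm (f x))" by (rule norm_has_sum_bound[OF n f])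
  also have "\<dots> \<le> s" by (rule has_sum_mono[OF n g le])
  finally show ?thesis .
qed

lemma ell2D: 
  assumes "x \<in> ell2 J"
  shows "(\<lambda>e. (norm (x e))\<^sup>2) summable_on J" "e \<notin> J \<Longrightarrow> x e = 0"
  using assms by (auto simp: ell2_def)

lemma ell2_zero: "(\<lambda>e. 0) \<in> ell2 J"
  by (simp add: ell2_def)

lemma ell2_add: 
  assumes x: "x \<in> ell2 J" and y: "y \<in> ell2 J"
  shows "(\<lambda>e. x e + y e) \<in> ell2 J"
proof -
  have "(\<lambda>e. (norm (x e + y e))\<^sup>2) summable_on J"
  proof (rule summable_on_norm_bound(1))
    show "(\<lambda>e. 2 * (norm (x e))\<^sup>2 + 2 * (norm (y e))\<^sup>2) summable_on J"
      by (intro summable_on_add summable_on_cmult_right ell2D x y)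
  qed (simp add: power2_norm_add_le)
  then show ?thesis using ell2D(2)[OF x] ell2D(2)[OF y] by (simp add: ell2_def)
qed

lemma ell2_scale: "x \<in> ell2 J \<Longrightarrow> (\<lambda>e. c * x e) \<in> ell2 J"
  by (auto simp: ell2_def norm_mult power_mult_distrib intro: summable_on_cmult_right)

lemma ell2_diff: "x \<in> ell2 J \<Longrightarrow> y \<in> ell2 J \<Longrightarrow> (\<lambda>e. x e - y e) \<in> ell2 J"
  using ell2_add[of x J "\<lambda>e. (-1) * y e"] ell2_scale[of y J "-1"] by simp

text \<open>
  With \<open>t\<close> free this replaces the Cauchy-Schwarz inequality and avoids square roots: the first term
  is small for small \<open>t\<close>, the second one for small \<open>q\<close>.
\<close>

lemma weighted_product_le:
  assumes "t > (0::real)"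
  shows "p * q \<le> t * p\<^sup>2 + q\<^sup>2 / t"
proof -
  have "0 \<le> (t * p - q)\<^sup>2 + (t * p)\<^sup>2 + q\<^sup>2" by simp
  then have "t * (p * q) \<le> t * (t * p\<^sup>2 + q\<^sup>2 / t)"
    using assms by (simp add: power2_eq_square algebra_simps)
  then show ?thesis using assms by (simp only: mult_le_cancel_left_pos)
qed

lemma ell2_inner_summable:
  assumes x: "x \<in> ell2 J" and y: "y \<in> ell2 J"
  shows "(\<lambda>e. x e * kconj (y e)) summable_on J" "(\<lambda>e. x e \<bullet> y e) summable_on J"
proof -
  have s: "(\<lambda>e. (norm (x e))\<^sup>2 + (norm (y e))\<^sup>2) summable_on J"
    by (intro summable_on_add ell2D x y)
  have b: "norm (x e * kconj (y e)) \<le> (norm (x e))\<^sup>2 + (norm (y e))\<^sup>2" for e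
    using norm_mult_le_squares[of "x e" "kconj (y e)"] by simp
  then show "(\<lambda>e. x e * kconj (y e)) summable_on J"
    by (rule summable_on_norm_bound(1)[OF s])
  have "norm (x e \<bullet> y e) \<le> norm (x e * kconj (y e))" for e
    using Cauchy_Schwarz_ineq2[of "x e" "y e"] by (simp add: norm_mult)
  then show "(\<lambda>e. x e \<bullet> y e) summable_on J"
    by (rule summable_on_norm_bound(1)[OF s order_trans[OF _ b]])
qed

lemma ell2_inner_bound:
  assumes x: "x \<in> ell2 J" and y: "y \<in> ell2 J" and t: "t > 0"
  shows "norm (ell2_inner J x y) \<le> t * ell2_normsq J x + ell2_normsq J y / t"
    "\<bar>ell2_re_inner J x y\<bar> \<le> t * ell2_normsq J x + ell2_normsq J y / t"
proof -
  have s: "((\<lambda>e. t * (norm (x e))\<^sup>2 + (norm (y e))\<^sup>2 / t) has_sum (t * ell2_normsq J x + ell2_normsq J y / t)) J"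
    unfolding ell2_normsq_def divide_inverse
    by (intro has_sum_add has_sum_cmult_left has_sum_cmult_right has_sum_infsum ell2D x y)
  have b: "norm (x e * kconj (y e)) \<le> t * (norm (x e))\<^sup>2 + (norm (y e))\<^sup>2 / t" for e
    using weighted_product_le[OF t] by (simp add: norm_mult)
  show "norm (ell2_inner J x y) \<le> t * ell2_normsq J x + ell2_normsq J y / t"
    unfolding ell2_inner_def
    by (rule norm_has_sum_le[OF has_sum_infsum[OF ell2_inner_summable(1)[OF x y]] s b])
  have b': "norm (x e \<bullet> y e) \<le> t * (norm (x e))\<^sup>2 + (norm (y e))\<^sup>2 / t" for e
    using Cauchy_Schwarz_ineq2[of "x e" "y e"] b[of e] by (simp add: norm_mult)
  have "norm (ell2_re_inner J x y) \<le> t * ell2_normsq J x + ell2_normsq J y / t"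
    unfolding ell2_re_inner_def
    by (rule norm_has_sum_le[OF has_sum_infsum[OF ell2_inner_summable(2)[OF x y]] s b'])
  then show "\<bar>ell2_re_inner J x y\<bar> \<le> t * ell2_normsq J x + ell2_normsq J y / t" by simp
qed

lemma ell2_normsq_nonneg: "ell2_normsq J x \<ge> 0"
  unfolding ell2_normsq_def by (intro infsum_nonneg) auto

lemma ell2_inner_self: "x \<in> ell2 J \<Longrightarrow> ell2_inner J x x = ell2_normsq J x *\<^sub>R 1"
  unfolding ell2_inner_def ell2_normsq_def by (simp add: mult_kconj infsum_scaleR_left ell2D)

lemma ell2_re_inner_self: "ell2_re_inner J x x = ell2_normsq J x"
  unfolding ell2_re_inner_def ell2_normsq_def by (simp add: power2_norm_eq_inner)

lemma ell2_normsq_eq_0: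
  assumes x: "x \<in> ell2 J" and z: "ell2_normsq J x = 0"
  shows "x = (\<lambda>e. 0)"
proof
  fix e
  show "x e = 0"
  proof (cases "e \<in> J")
    case True
    have "(norm (x e))\<^sup>2 = 0"
      using z True ell2D(1)[OF x] unfolding ell2_normsq_def
      by (intro nonneg_infsum_le_0D[of "\<lambda>e. (norm (x e))\<^sup>2" J]) auto
    then show ?thesis by simp
  qed (rule ell2D(2)[OF x])
qed

lemma kconj_diff: "kconj (p - q) = kconj p - kconj (q::'k::rc_scalar)"
  using kconj_add[of p "-q"] by (simp add: kconj_minus)

lemma ell2_inner_linear:
  assumes "x \<in> ell2 J" "y \<in> ell2 J" "z \<in> ell2 J"
  shows "ell2_inner J z (\<lambda>e. x e + y e) = ell2_inner J z x + ell2_inner J z y"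
    "ell2_inner J z (\<lambda>e. x e - y e) = ell2_inner J z x - ell2_inner J z y"
    "ell2_inner J z (\<lambda>e. c * x e) = kconj c * ell2_inner J z x"
proof -
  have s: "((\<lambda>e. z e * kconj (x e)) has_sum ell2_inner J z x) J" "((\<lambda>e. z e * kconj (y e)) has_sum ell2_inner J z y) J"
    unfolding ell2_inner_def by (intro has_sum_infsum ell2_inner_summable(1) assms)+
  show "ell2_inner J z (\<lambda>e. x e + y e) = ell2_inner J z x + ell2_inner J z y"
    unfolding ell2_inner_def[of J z "\<lambda>e. x e + y e"]
    by (intro infsumI) (use has_sum_add[OF s] in \<open>simp add: kconj_add algebra_simps\<close>)
  show "ell2_inner J z (\<lambda>e. x e - y e) = ell2_inner J z x - ell2_inner J z y"
    unfolding ell2_inner_def[of J z "\<lambda>e. x e - y e"]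
    by (intro infsumI)
       (use has_sum_add[OF s(1) has_sum_cmult_right[OF s(2), of "-1"]] in \<open>simp add: kconj_diff algebra_simps\<close>)
  show "ell2_inner J z (\<lambda>e. c * x e) = kconj c * ell2_inner J z x"
    unfolding ell2_inner_def[of J z "\<lambda>e. c * x e"]
    by (intro infsumI) (use has_sum_cmult_right[OF s(1), of "kconj c"] in \<open>simp add: kconj_mult mult_ac\<close>)
qed

lemma ell2_re_inner_eq: "x \<in> ell2 J \<Longrightarrow> y \<in> ell2 J \<Longrightarrow> ell2_re_inner J x (\<lambda>e. \<alpha> * y e) = ell2_inner J x y \<bullet> \<alpha>"
  unfolding ell2_re_inner_def
proof (intro infsumI)
  assume "x \<in> ell2 J" "y \<in> ell2 J"
  then have "((\<lambda>e. x e * kconj (y e)) has_sum ell2_inner J x y) J"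
    unfolding ell2_inner_def by (intro has_sum_infsum ell2_inner_summable)
  from has_sum_bounded_linear[OF bounded_linear_inner_left[of \<alpha>] this]
  show "((\<lambda>e. x e \<bullet> (\<alpha> * y e)) has_sum ell2_inner J x y \<bullet> \<alpha>) J"
    by (simp add: inner_mult_right_kconj o_def)
qed

lemma ell2_re_inner_linear:
  assumes "x \<in> ell2 J" "y \<in> ell2 J" "z \<in> ell2 J"
  shows "ell2_re_inner J (\<lambda>e. x e - y e) z = ell2_re_inner J x z - ell2_re_inner J y z"
proof -
  have s: "((\<lambda>e. x e \<bullet> z e) has_sum ell2_re_inner J x z) J" "((\<lambda>e. y e \<bullet> z e) has_sum ell2_re_inner J y z) J"
    unfolding ell2_re_inner_def by (intro has_sum_infsum ell2_inner_summable(2) assms)+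
  show ?thesis
    unfolding ell2_re_inner_def[of J "\<lambda>e. x e - y e"]
    by (intro infsumI)
       (use has_sum_add[OF s(1) has_sum_cmult_right[OF s(2), of "-1"]] in \<open>simp add: inner_diff_left\<close>)
qed

lemma ell2_normsq_diff:
  assumes "x \<in> ell2 J" "y \<in> ell2 J"
  shows "ell2_normsq J (\<lambda>e. x e - y e) = ell2_normsq J x - 2 * ell2_re_inner J x y + ell2_normsq J y"
proof -
  have s: "((\<lambda>e. x e \<bullet> x e) has_sum ell2_re_inner J x x) J" "((\<lambda>e. x e \<bullet> y e) has_sum ell2_re_inner J x y) J"
    "((\<lambda>e. y e \<bullet> y e) has_sum ell2_re_inner J y y) J"
    unfolding ell2_re_inner_def by (intro has_sum_infsum ell2_inner_summable(2) assms)+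
  have "ell2_re_inner J (\<lambda>e. x e - y e) (\<lambda>e. x e - y e) = ell2_re_inner J x x + (-2) * ell2_re_inner J x y + ell2_re_inner J y y"
    unfolding ell2_re_inner_def[of J "\<lambda>e. x e - y e"]
    by (intro infsumI)
       (use has_sum_add[OF has_sum_add[OF s(1) has_sum_cmult_right[OF s(2), of "-2"]] s(3)]
          in \<open>simp add: inner_diff_left inner_diff_right inner_commute algebra_simps\<close>)
  then show ?thesis by (simp add: ell2_re_inner_self)
qed

text \<open>
  Take limits in each coordinate. The Cauchy bound holds for finite partial sums, where it
  survives the limit in \<open>m\<close>, and bounds on these control the infinite sum.
\<close>

lemma ell2_complete:
  assumes X: "\<And>n. X n \<in> ell2 J" and \<epsilon>: "\<epsilon> \<longlonglongrightarrow> 0"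
    and C: "\<And>m n. ell2_normsq J (\<lambda>e. X m e - X n e) \<le> \<epsilon> m + \<epsilon> n"
  shows "\<exists>x\<in>ell2 J. \<forall>n. ell2_normsq J (\<lambda>e. x e - X n e) \<le> \<epsilon> n"
proof -
  have fin: "(\<Sum>e\<in>F. (norm (X m e - X n e))\<^sup>2) \<le> \<epsilon> m + \<epsilon> n" if "finite F" "F \<subseteq> J" for F m n
  proof -
    have "(\<Sum>e\<in>F. (norm (X m e - X n e))\<^sup>2) \<le> ell2_normsq J (\<lambda>e. X m e - X n e)"
      unfolding ell2_normsq_def using that ell2D(1)[OF ell2_diff[OF X X]]
      by (intro finite_sum_le_infsum) auto
    then show ?thesis using C order_trans by blast
  qed
  have "convergent (\<lambda>m. X m e)" for e
  proof (cases "e \<in> J")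
    case True
    have "Cauchy (\<lambda>m. X m e)"
    proof (rule metric_CauchyI)
      fix r :: real assume r: "r > 0"
      then have "\<forall>\<^sub>F n in sequentially. \<epsilon> n < r\<^sup>2 / 2" using \<epsilon> by (intro order_tendstoD) auto
      then obtain N where N: "\<And>n. n \<ge> N \<Longrightarrow> \<epsilon> n < r\<^sup>2 / 2" by (auto simp: eventually_sequentially)
      show "\<exists>M. \<forall>m\<ge>M. \<forall>n\<ge>M. dist (X m e) (X n e) < r"
      proof (intro exI allI impI)
        fix m n assume "m \<ge> N" "n \<ge> N"
        then have "(norm (X m e - X n e))\<^sup>2 < r\<^sup>2" using fin[of "{e}" m n] N[of m] N[of n] True by auto
        then show "dist (X m e) (X n e) < r" using r by (simp add: dist_norm power2_less_imp_less)
      qed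
    qed
    then show ?thesis by (rule Cauchy_convergent)
  next
    case False
    then have "(\<lambda>m. X m e) = (\<lambda>m. 0)" using ell2D(2)[OF X] by auto
    then show ?thesis by (simp add: convergent_const)
  qed
  then obtain x where x: "\<And>e. (\<lambda>m. X m e) \<longlonglongrightarrow> x e" unfolding convergent_def by metis
  have finx: "(\<Sum>e\<in>F. (norm (x e - X n e))\<^sup>2) \<le> \<epsilon> n" if "finite F" "F \<subseteq> J" for F n
  proof (rule LIMSEQ_le)
    show "(\<lambda>m. \<Sum>e\<in>F. (norm (X m e - X n e))\<^sup>2) \<longlonglongrightarrow> (\<Sum>e\<in>F. (norm (x e - X n e))\<^sup>2)"
      by (intro tendsto_intros x)
    show "(\<lambda>m. \<epsilon> m + \<epsilon> n) \<longlonglongrightarrow> \<epsilon> n" using tendsto_add[OF \<epsilon> tendsto_const[of "\<epsilon> n"]] by simp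
  qed (use fin[OF that] in blast)
  have sx: "(\<lambda>e. (norm (x e - X n e))\<^sup>2) summable_on J" for n
    by (rule nonneg_bdd_above_summable_on) (auto intro!: bdd_aboveI2[where M = "\<epsilon> n"] finx)
  have x0: "x e = 0" if "e \<notin> J" for e
    using x[of e] ell2D(2)[OF X that] by (simp add: LIMSEQ_const_iff)
  have d: "(\<lambda>e. x e - X n e) \<in> ell2 J" for n
    using sx x0 ell2D(2)[OF X] by (simp add: ell2_def)
  have "x \<in> ell2 J" using ell2_add[OF d[of 0] X[of 0]] by simp
  moreover have "ell2_normsq J (\<lambda>e. x e - X n e) \<le> \<epsilon> n" for n
    unfolding ell2_normsq_def by (rule infsum_le_finite_sums[OF sx finx])
  ultimately show ?thesis by blast
qed

section \<open>Self-orthogonal relations are unitary operators\<close>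

lemma ell2_inner_commute:
  assumes "x \<in> ell2 J" "y \<in> ell2 J"
  shows "ell2_inner J y x = kconj (ell2_inner J x y)"
proof -
  have "((\<lambda>e. x e * kconj (y e)) has_sum ell2_inner J x y) J"
    unfolding ell2_inner_def by (intro has_sum_infsum ell2_inner_summable assms)
  from has_sum_bounded_linear[OF bounded_linear_kconj this]
  have "((\<lambda>e. y e * kconj (x e)) has_sum kconj (ell2_inner J x y)) J"
    by (simp add: o_def kconj_mult kconj_kconj mult.commute)
  then show ?thesis unfolding ell2_inner_def[of J y x] by (rule infsumI)
qed

lemma ell2_inner_zero [simp]: "ell2_inner J x (\<lambda>e. 0) = 0"
  by (simp add: ell2_inner_def)

lemma ell2_normsq_scale:
  "x \<in> ell2 J \<Longrightarrow> ell2_normsq J (\<lambda>e. c * x e) = (norm c)\<^sup>2 * ell2_normsq J x"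
  unfolding ell2_normsq_def by (simp add: norm_mult power_mult_distrib infsum_cmult_right ell2D)

lemma ell2_normsq_add:
  assumes "x \<in> ell2 J" "y \<in> ell2 J"
  shows "ell2_normsq J (\<lambda>e. x e + y e) = ell2_normsq J x + 2 * ell2_re_inner J x y + ell2_normsq J y"
proof -
  have "ell2_re_inner J x (\<lambda>e. (-1) * y e) = - ell2_re_inner J x y"
    using ell2_re_inner_eq[OF assms, of "-1"] ell2_re_inner_eq[OF assms, of 1] by simp
  then show ?thesis
    using ell2_normsq_diff[OF assms(1) ell2_scale[OF assms(2), of "-1"]] ell2_normsq_scale[OF assms(2), of "-1"]
    by simp
qed

text \<open>
  \<open>R\<close> is its own orthogonal complement for the indefinite form
  \<open>\<langle>y', y\<rangle> - \<langle>x', x\<rangle>\<close> on \<open>\<ell>\<^sub>2(J) \<times> \<ell>\<^sub>2(K)\<close>.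
\<close>

definition self_orthogonal :: "'e set \<Rightarrow> 'e set \<Rightarrow> (('e \<Rightarrow> 'k::rc_scalar) \<times> ('e \<Rightarrow> 'k)) set \<Rightarrow> bool" where
  "self_orthogonal J K R \<longleftrightarrow> (\<forall>y x. (y, x) \<in> R \<longleftrightarrow> y \<in> ell2 J \<and> x \<in> ell2 K \<and>
     (\<forall>y' x'. (y', x') \<in> R \<longrightarrow> ell2_inner J y' y = ell2_inner K x' x))"

lemma self_orthogonalD:
  assumes "self_orthogonal J K R" "(y, x) \<in> R"
  shows "y \<in> ell2 J" "x \<in> ell2 K" "(y', x') \<in> R \<Longrightarrow> ell2_inner J y' y = ell2_inner K x' x"
  using assms unfolding self_orthogonal_def by blast+

lemma self_orthogonalI:
  assumes "self_orthogonal J K R" "y \<in> ell2 J" "x \<in> ell2 K"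
    "\<And>y' x'. (y', x') \<in> R \<Longrightarrow> ell2_inner J y' y = ell2_inner K x' x"
  shows "(y, x) \<in> R"
  using assms unfolding self_orthogonal_def by blast

text \<open>
  An orthogonal complement is a linear subspace.
\<close>

lemma self_orthogonal_linear:
  assumes R: "self_orthogonal J K R" and yx: "(y, x) \<in> R" and yx': "(y', x') \<in> R"
  shows "((\<lambda>e. y e + y' e), (\<lambda>e. x e + x' e)) \<in> R" "((\<lambda>e. y e - y' e), (\<lambda>e. x e - x' e)) \<in> R"
    "((\<lambda>e. c * y e), (\<lambda>e. c * x e)) \<in> R"
proof -
  note D = self_orthogonalD[OF R]
  note E = D(1,2)[OF yx] D(1,2)[OF yx']
  show "((\<lambda>e. y e + y' e), (\<lambda>e. x e + x' e)) \<in> R"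
    using E D(1,2) by (intro self_orthogonalI[OF R] ell2_add) (simp_all add: ell2_inner_linear D(3)[OF yx] D(3)[OF yx'])
  show "((\<lambda>e. y e - y' e), (\<lambda>e. x e - x' e)) \<in> R"
    using E D(1,2) by (intro self_orthogonalI[OF R] ell2_diff) (simp_all add: ell2_inner_linear D(3)[OF yx] D(3)[OF yx'])
  show "((\<lambda>e. c * y e), (\<lambda>e. c * x e)) \<in> R"
  proof (rule self_orthogonalI[OF R])
    fix v w assume vw: "(v, w) \<in> R"
    show "ell2_inner J v (\<lambda>e. c * y e) = ell2_inner K w (\<lambda>e. c * x e)"
      using ell2_inner_linear(3)[OF E(1) E(1) D(1)[OF vw], of c] ell2_inner_linear(3)[OF E(2) E(2) D(2)[OF vw], of c]
        D(3)[OF yx vw] by simp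
  qed (intro ell2_scale E)+
qed

lemma self_orthogonal_normsq:
  assumes R: "self_orthogonal J K R" and yx: "(y, x) \<in> R"
  shows "ell2_normsq J y = ell2_normsq K x"
  using self_orthogonalD(3)[OF R yx yx] self_orthogonalD(1,2)[OF R yx] by (simp add: ell2_inner_self)

text \<open>
  Let \<open>n\<close> tend to infinity first and \<open>t\<close> to 0 afterwards; thus \<open>B t\<close> may blow up as \<open>t\<close> tends to 0.
\<close>

lemma nonpos_if_weighted_bound:
  assumes "\<epsilon> \<longlonglongrightarrow> (0::real)" and b: "\<And>t n. t > 0 \<Longrightarrow> \<delta> \<le> t * A + \<epsilon> n * B t"
  shows "\<delta> \<le> 0"
proof (rule ccontr)
  assume "\<not> \<delta> \<le> 0"
  have lim: "\<delta> \<le> t * A" if t: "t > 0" for t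
  proof (rule LIMSEQ_le_const)
    show "(\<lambda>n. t * A + \<epsilon> n * B t) \<longlonglongrightarrow> t * A" by (auto intro!: tendsto_eq_intros assms(1))
  qed (use b[OF t] in blast)
  then have "A > 0" using \<open>\<not> \<delta> \<le> 0\<close> lim[of 1] by simp
  then show False using lim[of "\<delta> / (2 * A)"] \<open>\<not> \<delta> \<le> 0\<close> by simp
qed

text \<open>
  The orthogonal projection of \<open>z\<close> to the domain of \<open>R\<close> exists, because \<open>R\<close> is closed and isometric: a
  minimizing sequence in the domain is Cauchy, so are its images, and the limits form a pair of \<open>R\<close>.
  The remainder \<open>r\<close> is orthogonal to the domain, hence \<open>(r, 0)\<close> is orthogonal to \<open>R\<close> and so lies in \<open>R\<close>,
  and isometry yields \<open>r = 0\<close>.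
\<close>

lemma self_orthogonal_domain:
  fixes R :: "(('e \<Rightarrow> 'k::rc_scalar) \<times> ('e \<Rightarrow> 'k)) set"
  assumes R: "self_orthogonal J K R" and z: "z \<in> ell2 J"
  shows "\<exists>x. (z, x) \<in> R"
proof -
  note D = self_orthogonalD[OF R] and lin = self_orthogonal_linear[OF R]
  have R0: "((\<lambda>e. 0), (\<lambda>e. 0)) \<in> R" by (intro self_orthogonalI[OF R] ell2_zero) simp
  define S where "S = {ell2_normsq J (\<lambda>e. z e - y e) | y x. (y, x) \<in> R}"
  define d where "d = Inf S"
  have S: "S \<noteq> {}" "bdd_below S"
    using R0 by (auto simp: S_def ell2_normsq_nonneg intro!: bdd_belowI[of _ 0])
  have dle: "d \<le> ell2_normsq J (\<lambda>e. z e - y e)" if "(y, x) \<in> R" for y x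
    unfolding d_def by (rule cInf_lower[OF _ S(2)]) (use that in \<open>auto simp: S_def\<close>)
  have "\<exists>y x. (y, x) \<in> R \<and> ell2_normsq J (\<lambda>e. z e - y e) < d + 1 / Suc n" for n
  proof -
    have "\<exists>s\<in>S. s < d + 1 / Suc n"
      using cInf_lessD[OF S(1), of "d + 1 / Suc n"] by (simp add: d_def)
    then show ?thesis by (auto simp: S_def)
  qed
  then obtain Y X where YX: "\<And>n. (Y n, X n) \<in> R" and Yd: "\<And>n. ell2_normsq J (\<lambda>e. z e - Y n e) < d + 1 / Suc n"
    by metis
  note YE = D(1)[OF YX] and XE = D(2)[OF YX]
  define \<epsilon> where "\<epsilon> n = 2 / real (Suc n)" for n
  have "(\<lambda>n. 2 * (1 / real (Suc n))) \<longlonglongrightarrow> 2 * 0"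
    by (intro tendsto_intros LIMSEQ_Suc[OF lim_1_over_n])
  then have \<epsilon>: "\<epsilon> \<longlonglongrightarrow> 0" by (simp add: \<epsilon>_def[abs_def])
  have CY: "ell2_normsq J (\<lambda>e. Y m e - Y n e) \<le> \<epsilon> m + \<epsilon> n" for m n
  proof -
    let ?u = "\<lambda>n e. z e - Y n e"
    have u: "?u n \<in> ell2 J" for n by (intro ell2_diff z YE)
    \<comment> \<open>parallelogram identity: the midpoint of \<open>Y m\<close> and \<open>Y n\<close> is no closer to \<open>z\<close> than the infimum \<open>d\<close>\<close>
    have "((\<lambda>e. (1 / 2) * (Y m e + Y n e)), (\<lambda>e. (1 / 2) * (X m e + X n e))) \<in> R"
      by (rule lin(3)[OF lin(1)[OF YX YX] R0])
    then have "d \<le> ell2_normsq J (\<lambda>e. z e - (1 / 2) * (Y m e + Y n e))" by (rule dle)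
    then have "4 * d \<le> (norm (2::'k))\<^sup>2 * ell2_normsq J (\<lambda>e. z e - (1 / 2) * (Y m e + Y n e))"
      by simp
    also have "\<dots> = ell2_normsq J (\<lambda>e. 2 * (z e - (1 / 2) * (Y m e + Y n e)))"
      by (intro ell2_normsq_scale[symmetric] ell2_diff z ell2_scale ell2_add YE)
    also have "\<dots> = ell2_normsq J (\<lambda>e. ?u n e + ?u m e)"
      by (intro arg_cong[of _ _ "ell2_normsq J"] ext) (simp add: algebra_simps)
    finally have "4 * d \<le> ell2_normsq J (\<lambda>e. ?u n e + ?u m e)" .
    moreover have "ell2_normsq J (\<lambda>e. Y m e - Y n e) = ell2_normsq J (\<lambda>e. ?u n e - ?u m e)"
      by (intro arg_cong[of _ _ "ell2_normsq J"] ext) (simp add: algebra_simps)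
    ultimately show ?thesis
      using ell2_normsq_diff[OF u u, of n m] ell2_normsq_add[OF u u, of n m] Yd[of m] Yd[of n]
      unfolding \<epsilon>_def by linarith
  qed
  have CX: "ell2_normsq K (\<lambda>e. X m e - X n e) \<le> \<epsilon> m + \<epsilon> n" for m n
    using CY[of m n] self_orthogonal_normsq[OF R lin(2)[OF YX YX], of m n] by simp
  obtain y where y: "y \<in> ell2 J" "\<And>n. ell2_normsq J (\<lambda>e. y e - Y n e) \<le> \<epsilon> n"
    using ell2_complete[of Y, OF YE \<epsilon> CY] by blast
  obtain x where x: "x \<in> ell2 K" "\<And>n. ell2_normsq K (\<lambda>e. x e - X n e) \<le> \<epsilon> n"
    using ell2_complete[of X, OF XE \<epsilon> CX] by blast
  \<comment> \<open>\<open>R\<close> is closed, as an orthogonal complement\<close>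
  have yx: "(y, x) \<in> R"
  proof (rule self_orthogonalI[OF R y(1) x(1)])
    fix y' x' assume yx': "(y', x') \<in> R"
    note E' = D(1,2)[OF yx']
    have "norm (ell2_inner J y' y - ell2_inner K x' x) \<le> 0"
    proof (rule nonpos_if_weighted_bound[OF \<epsilon>, where B = "\<lambda>t. 2 / t"])
      fix t :: real and n assume t: "t > 0"
      have "ell2_inner J y' y - ell2_inner K x' x
          = ell2_inner J y' (\<lambda>e. y e - Y n e) - ell2_inner K x' (\<lambda>e. x e - X n e)"
        using ell2_inner_linear(2)[OF y(1) YE E'(1), of n] ell2_inner_linear(2)[OF x(1) XE E'(2), of n] D(3)[OF YX yx', of n]
        by simp
      also have "norm \<dots> \<le> norm (ell2_inner J y' (\<lambda>e. y e - Y n e)) + norm (ell2_inner K x' (\<lambda>e. x e - X n e))"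
        by (rule norm_triangle_ineq4)
      also have "\<dots> \<le> (t * ell2_normsq J y' + \<epsilon> n / t) + (t * ell2_normsq K x' + \<epsilon> n / t)"
        using t y x
        by (intro add_mono order_trans[OF ell2_inner_bound(1)[OF E'(1) ell2_diff[OF y(1) YE[of n]] t]]
            order_trans[OF ell2_inner_bound(1)[OF E'(2) ell2_diff[OF x(1) XE[of n]] t]] add_left_mono divide_right_mono) auto
      also have "\<dots> = t * (ell2_normsq J y' + ell2_normsq K x') + \<epsilon> n * (2 / t)"
        by (simp add: algebra_simps)
      finally show "norm (ell2_inner J y' y - ell2_inner K x' x) \<le> t * (ell2_normsq J y' + ell2_normsq K x') + \<epsilon> n * (2 / t)" .
    qed
    then show "ell2_inner J y' y = ell2_inner K x' x" by simp
  qed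
  define r where "r e = z e - y e" for e
  have r: "r \<in> ell2 J" unfolding r_def[abs_def] by (intro ell2_diff z y)
  \<comment> \<open>first variation: moving from \<open>y\<close> by \<open>m\<close> cannot decrease the distance to \<open>z\<close>\<close>
  have var: "2 * ell2_re_inner J r m \<le> ell2_normsq J m" if m: "(m, m') \<in> R" for m m'
  proof -
    have mE: "m \<in> ell2 J" by (rule D(1)[OF m])
    have "2 * ell2_re_inner J r m - ell2_normsq J m \<le> 0"
    proof (rule nonpos_if_weighted_bound[OF \<epsilon>, where B = "\<lambda>t. (2 + t) / t"])
      fix t :: real and n assume t: "t > 0"
      have u: "(\<lambda>e. z e - Y n e) \<in> ell2 J" by (intro ell2_diff z YE)
      have "d \<le> ell2_normsq J (\<lambda>e. z e - (Y n e + m e))" by (rule dle[OF lin(1)[OF YX m]])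
      also have "\<dots> = ell2_normsq J (\<lambda>e. (z e - Y n e) - m e)" by (simp add: algebra_simps)
      finally have "d \<le> ell2_normsq J (\<lambda>e. (z e - Y n e) - m e)" .
      have 1: "2 * ell2_re_inner J (\<lambda>e. z e - Y n e) m \<le> \<epsilon> n + ell2_normsq J m"
      proof -
        have "1 / real (Suc n) \<le> \<epsilon> n" unfolding \<epsilon>_def by (intro divide_right_mono) auto
        then show ?thesis
          using ell2_normsq_diff[OF u mE] Yd[of n] \<open>d \<le> ell2_normsq J (\<lambda>e. (z e - Y n e) - m e)\<close> by linarith
      qed
      have yn: "(\<lambda>e. y e - Y n e) \<in> ell2 J" by (intro ell2_diff y YE)
      have "r = (\<lambda>e. (z e - Y n e) - (y e - Y n e))" by (auto simp: r_def)
      then have 2: "ell2_re_inner J r m = ell2_re_inner J (\<lambda>e. z e - Y n e) m - ell2_re_inner J (\<lambda>e. y e - Y n e) m"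
        using ell2_re_inner_linear[OF u yn mE] by simp
      show "2 * ell2_re_inner J r m - ell2_normsq J m \<le> t * (2 * ell2_normsq J m) + \<epsilon> n * ((2 + t) / t)"
      proof -
        have "\<bar>ell2_re_inner J (\<lambda>e. y e - Y n e) m\<bar> \<le> 1 / t * ell2_normsq J (\<lambda>e. y e - Y n e) + ell2_normsq J m / (1 / t)"
          by (rule ell2_inner_bound(2)[OF yn mE]) (use t in simp)
        also have "\<dots> \<le> 1 / t * \<epsilon> n + t * ell2_normsq J m"
          using t y(2)[of n] by (intro add_mono mult_left_mono) auto
        finally have "- ell2_re_inner J (\<lambda>e. y e - Y n e) m \<le> 1 / t * \<epsilon> n + t * ell2_normsq J m"
          by (rule order_trans[OF abs_ge_minus_self])
        then have "2 * (- ell2_re_inner J (\<lambda>e. y e - Y n e) m) \<le> 2 * (1 / t * \<epsilon> n + t * ell2_normsq J m)"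
          by (rule mult_left_mono) simp
        moreover have "2 * ell2_re_inner J r m - ell2_normsq J m \<le> \<epsilon> n + 2 * (- ell2_re_inner J (\<lambda>e. y e - Y n e) m)"
          using 1 2 by simp
        ultimately have "2 * ell2_re_inner J r m - ell2_normsq J m \<le> \<epsilon> n + 2 * (1 / t * \<epsilon> n + t * ell2_normsq J m)"
          by (meson add_left_mono order_trans)
        also have "\<dots> = t * (2 * ell2_normsq J m) + \<epsilon> n * ((2 + t) / t)"
          using t by (simp add: field_simps)
        finally show ?thesis .
      qed
    qed
    then show ?thesis by simp
  qed
  have orth: "ell2_inner J m r = ell2_inner K m' (\<lambda>e. 0)" if m: "(m, m') \<in> R" for m m'
  proof -
    have mE: "m \<in> ell2 J" by (rule D(1)[OF m])
    define p where "p = ell2_inner J r m"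
    \<comment> \<open>the first variation in the direction \<open>s p m\<close>, divided by \<open>s\<close>\<close>
    have "(norm p)\<^sup>2 \<le> s * ((norm p)\<^sup>2 * ell2_normsq J m)" if s: "s > 0" for s :: real
    proof -
      have "2 * ell2_re_inner J r (\<lambda>e. (s *\<^sub>R p) * m e) \<le> ell2_normsq J (\<lambda>e. (s *\<^sub>R p) * m e)"
        by (rule var[OF lin(3)[OF m m]])
      then have "2 * (s * (norm p)\<^sup>2) \<le> (norm (s *\<^sub>R p))\<^sup>2 * ell2_normsq J m"
        by (simp add: ell2_re_inner_eq[OF r mE] ell2_normsq_scale[OF mE] p_def[symmetric] power2_norm_eq_inner
            del: mult_scaleR_left norm_scaleR)
      also have "\<dots> = s * (s * ((norm p)\<^sup>2 * ell2_normsq J m))"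
        using s by (simp add: power_mult_distrib power2_eq_square)
      finally have "s * (2 * (norm p)\<^sup>2) \<le> s * (s * ((norm p)\<^sup>2 * ell2_normsq J m))" by (simp add: mult_ac)
      then have "2 * (norm p)\<^sup>2 \<le> s * ((norm p)\<^sup>2 * ell2_normsq J m)"
        using s by (simp only: mult_le_cancel_left_pos)
      then show ?thesis by (smt (verit) zero_le_power2)
    qed
    then have "(norm p)\<^sup>2 \<le> 0"
      by (intro nonpos_if_weighted_bound[of "\<lambda>_. 0" _ "(norm p)\<^sup>2 * ell2_normsq J m" "\<lambda>_. 0"]) auto
    then have "p = 0" by simp
    then show ?thesis using ell2_inner_commute[OF r mE] by (simp add: p_def)
  qed
  have "(r, (\<lambda>e. 0)) \<in> R" by (rule self_orthogonalI[OF R r ell2_zero orth])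
  then have "ell2_normsq J r = 0" using self_orthogonal_normsq[OF R] by (force simp: ell2_normsq_def)
  then have "r = (\<lambda>e. 0)" by (rule ell2_normsq_eq_0[OF r])
  then have "z = y" by (auto simp: r_def fun_eq_iff)
  then show ?thesis using yx by blast
qed

lemma self_orthogonal_converse:
  assumes R: "self_orthogonal J K R"
  shows "self_orthogonal K J (R\<inverse>)"
  unfolding self_orthogonal_def converse_iff
proof (intro allI iffI)
  fix y x assume yx: "(x, y) \<in> R"
  show "y \<in> ell2 K \<and> x \<in> ell2 J \<and> (\<forall>y' x'. (x', y') \<in> R \<longrightarrow> ell2_inner K y' y = ell2_inner J x' x)"
    using self_orthogonalD[OF R yx] by simp
next
  fix y x
  assume "y \<in> ell2 K \<and> x \<in> ell2 J \<and> (\<forall>y' x'. (x', y') \<in> R \<longrightarrow> ell2_inner K y' y = ell2_inner J x' x)"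
  then show "(x, y) \<in> R" by (intro self_orthogonalI[OF R]) simp_all
qed

text \<open>
  The domain is everything, and so is the range because the converse relation is self-orthogonal
  as well; linearity and isometry make \<open>R\<close> single-valued in both directions.
\<close>

lemma self_orthogonal_unitary:
  fixes R :: "(('e \<Rightarrow> 'k::rc_scalar) \<times> ('e \<Rightarrow> 'k)) set"
  assumes R: "self_orthogonal J K R"
  shows "\<exists>L. ell2_unitary J K L \<and> (\<forall>y x. (y, x) \<in> R \<longleftrightarrow> y \<in> ell2 J \<and> L y = x)"
proof -
  note D = self_orthogonalD[OF R] and lin = self_orthogonal_linear[OF R]
  have uniq: "x = x'" if "(y, x) \<in> R" "(y, x') \<in> R" for y x x'
  proof -
    have "((\<lambda>e. y e - y e), (\<lambda>e. x e - x' e)) \<in> R" by (rule lin(2)[OF that])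
    then have "ell2_normsq K (\<lambda>e. x e - x' e) = 0"
      using self_orthogonal_normsq[OF R] by (force simp: ell2_normsq_def)
    then have "(\<lambda>e. x e - x' e) = (\<lambda>e. 0)"
      by (rule ell2_normsq_eq_0[OF ell2_diff[OF D(2)[OF that(1)] D(2)[OF that(2)]]])
    then show ?thesis by (auto simp: fun_eq_iff)
  qed
  have uniq': "y = y'" if "(y, x) \<in> R" "(y', x) \<in> R" for y y' x
  proof -
    have "((\<lambda>e. y e - y' e), (\<lambda>e. x e - x e)) \<in> R" by (rule lin(2)[OF that])
    then have "ell2_normsq J (\<lambda>e. y e - y' e) = 0"
      using self_orthogonal_normsq[OF R] by (force simp: ell2_normsq_def)
    then have "(\<lambda>e. y e - y' e) = (\<lambda>e. 0)"
      by (rule ell2_normsq_eq_0[OF ell2_diff[OF D(1)[OF that(1)] D(1)[OF that(2)]]])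
    then show ?thesis by (auto simp: fun_eq_iff)
  qed
  define L where "L y = (THE x. (y, x) \<in> R)" for y
  have L: "(y, L y) \<in> R" if y: "y \<in> ell2 J" for y
    unfolding L_def using self_orthogonal_domain[OF R y] uniq by (metis theI)
  have Leq: "L y = x" if "(y, x) \<in> R" for y x
    using uniq[OF L[OF D(1)[OF that]] that] .
  have graph: "(y, x) \<in> R \<longleftrightarrow> y \<in> ell2 J \<and> L y = x" for y x
    using L Leq D(1) by blast
  have "bij_betw L (ell2 J) (ell2 K)"
    unfolding bij_betw_def
  proof
    show "inj_on L (ell2 J)" by (rule inj_onI) (metis L uniq')
    show "L ` ell2 J = ell2 K"
    proof
      show "L ` ell2 J \<subseteq> ell2 K" using L D(2) by blast
      show "ell2 K \<subseteq> L ` ell2 J"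
      proof
        fix x :: "'e \<Rightarrow> 'k" assume "x \<in> ell2 K"
        then obtain y where "(x, y) \<in> R\<inverse>"
          using self_orthogonal_domain[OF self_orthogonal_converse[OF R]] by blast
        then have "(y, x) \<in> R" by simp
        then show "x \<in> L ` ell2 J" by (intro image_eqI[of _ _ y]) (simp_all add: graph)
      qed
    qed
  qed
  moreover have "L (\<lambda>e. x e + y e) = (\<lambda>e. L x e + L y e)" if "x \<in> ell2 J" "y \<in> ell2 J" for x y
    by (rule Leq[OF lin(1)[OF L[OF that(1)] L[OF that(2)]]])
  moreover have "L (\<lambda>e. c * x e) = (\<lambda>e. c * L x e)" if "x \<in> ell2 J" for x c
    by (rule Leq[OF lin(3)[OF L[OF that] L[OF that]]])
  moreover have "ell2_inner K (L x) (L y) = ell2_inner J x y" if "x \<in> ell2 J" "y \<in> ell2 J" for x y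
    using D(3)[OF L[OF that(2)] L[OF that(1)]] by simp
  ultimately have "ell2_unitary J K L" unfolding ell2_unitary_def by blast
  then show ?thesis using graph by blast
qed

section \<open>Traces on the graph\<close>

text \<open>
  The derivative in \<open>W12_norm\<close> is a choice; weak derivatives being unique, any of them gives the same
  norm.
\<close>

lemma W12_norm_eq:
  fixes f g :: "real \<Rightarrow> 'k::rc_scalar"
  assumes ab: "a < b" and fg: "has_weak_deriv (einterval a b) f g"
  shows "(W12_norm (einterval a b) f)\<^sup>2 = (L2_norm (einterval a b) f)\<^sup>2 + (L2_norm (einterval a b) g)\<^sup>2"
proof -
  let ?w = "weak_deriv (einterval a b) f"
  have w: "has_weak_deriv (einterval a b) f ?w"
    unfolding weak_deriv_def by (rule someI[of "has_weak_deriv (einterval a b) f", OF fg])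
  have "L2_norm (einterval a b) ?w = L2_norm (einterval a b) g"
    by (rule L2_norm_cong[OF L2D(1)[OF has_weak_deriv_L2(2)[OF w]] L2D(1)[OF has_weak_deriv_L2(2)[OF fg]]
        has_weak_deriv_unique[OF ab w fg]])
  then show ?thesis by (simp add: W12_norm_def)
qed

lemma max_deriv_iff:
  fixes f g :: "'e \<Rightarrow> real \<Rightarrow> 'k::rc_scalar"
  assumes ab: "\<And>e. e \<in> E \<Longrightarrow> a e < b e"
  shows "(f, g) \<in> max_deriv E a b \<longleftrightarrow> f \<in> graph_L2 E a b \<and> g \<in> graph_L2 E a b \<and>
     (\<forall>e\<in>E. has_weak_deriv (edge a b e) (f e) (g e))"
proof
  assume A: "(f, g) \<in> max_deriv E a b"
  then have wd: "\<forall>e\<in>E. has_weak_deriv (edge a b e) (f e) (g e)" and f: "f \<in> graph_W12 E a b" and g: "g \<in> graph_L2 E a b"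
    by (auto simp: max_deriv_def)
  have "(\<lambda>e. (L2_norm (edge a b e) (f e))\<^sup>2) summable_on E"
  proof (rule summable_on_norm_bound(1))
    show "(\<lambda>e. (W12_norm (edge a b e) (f e))\<^sup>2) summable_on E"
      using f by (simp add: graph_W12_def hilbert_sum_def)
    show "norm ((L2_norm (edge a b e) (f e))\<^sup>2) \<le> (W12_norm (edge a b e) (f e))\<^sup>2" if "e \<in> E" for e
      using W12_norm_eq[OF ab[OF that] bspec[OF wd that]] by simp
  qed
  then show "f \<in> graph_L2 E a b \<and> g \<in> graph_L2 E a b \<and> (\<forall>e\<in>E. has_weak_deriv (edge a b e) (f e) (g e))"
    using g wd has_weak_deriv_L2(1) by (auto simp: graph_L2_def hilbert_sum_def)
next
  assume A: "f \<in> graph_L2 E a b \<and> g \<in> graph_L2 E a b \<and> (\<forall>e\<in>E. has_weak_deriv (edge a b e) (f e) (g e))"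
  then have wd: "\<forall>e\<in>E. has_weak_deriv (edge a b e) (f e) (g e)" by blast
  have "(\<lambda>e. (L2_norm (edge a b e) (f e))\<^sup>2 + (L2_norm (edge a b e) (g e))\<^sup>2) summable_on E"
    using A by (intro summable_on_add) (auto simp: graph_L2_def hilbert_sum_def)
  then have "(\<lambda>e. (W12_norm (edge a b e) (f e))\<^sup>2) summable_on E"
    using W12_norm_eq[OF ab bspec[OF wd]] by (simp cong: summable_on_cong)
  then show "(f, g) \<in> max_deriv E a b"
    using A by (auto simp: max_deriv_def graph_W12_def hilbert_sum_def W12_def)
qed

lemma graph_L2D:
  assumes "f \<in> graph_L2 E a b"
  shows "e \<in> E \<Longrightarrow> f e \<in> L2 (edge a b e)" "(\<lambda>e. (L2_norm (edge a b e) (f e))\<^sup>2) summable_on E"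
  using assms by (auto simp: graph_L2_def hilbert_sum_def)

lemma graph_inner_summable:
  fixes f g :: "'e \<Rightarrow> real \<Rightarrow> 'k::rc_scalar"
  assumes f: "f \<in> graph_L2 E a b" and g: "g \<in> graph_L2 E a b"
  shows "(\<lambda>e. L2_inner (edge a b e) (f e) (g e)) summable_on E"
proof (rule summable_on_norm_bound(1))
  show "(\<lambda>e. (L2_norm (edge a b e) (f e))\<^sup>2 + (L2_norm (edge a b e) (g e))\<^sup>2) summable_on E"
    by (intro summable_on_add graph_L2D f g)
  show "norm (L2_inner (edge a b e) (f e) (g e)) \<le> (L2_norm (edge a b e) (f e))\<^sup>2 + (L2_norm (edge a b e) (g e))\<^sup>2"
    if "e \<in> E" for e
    by (intro L2_mult_kconj_integrable(2) graph_L2D(1)[OF f that] graph_L2D(1)[OF g that])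
qed

lemma graph_inner_uminus:
  fixes f g :: "'e \<Rightarrow> real \<Rightarrow> 'k::rc_scalar"
  shows "graph_inner E a b f (\<lambda>e t. - g e t) = - graph_inner E a b f g"
  by (simp add: graph_inner_def L2_inner_def kconj_minus infsum_uminus)

lemma graph_L2_uminus:
  fixes g :: "'e \<Rightarrow> real \<Rightarrow> 'k::rc_scalar"
  shows "(\<lambda>e t. - g e t) \<in> graph_L2 E a b \<longleftrightarrow> g \<in> graph_L2 E a b"
proof -
  have "(\<lambda>e t. - g e t) \<in> graph_L2 E a b" if "g \<in> graph_L2 E a b" for g :: "'e \<Rightarrow> real \<Rightarrow> 'k"
    using that L2_mult[of _ _ "-1"] by (fastforce simp: graph_L2_def hilbert_sum_def L2_norm_def)
  from this[of g] this[of "\<lambda>e t. - g e t"] show ?thesis by auto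
qed

lemma rel_uminus_iff: "(f, g) \<in> rel_uminus A \<longleftrightarrow> (f, \<lambda>e t. - g e t) \<in> (A :: (('e \<Rightarrow> real \<Rightarrow> 'k::rc_scalar) \<times> _) set)"
proof
  assume "(f, \<lambda>e t. - g e t) \<in> A"
  then show "(f, g) \<in> rel_uminus A"
    unfolding rel_uminus_def mem_Collect_eq
    by (intro exI[of _ f] exI[of _ "\<lambda>e t. - g e t"] conjI) simp_all
qed (auto simp: rel_uminus_def)

text \<open>
  With the sign moved into the condition, membership in \<open>-H\<^sup>*\<close> takes the form that Green's formula
  evaluates.
\<close>

lemma in_neg_adjoint_iff:
  fixes f g :: "'e \<Rightarrow> real \<Rightarrow> 'k::rc_scalar"
  shows "(f, g) \<in> rel_uminus (graph_adjoint E a b H) \<longleftrightarrow> f \<in> graph_L2 E a b \<and> g \<in> graph_L2 E a b \<and>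
     (\<forall>u v. (u, v) \<in> H \<longrightarrow> graph_inner E a b v f + graph_inner E a b u g = 0)"
  unfolding rel_uminus_iff graph_adjoint_def
  by (auto simp: graph_L2_uminus graph_inner_uminus eq_neg_iff_add_eq_0)

text \<open>
  A real lower bound \<open>l\<close> stands in for the infimum of the lengths, which is infinite if no edge is
  bounded.
\<close>

locale uniformly_long_edges =
  fixes E :: "'e set" and a b :: "'e \<Rightarrow> ereal" and l :: real
  assumes edge_nonempty: "e \<in> E \<Longrightarrow> a e < b e"
    and length_pos: "l > 0" and length_le: "e \<in> E \<Longrightarrow> ereal l \<le> b e - a e"
begin

lemma max_deriv_iff_edgewise:
  fixes f g :: "'e \<Rightarrow> real \<Rightarrow> 'k::rc_scalar"
  shows "(f, g) \<in> max_deriv E a b \<longleftrightarrow> f \<in> graph_L2 E a b \<and> g \<in> graph_L2 E a b \<and>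
     (\<forall>e\<in>E. has_weak_deriv (edge a b e) (f e) (g e))"
  by (rule max_deriv_iff) (rule edge_nonempty)

lemma max_derivD:
  fixes f g :: "'e \<Rightarrow> real \<Rightarrow> 'k::rc_scalar"
  assumes "(f, g) \<in> max_deriv E a b"
  shows "f \<in> graph_L2 E a b" "g \<in> graph_L2 E a b" "e \<in> E \<Longrightarrow> has_weak_deriv (edge a b e) (f e) (g e)"
  using assms unfolding max_deriv_iff_edgewise by simp_all

lemma max_derivI:
  fixes f g :: "'e \<Rightarrow> real \<Rightarrow> 'k::rc_scalar"
  assumes "f \<in> graph_L2 E a b" "g \<in> graph_L2 E a b" "\<And>e. e \<in> E \<Longrightarrow> has_weak_deriv (edge a b e) (f e) (g e)"
  shows "(f, g) \<in> max_deriv E a b"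
  using assms unfolding max_deriv_iff_edgewise by simp

text \<open>
  The trace bound has the same constant on all edges, so the squared norms of the function and its
  derivative dominate the squared traces.
\<close>

lemma traces_ell2:
  fixes f g :: "'e \<Rightarrow> real \<Rightarrow> 'k::rc_scalar"
  assumes fg: "(f, g) \<in> max_deriv E a b"
  shows "tr_l E a b f \<in> ell2 (E_l E a)" "tr_r E a b f \<in> ell2 (E_r E b)"
proof -
  let ?s = "\<lambda>e. (1 / l + 1) * ((L2_norm (edge a b e) (f e))\<^sup>2 + (L2_norm (edge a b e) (g e))\<^sup>2)"
  have s: "?s summable_on E"
    by (intro summable_on_cmult_right summable_on_add graph_L2D(2) max_derivD[OF fg])
  have "(\<lambda>e. (norm (tr_l E a b f e))\<^sup>2) summable_on E_l E a"
  proof (rule summable_on_norm_bound(1))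
    show "?s summable_on E_l E a" by (rule summable_on_subset_banach[OF s]) (auto simp: E_l_def)
    show "norm ((norm (tr_l E a b f e))\<^sup>2) \<le> ?s e" if "e \<in> E_l E a" for e
    proof -
      have e: "e \<in> E" "\<bar>a e\<bar> \<noteq> \<infinity>" using that edge_nonempty[of e] by (auto simp: E_l_def)
      show ?thesis
        using trace_bound_edge[OF edge_nonempty[OF e(1)] max_derivD(3)[OF fg e(1)] length_pos length_le[OF e(1)], of "a e"] e that
        by (simp add: tr_l_def)
    qed
  qed
  then show "tr_l E a b f \<in> ell2 (E_l E a)" by (simp add: ell2_def tr_l_def)
  have "(\<lambda>e. (norm (tr_r E a b f e))\<^sup>2) summable_on E_r E b"
  proof (rule summable_on_norm_bound(1))
    show "?s summable_on E_r E b" by (rule summable_on_subset_banach[OF s]) (auto simp: E_r_def)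
    show "norm ((norm (tr_r E a b f e))\<^sup>2) \<le> ?s e" if "e \<in> E_r E b" for e
    proof -
      have e: "e \<in> E" "\<bar>b e\<bar> \<noteq> \<infinity>" using that edge_nonempty[of e] by (auto simp: E_r_def)
      show ?thesis
        using trace_bound_edge[OF edge_nonempty[OF e(1)] max_derivD(3)[OF fg e(1)] length_pos length_le[OF e(1)], of "b e"] e that
        by (simp add: tr_r_def)
    qed
  qed
  then show "tr_r E a b f \<in> ell2 (E_r E b)" by (simp add: ell2_def tr_r_def)
qed

text \<open>
  Sum Green's formula over the edges. An infinite endpoint has boundary value zero and is missing
  from the index set of the corresponding trace, so both sides count the same terms.
\<close>

lemma Green_graph:
  fixes f g u v :: "'e \<Rightarrow> real \<Rightarrow> 'k::rc_scalar"
  assumes fg: "(f, g) \<in> max_deriv E a b" and uv: "(u, v) \<in> max_deriv E a b"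
  shows "graph_inner E a b v f + graph_inner E a b u g =
    ell2_inner (E_r E b) (tr_r E a b u) (tr_r E a b f) - ell2_inner (E_l E a) (tr_l E a b u) (tr_l E a b f)"
proof -
  let ?r = "\<lambda>e. tr_r E a b u e * kconj (tr_r E a b f e)" and ?l = "\<lambda>e. tr_l E a b u e * kconj (tr_l E a b f e)"
  let ?A = "\<lambda>e. L2_inner (edge a b e) (v e) (f e)" and ?B = "\<lambda>e. L2_inner (edge a b e) (u e) (g e)"
  have ABs: "(?A has_sum graph_inner E a b v f) E" "(?B has_sum graph_inner E a b u g) E"
    unfolding graph_inner_def by (intro has_sum_infsum graph_inner_summable max_derivD[OF fg] max_derivD[OF uv])+
  have "(?r has_sum ell2_inner (E_r E b) (tr_r E a b u) (tr_r E a b f)) (E_r E b)"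
    unfolding ell2_inner_def by (intro has_sum_infsum ell2_inner_summable traces_ell2[OF fg] traces_ell2[OF uv])
  then have r: "(?r has_sum ell2_inner (E_r E b) (tr_r E a b u) (tr_r E a b f)) E"
    by (rule has_sum_cong_neutral[THEN iffD1, rotated 3]) (auto simp: E_r_def tr_r_def)
  have "(?l has_sum ell2_inner (E_l E a) (tr_l E a b u) (tr_l E a b f)) (E_l E a)"
    unfolding ell2_inner_def by (intro has_sum_infsum ell2_inner_summable traces_ell2[OF fg] traces_ell2[OF uv])
  then have l: "(?l has_sum ell2_inner (E_l E a) (tr_l E a b u) (tr_l E a b f)) E"
    by (rule has_sum_cong_neutral[THEN iffD1, rotated 3]) (auto simp: E_l_def tr_l_def)
  have eq: "(?A e + ?B e) + ?l e = ?r e" if e: "e \<in> E" for e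
  proof -
    let ?P = "\<lambda>x. cont_rep (edge a b e) (u e) x * kconj (cont_rep (edge a b e) (f e) x)"
    have "?A e + ?B e = boundary_value ?P (b e) - boundary_value ?P (a e)"
      by (rule Green_edge[OF edge_nonempty[OF e] max_derivD(3)[OF uv e] max_derivD(3)[OF fg e]])
    moreover have "boundary_value ?P (b e) = ?r e" "boundary_value ?P (a e) = ?l e"
      using e edge_nonempty[OF e] by (auto simp: boundary_value_def tr_r_def tr_l_def E_r_def E_l_def)
    ultimately show ?thesis by simp
  qed
  have "((\<lambda>e. (?A e + ?B e) + ?l e) has_sum (graph_inner E a b v f + graph_inner E a b u g
       + ell2_inner (E_l E a) (tr_l E a b u) (tr_l E a b f))) E"
    by (intro has_sum_add ABs l)
  then have "(?r has_sum (graph_inner E a b v f + graph_inner E a b u g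
       + ell2_inner (E_l E a) (tr_l E a b u) (tr_l E a b f))) E"
    by (rule has_sum_cong[THEN iffD1, rotated]) (rule eq)
  from has_sum_unique[OF this r] show ?thesis by (simp add: algebra_simps)
qed

lemma traces_surjective:
  fixes x y :: "'e \<Rightarrow> 'k::rc_scalar"
  assumes x: "x \<in> ell2 (E_l E a)" and y: "y \<in> ell2 (E_r E b)"
  shows "\<exists>f g. (f, g) \<in> max_deriv E a b \<and> tr_l E a b f = x \<and> tr_r E a b f = y"
proof -
  \<comment> \<open>what \<open>edge_extension\<close> provides on the edge \<open>e\<close>\<close>
  define Q where "Q e f g \<longleftrightarrow> has_weak_deriv (edge a b e) f g \<and>
     (a e \<noteq> -\<infinity> \<longrightarrow> cont_rep (edge a b e) f (real_of_ereal (a e)) = x e) \<and>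
     (b e \<noteq> \<infinity> \<longrightarrow> cont_rep (edge a b e) f (real_of_ereal (b e)) = y e) \<and>
     (L2_norm (edge a b e) f)\<^sup>2 \<le> 2 * l * ((norm (x e))\<^sup>2 + (norm (y e))\<^sup>2) \<and>
     (L2_norm (edge a b e) g)\<^sup>2 \<le> 2 / l * ((norm (x e))\<^sup>2 + (norm (y e))\<^sup>2)" for e f g
  have "\<exists>f g. Q e f g" if e: "e \<in> E" for e
    unfolding Q_def
    by (rule edge_extension[OF edge_nonempty[OF e] length_pos length_le[OF e]])
       (use ell2D(2)[OF x, of e] ell2D(2)[OF y, of e] in \<open>auto simp: E_l_def E_r_def\<close>)
  then have "\<forall>e\<in>E. \<exists>f g. Q e f g" by blast
  then obtain f g where Q: "\<And>e. e \<in> E \<Longrightarrow> Q e (f e) (g e)" by metis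
  have sx: "(\<lambda>e. (norm (x e))\<^sup>2) summable_on E"
    using ell2D(1)[OF x] by (rule summable_on_cong_neutral[THEN iffD1, rotated 3]) (auto simp: E_l_def ell2D(2)[OF x])
  have sy: "(\<lambda>e. (norm (y e))\<^sup>2) summable_on E"
    using ell2D(1)[OF y] by (rule summable_on_cong_neutral[THEN iffD1, rotated 3]) (auto simp: E_r_def ell2D(2)[OF y])
  have s: "(\<lambda>e. c * ((norm (x e))\<^sup>2 + (norm (y e))\<^sup>2)) summable_on E" for c
    by (intro summable_on_cmult_right summable_on_add sx sy)
  have "(\<lambda>e. (L2_norm (edge a b e) (f e))\<^sup>2) summable_on E" "(\<lambda>e. (L2_norm (edge a b e) (g e))\<^sup>2) summable_on E"
    by (rule summable_on_norm_bound(1)[OF s[of "2 * l"]], use Q in \<open>force simp: Q_def\<close>)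
       (rule summable_on_norm_bound(1)[OF s[of "2 / l"]], use Q in \<open>force simp: Q_def\<close>)
  moreover have "has_weak_deriv (edge a b e) (f e) (g e)" if "e \<in> E" for e
    using Q[OF that] by (simp add: Q_def)
  ultimately have "(f, g) \<in> max_deriv E a b"
    by (intro max_derivI) (auto simp: graph_L2_def hilbert_sum_def dest: has_weak_deriv_L2)
  moreover have "tr_l E a b f = x"
    using Q ell2D(2)[OF x] by (force simp: tr_l_def E_l_def Q_def fun_eq_iff)
  moreover have "tr_r E a b f = y"
    using Q ell2D(2)[OF y] by (force simp: tr_r_def E_r_def Q_def fun_eq_iff)
  ultimately show ?thesis by blast
qed

end

section \<open>Skew-self-adjoint restrictions of the maximal operator\<close>

lemma L2_zero: "(\<lambda>t. 0 :: 'k::rc_scalar) \<in> L2 S"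
  by (simp add: L2_def)

lemma has_weak_deriv_zero: "has_weak_deriv I (\<lambda>t. 0 :: 'k::rc_scalar) (\<lambda>t. 0)"
  by (simp add: has_weak_deriv_def L2_zero)

lemma test_function_has_weak_deriv:
  assumes ab: "a < b" and \<phi>: "\<phi> \<in> test_functions (einterval a b)"
  shows "has_weak_deriv (einterval a b) (\<lambda>t. \<phi> t *\<^sub>R (1::'k::rc_scalar)) (\<lambda>t. deriv \<phi> t *\<^sub>R 1)"
    "c = a \<or> c = b \<Longrightarrow> \<bar>c\<bar> \<noteq> \<infinity> \<Longrightarrow> cont_rep (einterval a b) (\<lambda>t. \<phi> t *\<^sub>R (1::'k)) (real_of_ereal c) = 0"
proof -
  let ?I = "einterval a b"
  obtain s t where st: "s \<in> ?I" "t \<in> ?I" "s \<le> t" "\<forall>x. x \<notin> {s..t} \<longrightarrow> \<phi> x = 0"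
    using test_function_support[OF \<phi> ab] by blast
  have L: "(\<lambda>x. \<psi> x *\<^sub>R (1::'k)) \<in> L2 ?I"
    if cont: "continuous_on UNIV \<psi>" and supp: "\<forall>x. x \<notin> {s..t} \<longrightarrow> \<psi> x = 0" for \<psi> :: "real \<Rightarrow> real"
  proof -
    have "bounded (\<psi> ` {s..t})"
      by (intro compact_imp_bounded compact_continuous_image continuous_on_subset[OF cont]) auto
    then obtain B where "\<forall>y\<in>\<psi> ` {s..t}. norm y \<le> B" by (auto simp: bounded_iff)
    then have B: "\<bar>\<psi> x\<bar> \<le> B" if "x \<in> {s..t}" for x using that by auto
    have "norm (\<psi> x *\<^sub>R (1::'k)) \<le> B * indicator {s..s + (t - s + 1)} x" for x
    proof (cases "x \<in> {s..t}")
      case True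
      then show ?thesis using B[OF True] by (simp add: indicator_def)
    next
      case False
      moreover have "0 \<le> B" using B[of s] st(3) abs_ge_zero[of "\<psi> s"] by simp
      ultimately show ?thesis using supp by simp
    qed
    then have le: "\<forall>x\<in>?I. norm (\<psi> x *\<^sub>R (1::'k)) \<le> B * indicator {s..s + (t - s + 1)} x" by blast
    have "(\<lambda>x. \<psi> x *\<^sub>R (1::'k)) \<in> borel_measurable borel"
      by (intro borel_measurable_continuous_onI continuous_intros cont)
    then show ?thesis by (rule L2_if_bounded_on_Icc(1)[OF _ _ le]) (use st in auto)
  qed
  have p: "primitive_on (closure ?I) (\<lambda>t. \<phi> t *\<^sub>R (1::'k)) (\<lambda>t. deriv \<phi> t *\<^sub>R 1)"
    using test_function_deriv[OF \<phi>]
    by (intro primitive_on_scaleR_left primitive_on_C1) (auto simp: has_real_derivative_iff_has_vector_derivative)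
  note wd = has_weak_derivI_self[OF ab L[OF test_function_deriv(2)[OF \<phi>] st(4)]
      L[OF test_function_deriv(3)[OF \<phi>] deriv_zero_off_support[OF st(4)]] p]
  show "has_weak_deriv ?I (\<lambda>t. \<phi> t *\<^sub>R (1::'k)) (\<lambda>t. deriv \<phi> t *\<^sub>R 1)" by (rule wd(1))
  assume c: "c = a \<or> c = b" "\<bar>c\<bar> \<noteq> \<infinity>"
  then obtain r where r: "c = ereal r" by (cases c) auto
  have "r \<notin> ?I" using c r by (auto simp: einterval_def)
  then have "\<phi> r = 0" using st(4) einterval_Icc_subset[OF st(1,2)] by blast
  then show "cont_rep ?I (\<lambda>t. \<phi> t *\<^sub>R (1::'k)) (real_of_ereal c) = 0"
    using wd(2)[OF finite_end_in_closure[OF ab c]] r by simp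
qed

lemma cont_rep_zero:
  assumes "a < b" "x \<in> closure (einterval a b)"
  shows "cont_rep (einterval a b) (\<lambda>t. 0 :: 'k::rc_scalar) x = 0"
  by (rule cont_rep_eq[where u = "\<lambda>t. 0" and g = "\<lambda>t. 0"]) (use assms in \<open>auto simp: primitive_on_def\<close>)

text \<open>
  Extension by zero of a function on one edge to the whole graph.
\<close>

definition single_edge :: "'e \<Rightarrow> (real \<Rightarrow> 'k::zero) \<Rightarrow> 'e \<Rightarrow> real \<Rightarrow> 'k" where
  "single_edge e0 f e = (if e = e0 then f else (\<lambda>t. 0))"

lemma single_edge_graph_L2:
  fixes f :: "real \<Rightarrow> 'k::rc_scalar"
  assumes "f \<in> L2 (edge a b e0)"
  shows "single_edge e0 f \<in> graph_L2 E a b"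
proof -
  have "(\<lambda>e. (L2_norm (edge a b e) (single_edge e0 f e))\<^sup>2) summable_on E \<inter> {e0}"
    by (rule summable_on_finite) auto
  then have "(\<lambda>e. (L2_norm (edge a b e) (single_edge e0 f e))\<^sup>2) summable_on E"
    by (rule summable_on_cong_neutral[THEN iffD1, rotated 3]) (auto simp: single_edge_def L2_norm_def)
  then show ?thesis using assms L2_zero by (auto simp: graph_L2_def hilbert_sum_def single_edge_def)
qed

lemma graph_inner_single_edge:
  fixes f :: "real \<Rightarrow> 'k::rc_scalar"
  assumes "e0 \<in> E"
  shows "graph_inner E a b (single_edge e0 f) g = L2_inner (edge a b e0) f (g e0)"
proof -
  have "graph_inner E a b (single_edge e0 f) g = (\<Sum>\<^sub>\<infinity>e\<in>{e0}. L2_inner (edge a b e) (single_edge e0 f e) (g e))"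
    unfolding graph_inner_def
    by (rule infsum_cong_neutral) (use assms in \<open>auto simp: single_edge_def L2_inner_def\<close>)
  then show ?thesis by (simp add: single_edge_def)
qed

lemma L2_inner_real_left:
  fixes g :: "real \<Rightarrow> 'k::rc_scalar"
  assumes "integrable (lebesgue_on S) (\<lambda>t. \<phi> t *\<^sub>R g t)"
  shows "L2_inner S (\<lambda>t. \<phi> t *\<^sub>R 1) g = kconj (LINT t|lebesgue_on S. \<phi> t *\<^sub>R g t)"
proof -
  have "kconj (LINT t|lebesgue_on S. \<phi> t *\<^sub>R g t) = (LINT t|lebesgue_on S. kconj (\<phi> t *\<^sub>R g t))"
    by (rule integral_bounded_linear[OF bounded_linear_kconj assms, symmetric])
  then show ?thesis by (simp add: L2_inner_def kconj_scaleR)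
qed

context uniformly_long_edges
begin

lemma single_edge_test_function:
  assumes e0: "e0 \<in> E" and \<phi>: "\<phi> \<in> test_functions (edge a b e0)"
  defines "u \<equiv> single_edge e0 (\<lambda>t. \<phi> t *\<^sub>R (1::'k::rc_scalar))"
    and "v \<equiv> single_edge e0 (\<lambda>t. deriv \<phi> t *\<^sub>R (1::'k))"
  shows "(u, v) \<in> max_deriv E a b" "tr_l E a b u = (\<lambda>e. 0)" "tr_r E a b u = (\<lambda>e. 0)"
proof -
  note T = test_function_has_weak_deriv[OF edge_nonempty[OF e0] \<phi>, where ?'k = 'k]
  show "(u, v) \<in> max_deriv E a b"
    unfolding u_def v_def
  proof (rule max_derivI)
    show "has_weak_deriv (edge a b e) (single_edge e0 (\<lambda>t. \<phi> t *\<^sub>R (1::'k)) e) (single_edge e0 (\<lambda>t. deriv \<phi> t *\<^sub>R 1) e)" for e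
      using T(1) has_weak_deriv_zero by (auto simp: single_edge_def)
  qed (intro single_edge_graph_L2 has_weak_deriv_L2[OF T(1)])+
  have z: "cont_rep (edge a b e) (u e) (real_of_ereal c) = 0"
    if "e \<in> E" "c = a e \<or> c = b e" "\<bar>c\<bar> \<noteq> \<infinity>" for e c
  proof (cases "e = e0")
    case True
    then show ?thesis using T(2) that by (auto simp: u_def single_edge_def)
  next
    case False
    then show ?thesis
      using cont_rep_zero[OF edge_nonempty[OF that(1)] finite_end_in_closure[OF edge_nonempty[OF that(1)] that(2,3)]]
      by (simp add: u_def single_edge_def)
  qed
  have fin: "\<bar>a e\<bar> \<noteq> \<infinity>" if "e \<in> E_l E a" for e using that edge_nonempty[of e] by (auto simp: E_l_def)
  have fin': "\<bar>b e\<bar> \<noteq> \<infinity>" if "e \<in> E_r E b" for e using that edge_nonempty[of e] by (auto simp: E_r_def)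
  show "tr_l E a b u = (\<lambda>e. 0)"
  proof
    fix e show "tr_l E a b u e = 0"
      using z[of e "a e"] fin[of e] by (auto simp: tr_l_def E_l_def)
  qed
  show "tr_r E a b u = (\<lambda>e. 0)"
  proof
    fix e show "tr_r E a b u e = 0"
      using z[of e "b e"] fin'[of e] by (auto simp: tr_r_def E_r_def)
  qed
qed

text \<open>
  For a test function \<open>\<phi>\<close> on one edge, orthogonality to the pair \<open>(\<phi>, \<phi>')\<close> is, up to conjugation,
  the defining equation of the weak derivative on that edge.
\<close>

lemma neg_adjoint_subset_max_deriv:
  fixes H :: "(('e \<Rightarrow> real \<Rightarrow> 'k::rc_scalar) \<times> ('e \<Rightarrow> real \<Rightarrow> 'k)) set"
  assumes H: "\<And>u v. (u, v) \<in> max_deriv E a b \<Longrightarrow> tr_l E a b u = (\<lambda>e. 0) \<Longrightarrow> tr_r E a b u = (\<lambda>e. 0) \<Longrightarrow> (u, v) \<in> H"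
  shows "rel_uminus (graph_adjoint E a b H) \<subseteq> max_deriv E a b"
proof (rule subrelI)
  fix f g assume fg: "(f, g) \<in> rel_uminus (graph_adjoint E a b H)"
  then have L: "f \<in> graph_L2 E a b" "g \<in> graph_L2 E a b" and
    adj: "\<And>u v. (u, v) \<in> H \<Longrightarrow> graph_inner E a b v f + graph_inner E a b u g = 0"
    unfolding in_neg_adjoint_iff by blast+
  show "(f, g) \<in> max_deriv E a b"
  proof (rule max_derivI[OF L])
    fix e assume e: "e \<in> E"
    let ?I = "edge a b e"
    have cl: "x \<in> closure ?I" if "x \<in> ?I" for x using that closure_subset by blast
    show "has_weak_deriv ?I (f e) (g e)"
      unfolding has_weak_deriv_def
    proof (intro conjI ballI graph_L2D(1)[OF L(1) e] graph_L2D(1)[OF L(2) e])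
      fix \<phi> assume \<phi>: "\<phi> \<in> test_functions ?I"
      obtain s t where st: "s \<in> ?I" "t \<in> ?I" "s \<le> t" "\<forall>x. x \<notin> {s..t} \<longrightarrow> \<phi> x = 0"
        using test_function_support[OF \<phi> edge_nonempty[OF e]] by blast
      have i: "integrable (lebesgue_on ?I) (\<lambda>x. deriv \<phi> x *\<^sub>R f e x)" "integrable (lebesgue_on ?I) (\<lambda>x. \<phi> x *\<^sub>R g e x)"
        using test_function_LINT(1)[OF test_function_deriv(3)[OF \<phi>] deriv_zero_off_support[OF st(4)] st(1,2)
            L2_absolutely_integrable[OF graph_L2D(1)[OF L(1) e] cl[OF st(1)] cl[OF st(2)]]]
          test_function_LINT(1)[OF test_function_deriv(2)[OF \<phi>] st(4) st(1,2)
            L2_absolutely_integrable[OF graph_L2D(1)[OF L(2) e] cl[OF st(1)] cl[OF st(2)]]]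
        by blast+
      have "graph_inner E a b (single_edge e (\<lambda>t. deriv \<phi> t *\<^sub>R 1)) f + graph_inner E a b (single_edge e (\<lambda>t. \<phi> t *\<^sub>R 1)) g = 0"
        by (intro adj H single_edge_test_function e \<phi>)
      then have "kconj (LINT t|lebesgue_on ?I. deriv \<phi> t *\<^sub>R f e t) = kconj (- (LINT t|lebesgue_on ?I. \<phi> t *\<^sub>R g e t))"
        by (simp add: graph_inner_single_edge[OF e] L2_inner_real_left[OF i(1)] L2_inner_real_left[OF i(2)]
            kconj_minus eq_neg_iff_add_eq_0)
      then show "(LINT t|lebesgue_on ?I. deriv \<phi> t *\<^sub>R f e t) = - (LINT t|lebesgue_on ?I. \<phi> t *\<^sub>R g e t)"
        by (metis kconj_kconj)
    qed
  qed
qed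

lemma in_neg_adjoint_iff_traces:
  fixes H :: "(('e \<Rightarrow> real \<Rightarrow> 'k::rc_scalar) \<times> ('e \<Rightarrow> real \<Rightarrow> 'k)) set"
  assumes H: "H \<subseteq> max_deriv E a b" and fg: "(f, g) \<in> max_deriv E a b"
  shows "(f, g) \<in> rel_uminus (graph_adjoint E a b H) \<longleftrightarrow>
    (\<forall>u v. (u, v) \<in> H \<longrightarrow> ell2_inner (E_r E b) (tr_r E a b u) (tr_r E a b f)
       = ell2_inner (E_l E a) (tr_l E a b u) (tr_l E a b f))"
proof -
  have "graph_inner E a b v f + graph_inner E a b u g = 0 \<longleftrightarrow>
    ell2_inner (E_r E b) (tr_r E a b u) (tr_r E a b f) = ell2_inner (E_l E a) (tr_l E a b u) (tr_l E a b f)"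
    if "(u, v) \<in> H" for u v
    using Green_graph[OF fg subsetD[OF H that]] by simp
  then show ?thesis unfolding in_neg_adjoint_iff using max_derivD(1,2)[OF fg] by auto
qed

text \<open>
  Since every pair of \<open>\<ell>\<^sub>2(E\<^sub>r) \<times> \<ell>\<^sub>2(E\<^sub>l)\<close> is a pair of traces, equality of \<open>H\<close> and \<open>-H\<^sup>*\<close> is equality of the
  set \<open>R\<close> of traces of \<open>D(H)\<close> with its own orthogonal complement.
\<close>

lemma skew_self_adjoint_imp_unitary:
  fixes H :: "(('e \<Rightarrow> real \<Rightarrow> 'k::rc_scalar) \<times> ('e \<Rightarrow> real \<Rightarrow> 'k)) set"
  assumes H: "H \<subseteq> max_deriv E a b" and skew: "skew_self_adjoint E a b H"
  shows "\<exists>L. ell2_unitary (E_r E b) (E_l E a) L \<and>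
    Domain H = {f \<in> Domain (max_deriv E a b). L (tr_r E a b f) = tr_l E a b f}"
proof -
  define R where "R = {(tr_r E a b f, tr_l E a b f) | f g. (f, g) \<in> H}"
  have key: "(f, g) \<in> H" if fg: "(f, g) \<in> max_deriv E a b"
    and R: "\<And>y' x'. (y', x') \<in> R \<Longrightarrow> ell2_inner (E_r E b) y' (tr_r E a b f) = ell2_inner (E_l E a) x' (tr_l E a b f)" for f g
  proof -
    have "(f, g) \<in> rel_uminus (graph_adjoint E a b H)"
      unfolding in_neg_adjoint_iff_traces[OF H fg] using R unfolding R_def by blast
    then show ?thesis using skew by (simp add: skew_self_adjoint_def)
  qed
  have sym: "ell2_inner (E_r E b) y' (tr_r E a b f) = ell2_inner (E_l E a) x' (tr_l E a b f)"
    if fg: "(f, g) \<in> H" and "(y', x') \<in> R" for f g y' x'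
  proof -
    have "(f, g) \<in> rel_uminus (graph_adjoint E a b H)"
      using fg skew by (simp add: skew_self_adjoint_def)
    then show ?thesis
      using that(2) unfolding in_neg_adjoint_iff_traces[OF H subsetD[OF H fg]] by (auto simp: R_def)
  qed
  have "self_orthogonal (E_r E b) (E_l E a) R"
    unfolding self_orthogonal_def
  proof (intro allI iffI)
    fix y x assume "(y, x) \<in> R"
    then obtain f g where f: "(f, g) \<in> H" "y = tr_r E a b f" "x = tr_l E a b f" by (auto simp: R_def)
    show "y \<in> ell2 (E_r E b) \<and> x \<in> ell2 (E_l E a) \<and>
        (\<forall>y' x'. (y', x') \<in> R \<longrightarrow> ell2_inner (E_r E b) y' y = ell2_inner (E_l E a) x' x)"
      using traces_ell2[OF subsetD[OF H f(1)]] sym[OF f(1)] unfolding f by blast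
  next
    fix y x
    assume A: "y \<in> ell2 (E_r E b) \<and> x \<in> ell2 (E_l E a) \<and>
        (\<forall>y' x'. (y', x') \<in> R \<longrightarrow> ell2_inner (E_r E b) y' y = ell2_inner (E_l E a) x' x)"
    then obtain f g where f: "(f, g) \<in> max_deriv E a b" "tr_l E a b f = x" "tr_r E a b f = y"
      using traces_surjective by blast
    have "(f, g) \<in> H" by (rule key[OF f(1)]) (use A f in auto)
    then show "(y, x) \<in> R" unfolding R_def using f by blast
  qed
  from self_orthogonal_unitary[OF this] obtain L where L: "ell2_unitary (E_r E b) (E_l E a) L"
    and graph: "\<And>y x. (y, x) \<in> R \<longleftrightarrow> y \<in> ell2 (E_r E b) \<and> L y = x" by blast
  have "f \<in> Domain H \<longleftrightarrow> f \<in> Domain (max_deriv E a b) \<and> L (tr_r E a b f) = tr_l E a b f" for f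
  proof
    assume "f \<in> Domain H"
    then obtain g where fg: "(f, g) \<in> H" by blast
    then have "(tr_r E a b f, tr_l E a b f) \<in> R" unfolding R_def by blast
    then show "f \<in> Domain (max_deriv E a b) \<and> L (tr_r E a b f) = tr_l E a b f"
      using subsetD[OF H fg] unfolding graph by (simp add: DomainI)
  next
    assume A: "f \<in> Domain (max_deriv E a b) \<and> L (tr_r E a b f) = tr_l E a b f"
    then obtain g where fg: "(f, g) \<in> max_deriv E a b" by blast
    then have "(tr_r E a b f, tr_l E a b f) \<in> R" unfolding graph using A traces_ell2 by blast
    then obtain f0 g0 where f0: "(f0, g0) \<in> H" "tr_r E a b f = tr_r E a b f0" "tr_l E a b f = tr_l E a b f0"
      unfolding R_def by blast
    have "(f, g) \<in> H" by (rule key[OF fg]) (use sym[OF f0(1)] f0 in auto)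
    then show "f \<in> Domain H" by blast
  qed
  then show ?thesis using L by blast
qed

text \<open>
  Weak derivatives are unique almost everywhere, and an operator contains all representatives of
  its elements; so its domain determines its graph.
\<close>

lemma operator_eq_restricted_max_deriv:
  fixes H :: "(('e \<Rightarrow> real \<Rightarrow> 'k::rc_scalar) \<times> ('e \<Rightarrow> real \<Rightarrow> 'k)) set"
  assumes H: "H \<subseteq> max_deriv E a b" and op: "graph_operator E a b H"
  shows "(f, g) \<in> H \<longleftrightarrow> (f, g) \<in> max_deriv E a b \<and> f \<in> Domain H"
proof
  assume A: "(f, g) \<in> max_deriv E a b \<and> f \<in> Domain H"
  then obtain g' where g': "(f, g') \<in> H" by blast
  have "graph_eq E a b g' g"
    unfolding graph_eq_def
    using has_weak_deriv_unique[OF edge_nonempty max_derivD(3)[OF subsetD[OF H g']] max_derivD(3)[OF conjunct1[OF A]]]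
    by blast
  moreover have "graph_eq E a b f f" by (simp add: graph_eq_def)
  moreover have "f \<in> graph_L2 E a b" "g \<in> graph_L2 E a b" using max_derivD A by blast+
  ultimately show "(f, g) \<in> H" using op g' unfolding graph_operator_def by blast
qed (use H in blast)

text \<open>
  Let \<open>f\<close> satisfy the trace condition of \<open>-H\<^sup>*\<close> and put \<open>d = L tr\<^sub>r f - tr\<^sub>l f\<close>. Some \<open>u\<close> has the traces
  \<open>tr\<^sub>l u = d\<close> and \<open>tr\<^sub>r u = w\<close> with \<open>L w = d\<close>. It belongs to \<open>D(H)\<close>, and the condition for this \<open>u\<close>
  reads \<open>\<langle>d, d\<rangle> = 0\<close>.
\<close>

lemma unitary_imp_skew_self_adjoint:
  fixes H :: "(('e \<Rightarrow> real \<Rightarrow> 'k::rc_scalar) \<times> ('e \<Rightarrow> real \<Rightarrow> 'k)) set"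
  assumes H: "H \<subseteq> max_deriv E a b" and op: "graph_operator E a b H"
    and L: "ell2_unitary (E_r E b) (E_l E a) L"
    and dom: "Domain H = {f \<in> Domain (max_deriv E a b). L (tr_r E a b f) = tr_l E a b f}"
  shows "skew_self_adjoint E a b H"
proof -
  have iff: "(f, g) \<in> H \<longleftrightarrow> (f, g) \<in> max_deriv E a b \<and> L (tr_r E a b f) = tr_l E a b f" for f g
    unfolding operator_eq_restricted_max_deriv[OF H op] dom by blast
  have bij: "bij_betw L (ell2 (E_r E b)) (ell2 (E_l E a))"
    and Lip: "\<And>x y. x \<in> ell2 (E_r E b) \<Longrightarrow> y \<in> ell2 (E_r E b) \<Longrightarrow> ell2_inner (E_l E a) (L x) (L y) = ell2_inner (E_r E b) x y"
    and Lsc: "\<And>c x. x \<in> ell2 (E_r E b) \<Longrightarrow> L (\<lambda>e. c * x e) = (\<lambda>e. c * L x e)"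
    using L unfolding ell2_unitary_def by blast+
  have L0: "L (\<lambda>e. 0) = (\<lambda>e. 0)" using Lsc[OF ell2_zero, of 0] by simp
  have sub: "rel_uminus (graph_adjoint E a b H) \<subseteq> max_deriv E a b"
    by (rule neg_adjoint_subset_max_deriv) (simp add: iff L0)
  have "(f, g) \<in> H \<longleftrightarrow> (f, g) \<in> rel_uminus (graph_adjoint E a b H)" for f g
  proof (cases "(f, g) \<in> max_deriv E a b")
    case False
    then show ?thesis using H sub by blast
  next
    case fg: True
    let ?y = "tr_r E a b f" and ?x = "tr_l E a b f"
    have yx: "?y \<in> ell2 (E_r E b)" "?x \<in> ell2 (E_l E a)" using traces_ell2[OF fg] by blast+
    have Ly: "L ?y \<in> ell2 (E_l E a)" using bij yx by (auto dest: bij_betwE)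
    show ?thesis
      unfolding in_neg_adjoint_iff_traces[OF H fg]
    proof
      assume "(f, g) \<in> H"
      then have f: "L ?y = ?x" using iff by blast
      show "\<forall>u v. (u, v) \<in> H \<longrightarrow> ell2_inner (E_r E b) (tr_r E a b u) ?y = ell2_inner (E_l E a) (tr_l E a b u) ?x"
      proof (intro allI impI)
        fix u v assume uv: "(u, v) \<in> H"
        then have u: "L (tr_r E a b u) = tr_l E a b u" using iff by blast
        show "ell2_inner (E_r E b) (tr_r E a b u) ?y = ell2_inner (E_l E a) (tr_l E a b u) ?x"
          using Lip[OF traces_ell2(2)[OF subsetD[OF H uv]] yx(1)] unfolding u f by simp
      qed
    next
      assume A: "\<forall>u v. (u, v) \<in> H \<longrightarrow> ell2_inner (E_r E b) (tr_r E a b u) ?y = ell2_inner (E_l E a) (tr_l E a b u) ?x"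
      define d where "d e = L ?y e - ?x e" for e
      have d: "d \<in> ell2 (E_l E a)" unfolding d_def[abs_def] by (rule ell2_diff[OF Ly yx(2)])
      obtain w where w: "w \<in> ell2 (E_r E b)" "L w = d" using bij d by (metis bij_betw_imp_surj_on imageE)
      obtain u v where uv: "(u, v) \<in> max_deriv E a b" "tr_l E a b u = d" "tr_r E a b u = w"
        using traces_surjective[OF d w(1)] by blast
      then have "(u, v) \<in> H" using iff w by simp
      then have "ell2_inner (E_r E b) w ?y = ell2_inner (E_l E a) d ?x" using A uv by blast
      then have "ell2_inner (E_l E a) d (L ?y) = ell2_inner (E_l E a) d ?x" using Lip[OF w(1) yx(1)] w(2) by simp
      then have "ell2_inner (E_l E a) d d = 0"
        using ell2_inner_linear(2)[OF Ly yx(2) d] by (simp add: d_def[abs_def])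
      then have "ell2_normsq (E_l E a) d = 0" using ell2_inner_self[OF d] by simp
      then have "d = (\<lambda>e. 0)" by (rule ell2_normsq_eq_0[OF d])
      then have "L ?y = ?x" by (auto simp: d_def fun_eq_iff)
      then show "(f, g) \<in> H" using iff fg by blast
    qed
  qed
  then show ?thesis unfolding skew_self_adjoint_def by auto
qed

end

theorem theorem3p5:
  fixes V :: "'v set" and E :: "'e set"
    and a b :: "'e \<Rightarrow> ereal" and \<gamma>0 \<gamma>1 :: "'e \<Rightarrow> 'v"
    and H :: "(('e \<Rightarrow> real \<Rightarrow> 'k::rc_scalar) \<times> ('e \<Rightarrow> real \<Rightarrow> 'k)) set"
  assumes "metric_graph V E a b \<gamma>0 \<gamma>1"
    and "(INF e\<in>E. b e - a e) > 0"
    and "graph_operator E a b H"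
    and "H \<subseteq> max_deriv E a b"
  shows "skew_self_adjoint E a b H \<longleftrightarrow>
    (\<exists>L. ell2_unitary (E_r E b) (E_l E a) L \<and>
      Domain H = {f \<in> Domain (max_deriv E a b). L (tr_r E a b f) = tr_l E a b f})"
proof -
  obtain l where l: "0 < ereal l" "ereal l < (INF e\<in>E. b e - a e)"
    using ereal_dense2[OF assms(2)] by blast
  interpret uniformly_long_edges E a b l
  proof
    show "a e < b e" if "e \<in> E" for e using metric_graph.a_less_b[OF assms(1) that] .
    show "l > 0" using l(1) by simp
    show "ereal l \<le> b e - a e" if "e \<in> E" for e
      using l(2) INF_lower[OF that, of "\<lambda>e. b e - a e"] by (meson less_imp_le order_trans)
  qed
  show ?thesis
    using skew_self_adjoint_imp_unitary[OF assms(4)] unitary_imp_skew_self_adjoint[OF assms(4,3)] by blast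
qed

end
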